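(* Let $A(z)=\sum_{k\ge0}\prod_{1\le j\le k}\bigl(e^{jz}-1\bigr)$ (a formal power series) and $a_n=[z^n]A(z)$. Then as $n\to\infty$, \[ a_n=c\,\rho^n n^{n+\frac12}\bigl(1+O(n^{-1})\bigr),\qquad c=\frac{12}{\pi^{3/2}},\quad \rho=\frac{12}{e\pi^2}. \]
   Context: $[z^n]F(z)$ denotes the coefficient of $z^n$ in the formal power series $F$. Each product $\prod_{1\le j\le k}(e^{jz}-1)$ is $O(z^k)$, so the sum defines a formal power series. *)

theory Defs
  imports "HOL-Analysis.Analysis" "HOL-Library.Landau_Symbols"
begin

text \<open>
  The infinite sum is taken in the metric (z-adic) topology of \<^typ>\<open>real fps\<close>;
  \<open>fps_exp c\<close> is the formal series of $e^{cz}$.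
\<close>
definition A :: "real fps" where
  "A = (\<Sum>k. \<Prod>j\<in>{1..k}. (fps_exp (of_nat j) - 1))"

definition a :: "nat \<Rightarrow> real" where
  "a n = fps_nth A n"

definition c :: real where
  "c = 12 / pi powr (3/2)"

definition \<rho> :: real where
  "\<rho> = 12 / (exp 1 * pi\<^sup>2)"

text \<open>The series converges, so the unspecified value of a divergent sum is not involved.\<close>

lemma prod_nth_eq_0:
  assumes "n < k"
  shows "fps_nth (\<Prod>j\<in>{1..k}. (fps_exp (of_nat j :: real) - 1)) n = 0"
  using assms
proof (induction k arbitrary: n)
  case 0
  then show ?case by simp
next
  case (Suc k)
  let ?P = "\<Prod>j\<in>{1..k}. (fps_exp (of_nat j :: real) - 1)"
  have "fps_nth (?P * (fps_exp (of_nat (Suc k)) - 1)) n = 0"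
    unfolding fps_mult_nth
  proof (rule sum.neutral, rule ballI)
    fix i assume i: "i \<in> {0..n}"
    show "fps_nth ?P i * fps_nth (fps_exp (of_nat (Suc k)) - 1) (n - i) = 0"
    proof (cases "i < k")
      case True
      then show ?thesis using Suc.IH by simp
    next
      case False
      then have "n - i = 0" using i Suc.prems by auto
      then show ?thesis by simp
    qed
  qed
  then show ?case by (subst prod.nat_ivl_Suc') (simp_all only: mult.commute le_add2 Suc_eq_plus1)
qed

lemma A_sums: "(\<lambda>k. \<Prod>j\<in>{1..k}. (fps_exp (of_nat j :: real) - 1)) sums A"
proof -
  let ?P = "\<lambda>k. \<Prod>j\<in>{1..k}. (fps_exp (of_nat j :: real) - 1)"
  let ?B = "Abs_fps (\<lambda>n. \<Sum>k\<le>n. fps_nth (?P k) n)"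
  have "(\<lambda>m. \<Sum>k<m. ?P k) \<longlonglongrightarrow> ?B"
  proof (rule tendsto_fpsI)
    fix n
    show "\<forall>\<^sub>F m in sequentially. fps_nth (\<Sum>k<m. ?P k) n = fps_nth ?B n"
    proof (rule eventually_mono[OF eventually_gt_at_top[of n]])
      fix m assume m: "n < m"
      have "(\<Sum>k<m. fps_nth (?P k) n) = (\<Sum>k\<le>n. fps_nth (?P k) n)"
        using m by (intro sum.mono_neutral_right ballI prod_nth_eq_0) auto
      then show "fps_nth (\<Sum>k<m. ?P k) n = fps_nth ?B n"
        by (simp only: fps_sum_nth fps_nth_Abs_fps)
    qed
  qed
  then have "?P sums ?B" by (simp only: sums_def)
  then show ?thesis
    unfolding A_def by (rule sums_summable[THEN summable_sums])
qed

end

theory Submission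
  imports Defs "HOL-Complex_Analysis.Complex_Analysis" "HOL-Probability.Distributions"
    "HOL-Real_Asymp.Real_Asymp"
begin

text \<open>
  Write $P_k(z) = \prod_{j\le k}(e^{jz}-1)$, so that $a_n = \sum_k [z^n] P_k(z)$. Cauchy's formula for
  the $k$-th coefficient is used on the circle $|z| = \log 2/k$, whose radius depends on $k$ but not on $n$: with $z = s/k$,
  $a_n = \frac{1}{2\pi}\int \sum_k k^n P_k(s/k) s^{-n} d\theta$ where $s = (\log 2) e^{i\theta}$.
  The trapezoidal rule gives $P_k(s/k) = \sqrt{2\pi k}\, e^{-k\eta(s)} \sqrt{(e^s-1)/s}\,(1 + O(1/k))$
  with $-s\,\eta(s) = \Lambda(s)$ and $\Lambda' (s)= \log(e^s-1)$. Since $\mathrm{Re}\,\eta > 0$ on the whole circle, the sum over $k$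
  can be carried out first; after linearising $\sqrt k$ at the dominant $k = n/\eta(\log 2)$ it involves only
  $\sum_k k^m e^{-k\eta} = m!/\eta^{m+1} + O(m!\,(2/3)^m)$. What remains is an integral of
  $(-\Lambda(s))^{-n}$, which has a nondegenerate saddle at $s = \log 2$, where $\Lambda' = 0$,
  $\Lambda'' = 2$ and $-\Lambda = \pi^2/12$ (a dilogarithm value). The result is
  $a_n = n!\,(12/\pi^2)^n (6\sqrt 2/\pi^2 + O(1/n))$.
\<close>

section \<open>Stirling's formula with error bound\<close>

text \<open>The radius log 2 is dictated by the integrand that remains after the summation: the
  exponent there is -Lambda(s), and Lambda'(s) = log (e^s - 1) vanishes at s = log 2. As the circle
  in s is the same for every k, the whole sum goes under one integral; no estimate of a single
  coefficient of P_k, uniform in k and n, is ever needed. The obstacle is sqrt k, which is no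
  polynomial in k. Its tangent at K = n/eta(log 2) costs (k-K)^2/K^(3/2). Under the weights k^n
  e^(-k eta) the index k has mean about n/eta and variance of order n, so the loss is relatively
  O(1/n). Off the saddle the mean moves; this adds n (R - K')^2 with R = Re eta and K' = eta(log 2),
  which the decay in the angle absorbs. The rate 2/3 is the reciprocal of a Cauchy radius. The
  nearest poles of 1/(1 - e^(-z)) - 1/z are at 2 pi i and -2 pi i, and |Im eta| <= pi + 1 leaves
  room for discs of radius 3/2. This is enough because eta(log 2) = pi^2/(12 log 2) <= 4/3 <
  3/2.\<close>

lemma half_plus_inverse_ln_bounds:
  fixes y :: real
  assumes "0 < y" "y \<le> 1"
  shows "0 \<le> (1/y + 1/2) * ln (1 + y) - 1" "(1/y + 1/2) * ln (1 + y) - 1 \<le> y\<^sup>2 / 4"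
proof -
  have lo: "2 * y / (2 + y) \<le> ln (1 + y)"
    using ln_inverse_approx_ge[of 1 "1+y"] assms by (simp add: add_ac)
  \<comment> \<open>The factor \<open>1/y + 1/2\<close> is the exact reciprocal of the lower bound
    \<open>2 * y / (2 + y)\<close> for the logarithm. At y = 1/n the quantity being bounded is the
    decrement of \<open>ln (stirling_ratio n)\<close>.\<close>
  have "(1/y + 1/2) * (2 * y / (2 + y)) = 1" using assms by (simp add: divide_simps)
  moreover have "(1/y + 1/2) * (2 * y / (2 + y)) \<le> (1/y + 1/2) * ln (1 + y)"
    using lo assms by (intro mult_left_mono) auto
  ultimately show "0 \<le> (1/y + 1/2) * ln (1 + y) - 1" by linarith
  define f where "f = (\<lambda>x::real. x - x^2/2 + x^3/3 - ln (1+x))"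
  have "f 0 \<le> f y"
  proof (rule DERIV_nonneg_imp_nondecreasing[of 0 y])
    fix x assume x: "0 \<le> x" "x \<le> y"
    have "(f has_real_derivative (1 - x + x^2 - 1/(1+x))) (at x)"
      unfolding f_def using x by (auto intro!: derivative_eq_intros simp: power2_eq_square)
    moreover have "1 - x + x^2 - 1/(1+x) = x^3/(1+x)"
      using x by (simp add: field_simps power2_eq_square power3_eq_cube)
    ultimately show "\<exists>z. (f has_real_derivative z) (at x) \<and> 0 \<le> z" using x by auto
  qed (use assms in auto)
  hence "ln (1+y) \<le> y - y^2/2 + y^3/3" by (simp add: f_def)
  hence "(1/y + 1/2) * ln (1 + y) \<le> (1/y + 1/2) * (y - y^2/2 + y^3/3)"
    using assms by (intro mult_left_mono) auto
  also have "\<dots> = 1 + y^2/12 + y^3/6"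
    using assms by (simp add: field_simps power2_eq_square power3_eq_cube)
  also have "y^3 \<le> y^2" using assms by (intro power_decreasing) auto
  finally show "(1/y + 1/2) * ln (1 + y) - 1 \<le> y\<^sup>2 / 4" by linarith
qed

definition stirling_ratio :: "nat \<Rightarrow> real" where
  "stirling_ratio n = fact n * exp (real n) / (real n ^ n * sqrt (real n))"

lemma stirling_ratio_pos: "n > 0 \<Longrightarrow> stirling_ratio n > 0"
  by (simp add: stirling_ratio_def)

lemma ln_stirling_ratio:
  "n > 0 \<Longrightarrow> ln (stirling_ratio n) = ln (fact n) + real n - (real n + 1/2) * ln (real n)"
  by (simp add: stirling_ratio_def ln_div ln_mult ln_realpow ln_sqrt algebra_simps)

text \<open>The upper bound is a telescoping difference on purpose:
  \<open>ln (stirling_ratio n)\<close> decreases while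
  \<open>ln (stirling_ratio n) - 1 / (2 * n)\<close> increases, and the two enclose the
  limit.\<close>

lemma ln_stirling_ratio_diff:
  assumes "n > 0"
  shows "0 \<le> ln (stirling_ratio n) - ln (stirling_ratio (Suc n))"
    and "ln (stirling_ratio n) - ln (stirling_ratio (Suc n)) \<le> 1 / (2 * real n) - 1 / (2 * real (Suc n))"
proof -
  have "ln (fact (Suc n) :: real) = ln (real (Suc n)) + ln (fact n)"
    by (simp add: ln_mult)
  moreover have "ln (real (Suc n)) = ln (real n) + ln (1 + 1 / real n)"
    using assms by (subst ln_mult_pos[symmetric]) (auto simp: algebra_simps add_pos_nonneg)
  ultimately have eq: "ln (stirling_ratio n) - ln (stirling_ratio (Suc n)) =
      (1 / (1 / real n) + 1/2) * ln (1 + 1 / real n) - 1"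
    using assms by (simp add: ln_stirling_ratio algebra_simps)
  show "0 \<le> ln (stirling_ratio n) - ln (stirling_ratio (Suc n))"
    unfolding eq using assms by (intro half_plus_inverse_ln_bounds) auto
  have "ln (stirling_ratio n) - ln (stirling_ratio (Suc n)) \<le> (1 / real n)\<^sup>2 / 4"
    unfolding eq using assms by (intro half_plus_inverse_ln_bounds) auto
  also have "\<dots> \<le> 1 / (2 * real n) - 1 / (2 * real (Suc n))"
    using assms by (simp add: divide_simps power2_eq_square)
  finally show "ln (stirling_ratio n) - ln (stirling_ratio (Suc n)) \<le> 1 / (2 * real n) - 1 / (2 * real (Suc n))" .
qed

text \<open>The powers of n and e cancel in the quotient, and its square is 2 (2n + 1)/n times the
  partial Wallis product \<open>W n\<close>. If the ratio has a nonzero limit L, the quotient tends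
  to L as well, so this fixes L = sqrt (2 pi).\<close>

lemma stirling_ratio_sq_tendsto: "(\<lambda>n. ((stirling_ratio n)\<^sup>2 / stirling_ratio (2*n))\<^sup>2) \<longlonglongrightarrow> 2 * pi"
proof -
  define W where "W = (\<lambda>n. \<Prod>k=1..n. (4*real k^2) / (4*real k^2 - 1))"
  have W: "W n = 16 ^ n * (fact n)^4 / ((fact (2*n))^2 * (2 * real n + 1))" for n
  proof (induction n)
    case (Suc n)
    have "W (Suc n) = W n * ((4*real (Suc n)^2) / (4*real (Suc n)^2 - 1))"
      by (simp add: W_def)
    also have "4*real (Suc n)^2 - 1 = (2 * real n + 1) * (2 * real n + 3)"
      by (simp add: power2_eq_square algebra_simps)
    also have "W n * (4 * (real (Suc n))\<^sup>2 / ((2 * real n + 1) * (2 * real n + 3))) = 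
       16 ^ Suc n * (fact (Suc n))^4 / ((fact (2*Suc n))^2 * (2 * real (Suc n) + 1))"
    proof -
      have *: "P * A ^ 4 / (B\<^sup>2 * (2 * x + 1)) * (4 * (x + 1)\<^sup>2 / ((2 * x + 1) * (2 * x + 3))) =
          16 * P * ((x + 1) * A) ^ 4 / (((2 * x + 2) * (2 * x + 1) * B)\<^sup>2 * (2 * x + 3))"
        if "x \<ge> 0" "B > 0" for x A B P :: real
      proof -
        have "(2 * x + 2)\<^sup>2 = 4 * (x + 1)\<^sup>2" by (simp add: power2_eq_square algebra_simps)
        thus ?thesis using that by (simp add: divide_simps power_mult_distrib) (simp add: power2_eq_square power4_eq_xxxx)
      qed
      show ?thesis unfolding Suc.IH using *[of "real n" "fact (2*n)" "16^n" "fact n"]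
        by (simp add: add_ac)
    qed
    finally show ?case .
  qed (simp add: W_def)
  have "W \<longlonglongrightarrow> pi / 2" unfolding W_def by (rule wallis)
  moreover have "(\<lambda>n. 2 * (2 * real n + 1) / real n) \<longlonglongrightarrow> 4" by real_asymp
  ultimately have "(\<lambda>n. 2 * (2 * real n + 1) / real n * W n) \<longlonglongrightarrow> 4 * (pi / 2)"
    by (intro tendsto_mult)
  moreover have "eventually (\<lambda>n. 2 * (2 * real n + 1) / real n * W n = ((stirling_ratio n)\<^sup>2 / stirling_ratio (2*n))\<^sup>2) sequentially"
    using eventually_gt_at_top[of 0]
  proof eventually_elim
    case (elim n)
    have e: "exp (real (2*n)) = (exp (real n))^2" by (simp add: exp_double[symmetric] power2_eq_square exp_add[symmetric])
    have p4: "(4::real) ^ n = 2 ^ n * 2 ^ n" by (simp flip: power_mult_distrib)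
    have "((stirling_ratio n)\<^sup>2 / stirling_ratio (2*n)) = (fact n)^2 * sqrt 2 * 4 ^ n / (fact (2*n) * sqrt (real n))"
      unfolding stirling_ratio_def e p4 using elim 
      by (simp add: field_simps power_mult_distrib real_sqrt_mult power_mult power2_eq_square)
    hence sq: "((stirling_ratio n)\<^sup>2 / stirling_ratio (2*n))^2 = (fact n)^4 * 2 * 16 ^ n / ((fact (2*n))^2 * real n)"
      using elim by (simp add: power_divide power_mult_distrib flip: power_mult)
         (simp add: power_mult mult.commute[of n 2])
    show ?case unfolding W sq using elim by (simp add: divide_simps)
  qed
  ultimately have "(\<lambda>n. ((stirling_ratio n)\<^sup>2 / stirling_ratio (2*n))\<^sup>2) \<longlonglongrightarrow> 4 * (pi / 2)"
    by (rule Lim_transform_eventually)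
  thus ?thesis by simp
qed

text \<open>Monotone enclosure: \<open>d\<close> decreases and \<open>u\<close> increases to the
  same limit \<open>D\<close>, so every term gives a two-sided bound. Wallis' product identifies
  \<open>exp D\<close>.\<close>

lemma stirling_ratio_bounds:
  assumes "n > 0"
  shows "sqrt (2*pi) \<le> stirling_ratio n" "stirling_ratio n \<le> sqrt (2*pi) * exp (1 / (2 * real n))"
proof -
  \<comment> \<open>The index is shifted because \<open>stirling_ratio 0\<close> is 0, by division
    by zero.\<close>
  define d where "d = (\<lambda>n. ln (stirling_ratio (Suc n)))"
  define u where "u = (\<lambda>n. d n - 1 / (2 * real (Suc n)))"
  have dec: "decseq d" unfolding d_def
    by (rule decseq_SucI) (use ln_stirling_ratio_diff in fastforce)
  have inc: "incseq u" unfolding u_def d_def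
  proof (rule incseq_SucI)
    fix n show "ln (stirling_ratio (Suc n)) - 1 / (2 * real (Suc n))
         \<le> ln (stirling_ratio (Suc (Suc n))) - 1 / (2 * real (Suc (Suc n)))"
      using ln_stirling_ratio_diff(2)[of "Suc n"] by simp
  qed
  have "u 0 \<le> d n" for n
    using incseqD[OF inc, of 0 n] by (simp add: u_def) (smt (verit) divide_nonneg_nonneg of_nat_0_le_iff)
  then obtain D where D: "d \<longlonglongrightarrow> D" "\<And>n. D \<le> d n"
    using decseq_convergent[OF dec] by blast
  have u: "u \<longlonglongrightarrow> D"
  proof -
    have "(\<lambda>n. 1 / (2 * real (Suc n))) \<longlonglongrightarrow> 0" by real_asymp
    from tendsto_diff[OF D(1) this] show ?thesis by (simp add: u_def)
  qed
  have Du: "u n \<le> D" for n using incseq_le[OF inc u] .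
  have "(\<lambda>n. exp (d n)) \<longlonglongrightarrow> exp D" using D by (intro tendsto_intros)
  hence "(\<lambda>n. stirling_ratio (Suc n)) \<longlonglongrightarrow> exp D" by (simp add: d_def stirling_ratio_pos)
  hence q: "stirling_ratio \<longlonglongrightarrow> exp D" by (rule LIMSEQ_imp_Suc)
  have "filterlim (\<lambda>n::nat. 2 * n) at_top sequentially" by real_asymp
  from filterlim_compose[OF q this] have q2: "(\<lambda>n. stirling_ratio (2 * n)) \<longlonglongrightarrow> exp D" .
  have "(\<lambda>n. ((stirling_ratio n)\<^sup>2 / stirling_ratio (2*n))\<^sup>2) \<longlonglongrightarrow> ((exp D)\<^sup>2 / exp D)\<^sup>2"
    by (intro tendsto_intros q q2) auto
  from LIMSEQ_unique[OF this stirling_ratio_sq_tendsto] have "(exp D)\<^sup>2 = 2 * pi"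
    by (simp add: power2_eq_square)
  hence eD: "exp D = sqrt (2*pi)" by (metis exp_ge_zero real_sqrt_abs abs_of_nonneg)
  from assms obtain m where m: "n = Suc m" by (cases n) auto
  have "exp D \<le> exp (d m)" using D(2) by simp
  thus "sqrt (2*pi) \<le> stirling_ratio n" using eD assms stirling_ratio_pos by (simp add: m d_def)
  have "exp (d m) \<le> exp (D + 1 / (2 * real n))" using Du[of m] by (simp add: u_def m)
  thus "stirling_ratio n \<le> sqrt (2*pi) * exp (1 / (2 * real n))" 
    unfolding exp_add using eD assms stirling_ratio_pos by (simp add: m d_def)
qed

lemma stirling_ratio_approx:
  assumes "n > 0"
  shows "\<bar>stirling_ratio n - sqrt (2*pi)\<bar> \<le> sqrt (2*pi) / real n"
proof -
  define x where "x = 1 / (2 * real n)"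
  have x: "0 \<le> x" "x \<le> 1/2" using assms by (auto simp: x_def field_simps)
  have "exp x \<le> 1 + x + x\<^sup>2" using x by (intro exp_bound) auto
  also have "\<dots> \<le> 1 + 2 * x" using x by (simp add: power2_eq_square mult_left_le)
  finally have "exp x \<le> 1 + 1 / real n" by (simp add: x_def)
  hence "sqrt (2*pi) * exp x \<le> sqrt (2*pi) * (1 + 1 / real n)" by (intro mult_left_mono) auto
  thus ?thesis using stirling_ratio_bounds[OF assms] by (simp add: x_def algebra_simps)
qed

section \<open>A complex Laplace method with error bound\<close>

text \<open>\<open>exp (- p * x^2)\<close> is sqrt (pi/p) times the normal density of variance
  1/(2p). The vanishing first and third moments remove the terms of relative order n^(-1/2) from the
  Laplace expansion, which leaves a relative error O(1/n).\<close>

lemma has_bochner_integral_gaussian: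
  fixes p :: real
  assumes "p > 0"
  shows "has_bochner_integral lborel (\<lambda>x. exp (-p * x\<^sup>2)) (sqrt (pi / p))"
    and "has_bochner_integral lborel (\<lambda>x. exp (-p * x\<^sup>2) * x) 0"
    and "has_bochner_integral lborel (\<lambda>x. exp (-p * x\<^sup>2) * x ^ 3) 0"
proof -
  define \<sigma> where "\<sigma> = sqrt (1 / (2 * p))"
  have \<sigma>: "\<sigma> > 0" "\<sigma>\<^sup>2 = 1 / (2 * p)" using assms by (auto simp: \<sigma>_def)
  have nd: "exp (-p * x\<^sup>2) = sqrt (pi / p) * normal_density 0 \<sigma> x" for x
    using assms unfolding normal_density_def \<sigma> by (simp add: field_simps)
  show "has_bochner_integral lborel (\<lambda>x. exp (-p * x\<^sup>2)) (sqrt (pi / p))"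
    unfolding nd using has_bochner_integral_mult_right[OF normal_moment_even[OF \<sigma>(1), of 0 0], of "sqrt (pi / p)"]
    by simp
  show "has_bochner_integral lborel (\<lambda>x. exp (-p * x\<^sup>2) * x) 0"
    unfolding nd using has_bochner_integral_mult_right[OF normal_moment_odd[OF \<sigma>(1), of 0 0], of "sqrt (pi / p)"]
    by (simp add: mult.assoc)
  show "has_bochner_integral lborel (\<lambda>x. exp (-p * x\<^sup>2) * x ^ 3) 0"
    unfolding nd using has_bochner_integral_mult_right[OF normal_moment_odd[OF \<sigma>(1), of 0 1], of "sqrt (pi / p)"]
    by (simp add: mult.assoc)
qed

lemma norm_exp_minus_one_minus_le:
  fixes u :: complex
  shows "norm (exp u - 1 - u) \<le> (norm u)\<^sup>2 * exp (norm u)"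
  using Taylor_exp_field[of u 1] by (simp add: power2_eq_square algebra_simps)

text \<open>Each power is compared with the corresponding single term of the exponential series.
  This trades a polynomial factor for part of the Gaussian decay.\<close>

lemma cubic_le_exp:
  fixes c x :: real
  assumes "c > 0" "x \<ge> 0"
  shows "x + x\<^sup>2 + x ^ 3 \<le> (1 / c + 2 / c\<^sup>2 + 6 / c ^ 3) * exp (c * x)"
proof -
  have *: "x ^ k \<le> (fact k / c ^ k) * exp (c * x)" for k
  proof -
    have "(c * x) ^ k / fact k \<le> exp (c * x)"
    proof -
      have "sum (\<lambda>n. inverse (fact n) * (c * x) ^ n) {k} \<le> (\<Sum>n. inverse (fact n) * (c * x) ^ n)"
        using assms by (intro sum_le_suminf summable_exp) auto
      thus ?thesis by (simp add: exp_def field_simps)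
    qed
    thus ?thesis using assms by (simp add: field_simps power_mult_distrib)
  qed
  show ?thesis using *[of 1] *[of 2] *[of 3] by (simp add: algebra_simps numeral_eq_Suc)
qed

text \<open>With x = n theta^2 and u = -n (b theta^3 + xi), the normalised integrand is exp (-beta
  x) w exp u. Expanding w exp u to first order leaves errors that are polynomials in x divided by n.
  The smallness assumption gives |u| <= beta x / 2, so exp |u| uses up only half of the
  Gaussian.\<close>

lemma laplace_pointwise_near:
  fixes lm w w0 w1 b \<xi> :: complex and \<alpha> \<beta> C M \<theta> :: real
  assumes "\<alpha> > 0" "\<beta> > 0" "C \<ge> 0" "n \<ge> 1"
    and lm: "lm = \<alpha> * exp (\<beta> * \<theta>\<^sup>2 + b * of_real \<theta> ^ 3 + \<xi>)"
    and \<xi>: "norm \<xi> \<le> C * \<theta> ^ 4"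
    and w: "norm (w - w0 - w1 * \<theta>) \<le> C * \<theta>\<^sup>2" and M: "norm w \<le> M"
    and small: "\<bar>\<theta>\<bar> \<le> 1" "(norm b + C) * \<bar>\<theta>\<bar> \<le> \<beta> / 2"
  shows "norm (\<alpha> ^ n * w / lm ^ n - exp (- real n * \<beta> * \<theta>\<^sup>2) * (w0 + w1 * \<theta> - n * w0 * b * of_real \<theta> ^ 3))
     \<le> (M * (norm b + C)\<^sup>2 + C + (norm w1 + C) * (norm b + C) + norm w0 * C) / n *
        (n * \<theta>\<^sup>2 + (n * \<theta>\<^sup>2)\<^sup>2 + (n * \<theta>\<^sup>2) ^ 3) * exp (- (\<beta> / 2) * (n * \<theta>\<^sup>2))"
proof -
  define B where "B = norm b + C"
  define x where "x = n * \<theta>\<^sup>2"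
  define u where "u = - (n * (b * of_real \<theta> ^ 3 + \<xi>))"
  have B: "B \<ge> 0" "C \<le> B" using assms by (auto simp: B_def)
  have x: "x \<ge> 0" by (simp add: x_def)
  have M0: "M \<ge> 0" using M norm_ge_zero order_trans by blast
  have th4: "\<theta> ^ 4 \<le> \<bar>\<theta>\<bar> ^ 3"
    using power_decreasing[of 3 4 "\<bar>\<theta>\<bar>"] small by (simp add: power_even_abs)
  have th2: "\<theta>\<^sup>2 \<le> \<bar>\<theta>\<bar>"
    using power_decreasing[of 1 2 "\<bar>\<theta>\<bar>"] small by (simp add: power_even_abs)
  have u1: "norm u \<le> n * (B * \<bar>\<theta>\<bar> ^ 3)"
  proof -
    have "norm (b * of_real \<theta> ^ 3 + \<xi>) \<le> norm b * \<bar>\<theta>\<bar> ^ 3 + C * \<theta> ^ 4"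
      using \<xi> by (intro order.trans[OF norm_triangle_ineq] add_mono) (auto simp: norm_mult norm_power)
    also have "\<dots> \<le> B * \<bar>\<theta>\<bar> ^ 3"
      using mult_left_mono[OF th4 \<open>C \<ge> 0\<close>] by (simp add: B_def algebra_simps)
    finally show ?thesis by (simp add: u_def norm_mult mult_left_mono)
  qed
  have u2: "norm u \<le> \<beta> / 2 * x"
  proof -
    have "n * (B * \<bar>\<theta>\<bar> ^ 3) = (B * \<bar>\<theta>\<bar>) * x"
      by (simp add: x_def power3_eq_cube power2_eq_square)
    also have "\<dots> \<le> \<beta> / 2 * x" using small x by (intro mult_right_mono) (auto simp: B_def)
    finally show ?thesis using u1 by simp
  qed
  have "lm ^ n = \<alpha> ^ n * exp (n * (\<beta> * \<theta>\<^sup>2 + b * of_real \<theta> ^ 3 + \<xi>))"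
    by (simp add: lm power_mult_distrib exp_of_nat_mult)
  also have "exp (n * (\<beta> * \<theta>\<^sup>2 + b * of_real \<theta> ^ 3 + \<xi>)) = exp (of_real (\<beta> * x)) * exp (- u)"
    by (simp add: u_def x_def exp_add[symmetric] algebra_simps)
  finally have "\<alpha> ^ n * w / lm ^ n = exp (- of_real (\<beta> * x)) * (w * exp u)"
    using assms by (simp add: exp_minus field_simps)
  moreover have "exp (- real n * \<beta> * \<theta>\<^sup>2) = exp (- (\<beta> * x))" by (simp add: x_def mult_ac)
  hence "complex_of_real (exp (- real n * \<beta> * \<theta>\<^sup>2)) = exp (- of_real (\<beta> * x))" 
    by (metis exp_of_real of_real_minus)
  ultimately have "norm (\<alpha> ^ n * w / lm ^ n - exp (- real n * \<beta> * \<theta>\<^sup>2) * (w0 + w1 * \<theta> - n * w0 * b * of_real \<theta> ^ 3))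
     = exp (- \<beta> * x) * norm (w * exp u - (w0 + w1 * \<theta> - n * w0 * b * of_real \<theta> ^ 3))"
    by (simp add: norm_mult flip: right_diff_distrib)
  \<comment> \<open>The four remainders have sizes x^3/n, x/n, x^2/n and x^2/n: u^2 is of order n^2
    theta^6, while theta * u and n xi are of order n theta^4.\<close>
  also have "w * exp u - (w0 + w1 * \<theta> - n * w0 * b * of_real \<theta> ^ 3) =
     w * (exp u - 1 - u) + (w - w0 - w1 * \<theta>) + (w - w0) * u - n * w0 * \<xi>"
    by (simp add: u_def algebra_simps)
  also have "norm \<dots> \<le> norm (w * (exp u - 1 - u)) + norm (w - w0 - w1 * \<theta>) + norm ((w - w0) * u) + norm (n * w0 * \<xi>)"
    by (intro order.trans[OF norm_triangle_ineq4] add_mono order.trans[OF norm_triangle_ineq] order.refl)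
  also have "\<dots> \<le> M * (B\<^sup>2 * (x^3 / n)) * exp (\<beta> / 2 * x) + C * (x / n) + (norm w1 + C) * B * (x\<^sup>2 / n) + norm w0 * C * (x\<^sup>2 / n)"
  proof (intro add_mono)
    have "norm (w * (exp u - 1 - u)) \<le> M * ((norm u)\<^sup>2 * exp (norm u))"
      unfolding norm_mult using M M0 by (intro mult_mono norm_exp_minus_one_minus_le) auto
    also have "\<dots> \<le> M * ((n * (B * \<bar>\<theta>\<bar> ^ 3))\<^sup>2 * exp (\<beta> / 2 * x))"
      using u1 u2 M0 by (intro mult_left_mono mult_mono power_mono) auto
    also have "(n * (B * \<bar>\<theta>\<bar> ^ 3))\<^sup>2 = B\<^sup>2 * (x^3 / n)"
      using assms by (simp add: x_def power_mult_distrib field_simps eval_nat_numeral)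
    finally show "norm (w * (exp u - 1 - u)) \<le> M * (B\<^sup>2 * (x^3 / n)) * exp (\<beta> / 2 * x)" by (simp add: mult_ac)
    show "norm (w - w0 - w1 * \<theta>) \<le> C * (x / n)" using w assms by (simp add: x_def)
    have "norm (w - w0) \<le> norm (w - w0 - w1 * \<theta>) + norm (w1 * \<theta>)"
      by (metis diff_add_cancel norm_triangle_ineq)
    also have "\<dots> \<le> C * \<bar>\<theta>\<bar> + norm w1 * \<bar>\<theta>\<bar>"
      using order.trans[OF w mult_left_mono[OF th2 \<open>C \<ge> 0\<close>]] by (simp add: norm_mult)
    finally have "norm (w - w0) \<le> (norm w1 + C) * \<bar>\<theta>\<bar>" by (simp add: algebra_simps)
    hence "norm ((w - w0) * u) \<le> ((norm w1 + C) * \<bar>\<theta>\<bar>) * (n * (B * \<bar>\<theta>\<bar> ^ 3))"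
      unfolding norm_mult using u1 \<open>C \<ge> 0\<close> by (intro mult_mono) auto
    also have "\<dots> = (norm w1 + C) * B * (x\<^sup>2 / n)"
      using assms by (simp add: x_def power_mult_distrib field_simps eval_nat_numeral)
    finally show "norm ((w - w0) * u) \<le> (norm w1 + C) * B * (x\<^sup>2 / n)" .
    have "norm (n * w0 * \<xi>) \<le> n * norm w0 * (C * \<theta> ^ 4)"
      unfolding norm_mult using \<xi> by (intro mult_mono) auto
    also have "\<dots> = norm w0 * C * (x\<^sup>2 / n)"
      using assms by (simp add: x_def power_mult_distrib field_simps eval_nat_numeral)
    finally show "norm (n * w0 * \<xi>) \<le> norm w0 * C * (x\<^sup>2 / n)" .
  qed
  also have "\<dots> \<le> ((M * B\<^sup>2 + C + (norm w1 + C) * B + norm w0 * C) / n * (x + x\<^sup>2 + x^3)) * exp (\<beta> / 2 * x)"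
  proof -
    define E where "E = exp (\<beta> / 2 * x)"
    have E: "E \<ge> 1" unfolding E_def using assms x by simp
    have mono: "p * (y / n) \<le> p / n * (x + x\<^sup>2 + x^3) * E" if "p \<ge> 0" "y \<le> x + x\<^sup>2 + x^3" for p y
    proof -
      have "p * (y / n) \<le> p * ((x + x\<^sup>2 + x^3) / n)"
        using that by (intro mult_left_mono divide_right_mono) auto
      also have "\<dots> \<le> p * ((x + x\<^sup>2 + x^3) / n) * E"
        using that x E by (intro mult_right_le_one_le[THEN order.trans] mult_left_mono[of 1 E, simplified]) auto
      finally show ?thesis by simp
    qed
    have 1: "M * (B\<^sup>2 * (x^3 / n)) * E \<le> (M * B\<^sup>2) / n * (x + x\<^sup>2 + x^3) * E"
    proof -
      have "(M * B\<^sup>2) / n * x^3 * E \<le> (M * B\<^sup>2) / n * (x + x\<^sup>2 + x^3) * E"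
        using M0 x E by (intro mult_right_mono mult_left_mono) auto
      thus ?thesis by simp
    qed
    show ?thesis
      using 1 mono[of C x] mono[of "(norm w1 + C) * B" "x\<^sup>2"] mono[of "norm w0 * C" "x\<^sup>2"] x assms(3) B
      unfolding E_def[symmetric] add_divide_distrib distrib_right by simp
  qed
  finally have "norm (\<alpha> ^ n * w / lm ^ n - exp (- real n * \<beta> * \<theta>\<^sup>2) * (w0 + w1 * \<theta> - n * w0 * b * of_real \<theta> ^ 3)) \<le> 
    exp (- \<beta> * x) * (((M * B\<^sup>2 + C + (norm w1 + C) * B + norm w0 * C) / n * (x + x\<^sup>2 + x^3)) * exp (\<beta> / 2 * x))"
    by simp
  also have "\<dots> = (M * B\<^sup>2 + C + (norm w1 + C) * B + norm w0 * C) / n * (x + x\<^sup>2 + x^3) * (exp (- \<beta> * x) * exp (\<beta> / 2 * x))"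
    by (simp add: mult_ac)
  also have "exp (- \<beta> * x) * exp (\<beta> / 2 * x) = exp (- (\<beta> / 2) * x)"
    by (simp add: exp_add[symmetric] field_simps)
  finally show ?thesis by (simp add: x_def B_def)
qed

text \<open>Away from 0 the integrand and its Gaussian model are bounded separately. Since |theta|
  >= delta, each of 1, |theta| and n |theta|^3 is at most (x + x^2 + x^3)/(delta^2 n) with x = n
  theta^2. The bound thus takes the same shape as near 0, and one estimate covers the whole
  line.\<close>

lemma laplace_pointwise_far:
  fixes w0 w1 b v :: complex and \<beta> \<kappa> \<delta> \<theta> M :: real and n :: nat
  assumes "\<beta> > 0" "0 < \<kappa>" "\<kappa> \<le> \<beta>" "n \<ge> 1" "0 < \<delta>" "\<delta> \<le> 1" "\<delta> \<le> \<bar>\<theta>\<bar>"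
    and v: "norm v \<le> M * exp (- \<kappa> * (n * \<theta>\<^sup>2))" "M \<ge> 0"
  shows "norm (v - exp (- real n * \<beta> * \<theta>\<^sup>2) * (w0 + w1 * \<theta> - n * w0 * b * of_real \<theta> ^ 3))
     \<le> (M + norm w0 + norm w1 + norm (w0 * b)) / \<delta>\<^sup>2 / n *
        (n * \<theta>\<^sup>2 + (n * \<theta>\<^sup>2)\<^sup>2 + (n * \<theta>\<^sup>2) ^ 3) * exp (- \<kappa> * (n * \<theta>\<^sup>2))"
proof -
  define x where "x = n * \<theta>\<^sup>2"
  have x: "x \<ge> 0" by (simp add: x_def)
  define P where "P = (x + x\<^sup>2 + x ^ 3) / \<delta>\<^sup>2 / n"
  have d2: "\<delta>\<^sup>2 \<le> \<delta>" using assms by (simp add: power2_eq_square mult_left_le)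
  have d2': "\<delta>\<^sup>2 \<le> \<theta>\<^sup>2" using assms by (metis abs_le_square_iff abs_of_pos)
  have nn: "real n * (t * \<delta>\<^sup>2) \<le> x + x\<^sup>2 + x ^ 3 \<Longrightarrow> t \<le> P" for t
    unfolding P_def using assms by (simp add: field_simps)
  have 1: "1 \<le> P"
  proof (rule nn)
    have "real n * (1 * \<delta>\<^sup>2) \<le> x" using mult_left_mono[OF d2', of "real n"] by (simp add: x_def)
    thus "real n * (1 * \<delta>\<^sup>2) \<le> x + x\<^sup>2 + x ^ 3" using x by (smt (verit) zero_le_power)
  qed
  have 2: "\<bar>\<theta>\<bar> \<le> P"
  proof (rule nn)
    have "\<bar>\<theta>\<bar> * \<delta>\<^sup>2 \<le> \<bar>\<theta>\<bar> * \<bar>\<theta>\<bar>" using d2 assms by (intro mult_left_mono) auto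
    hence "real n * (\<bar>\<theta>\<bar> * \<delta>\<^sup>2) \<le> x" by (simp add: x_def power2_eq_square mult_left_mono)
    thus "real n * (\<bar>\<theta>\<bar> * \<delta>\<^sup>2) \<le> x + x\<^sup>2 + x ^ 3" using x by (smt (verit) zero_le_power)
  qed
  have 3: "n * \<bar>\<theta>\<bar> ^ 3 \<le> P"
  proof (rule nn)
    have "\<bar>\<theta>\<bar> ^ 3 * \<delta>\<^sup>2 \<le> \<bar>\<theta>\<bar> ^ 3 * \<bar>\<theta>\<bar>" using d2 assms by (intro mult_left_mono) auto
    also have "\<dots> = \<theta> ^ 4" by (simp add: power_Suc2[symmetric] power_even_abs del: power_Suc)
    finally have "real n * (n * \<bar>\<theta>\<bar> ^ 3 * \<delta>\<^sup>2) \<le> n * (n * \<theta> ^ 4)"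
      by (simp add: mult.assoc mult_left_mono)
    also have "\<dots> = x\<^sup>2" by (simp add: x_def power2_eq_square eval_nat_numeral)
    finally show "real n * (n * \<bar>\<theta>\<bar> ^ 3 * \<delta>\<^sup>2) \<le> x + x\<^sup>2 + x ^ 3" using x by (smt (verit) zero_le_power)
  qed
  have e: "exp (- real n * \<beta> * \<theta>\<^sup>2) \<le> exp (- \<kappa> * x)"
    using mult_right_mono[OF \<open>\<kappa> \<le> \<beta>\<close> x] by (simp add: x_def mult_ac)
  have "norm (w0 + w1 * \<theta> - n * w0 * b * of_real \<theta> ^ 3) \<le> norm w0 * 1 + norm w1 * \<bar>\<theta>\<bar> + norm (w0 * b) * (n * \<bar>\<theta>\<bar> ^ 3)"
    by (intro order.trans[OF norm_triangle_ineq4] add_mono order.trans[OF norm_triangle_ineq])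
       (auto simp: norm_mult norm_power mult_ac)
  also have "\<dots> \<le> norm w0 * P + norm w1 * P + norm (w0 * b) * P"
    using 1 2 3 by (intro add_mono mult_left_mono) auto
  finally have q: "norm (w0 + w1 * \<theta> - n * w0 * b * of_real \<theta> ^ 3) \<le> norm w0 * P + norm w1 * P + norm (w0 * b) * P" .
  have "norm (v - exp (- real n * \<beta> * \<theta>\<^sup>2) * (w0 + w1 * \<theta> - n * w0 * b * of_real \<theta> ^ 3))
    \<le> norm v + norm (exp (- real n * \<beta> * \<theta>\<^sup>2) * (w0 + w1 * \<theta> - n * w0 * b * of_real \<theta> ^ 3))"
    by (rule norm_triangle_ineq4)
  also have "\<dots> \<le> M * P * exp (- \<kappa> * x) + exp (- \<kappa> * x) * (norm w0 * P + norm w1 * P + norm (w0 * b) * P)"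
  proof (intro add_mono)
    show "norm v \<le> M * P * exp (- \<kappa> * x)"
    proof -
      have "M * 1 * exp (- \<kappa> * x) \<le> M * P * exp (- \<kappa> * x)"
        using 1 \<open>M \<ge> 0\<close> by (intro mult_right_mono mult_left_mono) auto
      thus ?thesis using v by (simp add: x_def)
    qed
    have "norm (exp (- real n * \<beta> * \<theta>\<^sup>2) * (w0 + w1 * \<theta> - n * w0 * b * of_real \<theta> ^ 3)) =
        exp (- real n * \<beta> * \<theta>\<^sup>2) * norm (w0 + w1 * \<theta> - n * w0 * b * of_real \<theta> ^ 3)" by (simp add: norm_mult)
    also have "\<dots> \<le> exp (- \<kappa> * x) * (norm w0 * P + norm w1 * P + norm (w0 * b) * P)"
      using e q by (intro mult_mono) auto
    finally show "norm (exp (- real n * \<beta> * \<theta>\<^sup>2) * (w0 + w1 * \<theta> - n * w0 * b * of_real \<theta> ^ 3)) \<le> 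
      exp (- \<kappa> * x) * (norm w0 * P + norm w1 * P + norm (w0 * b) * P)" .
  qed
  also have "\<dots> = (M + norm w0 + norm w1 + norm (w0 * b)) * P * exp (- \<kappa> * x)"
    by (simp add: algebra_simps)
  finally show ?thesis unfolding P_def x_def by simp
qed


text \<open>The integrand, extended by zero, is compared with its Gaussian model on all of the real
  line, so tails of the model need no separate treatment. The pointwise error is O(1/n) times a
  Gaussian of width n^(-1/2); the model integrates exactly, and its odd terms drop out.\<close>

theorem laplace_integral:
  fixes lm w :: "real \<Rightarrow> complex" and w0 w1 b :: complex and T \<alpha> \<beta> \<kappa> \<delta> C :: real
  assumes lm: "continuous_on {-T..T} lm" and w: "continuous_on {-T..T} w"
    and pos: "\<alpha> > 0" "\<beta> > 0" "\<kappa> > 0" "\<delta> > 0" "\<delta> \<le> T" "C \<ge> 0"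
    and low: "\<And>\<theta>. \<theta> \<in> {-T..T} \<Longrightarrow> \<alpha> * exp (\<kappa> * \<theta>\<^sup>2) \<le> norm (lm \<theta>)"
    and loc: "\<And>\<theta>. \<bar>\<theta>\<bar> \<le> \<delta> \<Longrightarrow>
      \<exists>\<xi>. lm \<theta> = \<alpha> * exp (\<beta> * \<theta>\<^sup>2 + b * of_real \<theta> ^ 3 + \<xi>) \<and> norm \<xi> \<le> C * \<theta> ^ 4"
    and wloc: "\<And>\<theta>. \<bar>\<theta>\<bar> \<le> \<delta> \<Longrightarrow> norm (w \<theta> - w0 - w1 * \<theta>) \<le> C * \<theta>\<^sup>2"
  shows "\<exists>D. \<forall>n\<ge>1. norm (\<alpha> ^ n * integral {-T..T} (\<lambda>\<theta>. w \<theta> / lm \<theta> ^ n) - w0 * sqrt (pi / (n * \<beta>))) 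
     \<le> D / (n * sqrt n)"
proof -
  obtain M where M: "M \<ge> 0" "\<And>\<theta>. \<theta> \<in> {-T..T} \<Longrightarrow> norm (w \<theta>) \<le> M"
  proof -
    have "bounded (w ` {-T..T})"
      using compact_continuous_image[OF w] by (intro compact_imp_bounded) auto
    then obtain M where "\<And>\<theta>. \<theta> \<in> {-T..T} \<Longrightarrow> norm (w \<theta>) \<le> M" 
      unfolding bounded_iff by blast
    thus ?thesis by (intro that[of "max M 0"]) (auto simp: le_max_iff_disj)
  qed
  \<comment> \<open>On this smaller neighbourhood the cubic and quartic terms use up at most half of
    \<open>\<beta>\<close>.\<close>
  define \<delta>' where "\<delta>' = min (min \<delta> 1) (\<beta> / 2 / (norm b + C + 1))"
  have \<delta>': "\<delta>' > 0" "\<delta>' \<le> 1" "\<delta>' \<le> \<delta>" "\<delta>' * (norm b + C + 1) \<le> \<beta> / 2"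
  proof -
    have "norm b + C + 1 > 0" using pos by (simp add: add_nonneg_pos)
    hence "\<beta> / 2 / (norm b + C + 1) * (norm b + C + 1) = \<beta> / 2"
      by (metis less_irrefl nonzero_eq_divide_eq)
    moreover from \<open>norm b + C + 1 > 0\<close> have "\<beta> / 2 / (norm b + C + 1) > 0" using pos by auto
    moreover have "\<delta>' * (norm b + C + 1) \<le> \<beta> / 2 / (norm b + C + 1) * (norm b + C + 1)"
      unfolding \<delta>'_def using pos by (intro mult_right_mono) auto
    ultimately show "\<delta>' * (norm b + C + 1) \<le> \<beta> / 2" by linarith
    show "\<delta>' > 0" using pos \<open>norm b + C + 1 > 0\<close> by (simp add: \<delta>'_def)
    show "\<delta>' \<le> 1" "\<delta>' \<le> \<delta>" by (auto simp: \<delta>'_def)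
  qed
  \<comment> \<open>A decay rate valid in both regions: \<open>\<beta> / 2\<close> near 0 and
    \<open>\<kappa>\<close> away from it. Half of it is later spent on the polynomial factor, which
    explains \<open>\<mu>/2\<close> in \<open>L\<close>.\<close>
  define \<mu> where "\<mu> = min \<kappa> (\<beta> / 2)"
  have \<mu>: "\<mu> > 0" "\<mu> \<le> \<kappa>" "\<mu> \<le> \<beta> / 2" "\<mu> \<le> \<beta>" using pos by (auto simp: \<mu>_def)
  define K where "K = max (M * (norm b + C)\<^sup>2 + C + (norm w1 + C) * (norm b + C) + norm w0 * C)
     ((M + norm w0 + norm w1 + norm (w0 * b)) / \<delta>'\<^sup>2)"
  define L where "L = 1 / (\<mu>/2) + 2 / (\<mu>/2)\<^sup>2 + 6 / (\<mu>/2) ^ 3"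
  have "K \<ge> 0" unfolding K_def by (intro max.coboundedI2) (use M in auto)
  define v where "v = (\<lambda>n \<theta>. \<alpha> ^ n * w \<theta> / lm \<theta> ^ n)"
  define g where "g = (\<lambda>(n::nat) \<theta>. exp (- real n * \<beta> * \<theta>\<^sup>2) * (w0 + w1 * \<theta> - n * w0 * b * of_real \<theta> ^ 3))"
  have lm0: "lm \<theta> \<noteq> 0" if "\<theta> \<in> {-T..T}" for \<theta>
  proof -
    have "0 < \<alpha> * exp (\<kappa> * \<theta>\<^sup>2)" using pos by simp
    thus ?thesis using low[OF that] by auto
  qed
  have ptw: "norm (indicator {-T..T} \<theta> *\<^sub>R v n \<theta> - g n \<theta>) \<le> K * L / n * exp (- (n * \<mu> / 2) * \<theta>\<^sup>2)" 
    if n: "n \<ge> 1" for n \<theta>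
  proof -
    let ?x = "n * \<theta>\<^sup>2"
    have x: "?x \<ge> 0" by simp
    have "norm (indicator {-T..T} \<theta> *\<^sub>R v n \<theta> - g n \<theta>) \<le> K / n * (?x + ?x\<^sup>2 + ?x ^ 3) * exp (- \<mu> * ?x)"
    proof (cases "\<bar>\<theta>\<bar> \<le> \<delta>'")
      case True
      hence th: "\<theta> \<in> {-T..T}" "\<bar>\<theta>\<bar> \<le> \<delta>" using \<delta>' pos by auto
      from loc[OF th(2)] obtain \<xi> where \<xi>: "lm \<theta> = \<alpha> * exp (\<beta> * \<theta>\<^sup>2 + b * of_real \<theta> ^ 3 + \<xi>)" "norm \<xi> \<le> C * \<theta> ^ 4" by blast
      have "(norm b + C) * \<bar>\<theta>\<bar> \<le> (norm b + C + 1) * \<delta>'"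
        using True pos by (intro mult_mono) auto
      hence "(norm b + C) * \<bar>\<theta>\<bar> \<le> \<beta> / 2" using \<delta>' by (simp add: mult.commute)
      from laplace_pointwise_near[OF pos(1,2,6) n \<xi> wloc[OF th(2)] M(2)[OF th(1)] _ this]
      have "norm (v n \<theta> - g n \<theta>) \<le> (M * (norm b + C)\<^sup>2 + C + (norm w1 + C) * (norm b + C) + norm w0 * C) / n *
          (?x + ?x\<^sup>2 + ?x ^ 3) * exp (- (\<beta> / 2) * ?x)"
        using True \<delta>' unfolding v_def g_def by simp
      also have "\<dots> \<le> K / n * (?x + ?x\<^sup>2 + ?x ^ 3) * exp (- \<mu> * ?x)"
        using mult_right_mono[OF \<mu>(3) x] x \<open>K \<ge> 0\<close>
        by (intro mult_mono divide_right_mono mult_right_mono) (auto simp: K_def intro: mult_right_mono)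
      finally show ?thesis using th by simp
    next
      case False
      have vb: "norm (indicator {-T..T} \<theta> *\<^sub>R v n \<theta>) \<le> M * exp (- \<mu> * (n * \<theta>\<^sup>2))"
      proof (cases "\<theta> \<in> {-T..T}")
        case th: True
        have "exp (\<mu> * (n * \<theta>\<^sup>2)) * \<alpha> ^ n \<le> exp (\<kappa> * (n * \<theta>\<^sup>2)) * \<alpha> ^ n"
          using \<mu> pos by (intro mult_right_mono) (auto intro: mult_right_mono)
        also have "\<dots> = (\<alpha> * exp (\<kappa> * \<theta>\<^sup>2)) ^ n"
          by (simp add: power_mult_distrib exp_of_nat_mult[symmetric] mult_ac)
        also have "\<dots> \<le> norm (lm \<theta>) ^ n" using pos low[OF th] by (intro power_mono) auto
        finally have le: "exp (\<mu> * (n * \<theta>\<^sup>2)) * \<alpha> ^ n \<le> norm (lm \<theta>) ^ n" .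
        have "norm (v n \<theta>) = norm (w \<theta>) * (\<alpha> ^ n / norm (lm \<theta>) ^ n)"
          using pos by (simp add: v_def norm_mult norm_divide norm_power)
        also have "\<dots> \<le> M * exp (- \<mu> * (n * \<theta>\<^sup>2))"
        proof (intro mult_mono M(2) th)
          show "\<alpha> ^ n / norm (lm \<theta>) ^ n \<le> exp (- \<mu> * (n * \<theta>\<^sup>2))"
            using le lm0[OF th] by (simp add: exp_minus field_simps)
        qed (use M pos in auto)
        finally show ?thesis using th by simp
      qed (use M in auto)
      from False have "\<delta>' \<le> \<bar>\<theta>\<bar>" by simp
      from laplace_pointwise_far[OF pos(2) \<mu>(1,4) n \<delta>'(1,2) this vb M(1)]
      have "norm (indicator {-T..T} \<theta> *\<^sub>R v n \<theta> - g n \<theta>) \<le> ((M + norm w0 + norm w1 + norm (w0 * b)) / \<delta>'\<^sup>2) / n *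
          (?x + ?x\<^sup>2 + ?x ^ 3) * exp (- \<mu> * ?x)"
        unfolding g_def .
      also have "\<dots> \<le> K / n * (?x + ?x\<^sup>2 + ?x ^ 3) * exp (- \<mu> * ?x)"
        using x by (intro mult_right_mono divide_right_mono) (auto simp: K_def)
      finally show ?thesis .
    qed
    also have "\<dots> \<le> K / n * (L * exp (\<mu> / 2 * ?x)) * exp (- \<mu> * ?x)"
      unfolding L_def using \<mu> x \<open>K \<ge> 0\<close> by (intro mult_right_mono mult_left_mono cubic_le_exp) auto
    also have "\<dots> = K * L / n * (exp (\<mu> / 2 * ?x) * exp (- \<mu> * ?x))" by simp
    also have "exp (\<mu> / 2 * ?x) * exp (- \<mu> * ?x) = exp (- (n * \<mu> / 2) * \<theta>\<^sup>2)"
      by (simp add: exp_add[symmetric] field_simps)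
    finally show ?thesis .
  qed
  have main: "norm (\<alpha> ^ n * integral {-T..T} (\<lambda>\<theta>. w \<theta> / lm \<theta> ^ n) - w0 * sqrt (pi / (n * \<beta>))) 
     \<le> K * L * sqrt (2 * pi / \<mu>) / (n * sqrt n)" if n: "n \<ge> 1" for n
  proof -
    have cont: "continuous_on {-T..T} (v n)"
      unfolding v_def using lm0 by (intro continuous_intros lm w) auto
    have vi: "integrable lborel (\<lambda>\<theta>. indicator {-T..T} \<theta> *\<^sub>R v n \<theta>)"
      by (rule borel_integrable_compact) (use cont in auto)
    have viv: "(LINT \<theta>|lborel. indicator {-T..T} \<theta> *\<^sub>R v n \<theta>) = integral {-T..T} (v n)"
      using set_borel_integral_eq_integral(2)[of "{-T..T}" "v n"] vi
      by (simp add: set_lebesgue_integral_def set_integrable_def)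
    also have "\<dots> = \<alpha> ^ n * integral {-T..T} (\<lambda>\<theta>. w \<theta> / lm \<theta> ^ n)"
      by (simp add: v_def flip: integral_mult_right)
    finally have vI: "(LINT \<theta>|lborel. indicator {-T..T} \<theta> *\<^sub>R v n \<theta>) = \<alpha> ^ n * integral {-T..T} (\<lambda>\<theta>. w \<theta> / lm \<theta> ^ n)" .
    have p: "n * \<beta> > 0" "n * \<mu> / 2 > 0" using n pos \<mu> by auto
    have gi: "has_bochner_integral lborel (g n) (w0 * sqrt (pi / (n * \<beta>)) + w1 * of_real 0 - n * w0 * b * of_real 0)"
    proof -
      have "has_bochner_integral lborel (\<lambda>\<theta>. w0 * of_real (exp (- (n * \<beta>) * \<theta>\<^sup>2)) + w1 * of_real (exp (- (n * \<beta>) * \<theta>\<^sup>2) * \<theta>) -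
          n * w0 * b * of_real (exp (- (n * \<beta>) * \<theta>\<^sup>2) * \<theta> ^ 3))
         (w0 * of_real (sqrt (pi / (n * \<beta>))) + w1 * of_real 0 - n * w0 * b * of_real 0)"
        by (intro has_bochner_integral_add has_bochner_integral_diff has_bochner_integral_mult_right
             has_bochner_integral_of_real has_bochner_integral_gaussian p)
      also have "(\<lambda>\<theta>. w0 * of_real (exp (- (n * \<beta>) * \<theta>\<^sup>2)) + w1 * of_real (exp (- (n * \<beta>) * \<theta>\<^sup>2) * \<theta>) -
          n * w0 * b * of_real (exp (- (n * \<beta>) * \<theta>\<^sup>2) * \<theta> ^ 3)) = g n"
        unfolding g_def by (auto simp: algebra_simps)
      finally show ?thesis .
    qed
    have "norm (\<alpha> ^ n * integral {-T..T} (\<lambda>\<theta>. w \<theta> / lm \<theta> ^ n) - w0 * sqrt (pi / (n * \<beta>)))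
       = norm (LINT \<theta>|lborel. indicator {-T..T} \<theta> *\<^sub>R v n \<theta> - g n \<theta>)"
      using vi gi by (subst Bochner_Integration.integral_diff) (auto simp: vI has_bochner_integral_iff)
    also have "\<dots> \<le> (LINT \<theta>|lborel. norm (indicator {-T..T} \<theta> *\<^sub>R v n \<theta> - g n \<theta>))"
      by (rule Bochner_Integration.integral_norm_bound)
    also have "\<dots> \<le> (LINT \<theta>|lborel. K * L / n * exp (- (n * \<mu> / 2) * \<theta>\<^sup>2))"
    proof (rule Bochner_Integration.integral_mono)
      show "integrable lborel (\<lambda>\<theta>. norm (indicator {-T..T} \<theta> *\<^sub>R v n \<theta> - g n \<theta>))"
        using vi gi by (intro integrable_norm Bochner_Integration.integrable_diff) (auto simp: has_bochner_integral_iff)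
      show "integrable lborel (\<lambda>\<theta>. K * L / n * exp (- (n * \<mu> / 2) * \<theta>\<^sup>2))"
        using has_bochner_integral_gaussian(1)[OF p(2)] by (intro integrable_mult_right) (simp add: has_bochner_integral_iff)
    qed (use ptw n in auto)
    also have "\<dots> = K * L / n * sqrt (pi / (n * \<mu> / 2))"
      using has_bochner_integral_gaussian(1)[OF p(2)] by (simp add: has_bochner_integral_iff)
    also have "sqrt (pi / (n * \<mu> / 2)) = sqrt (2 * pi / \<mu>) / sqrt n"
      by (simp add: real_sqrt_divide real_sqrt_mult mult_ac)
    finally show ?thesis by simp
  qed
  show ?thesis using main by blast
qed

section \<open>The power series with coefficients k^m\<close>

text \<open>For m >= 1 this is the polylogarithm of order -m. For m = 0 the term k = 0 counts as 1,
  which gives the geometric series 1/(1 - x).\<close>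

definition powser_sum :: "nat \<Rightarrow> complex \<Rightarrow> complex" where
  "powser_sum m x = (\<Sum>k. of_nat k ^ m * x ^ k)"

lemma summable_powser_sum:
  fixes x :: complex
  assumes "norm x < 1"
  shows "summable (\<lambda>k. of_nat k ^ m * x ^ k)"
  using assms
proof (induction m arbitrary: x)
  case (Suc m)
  have "summable (\<lambda>k. diffs (\<lambda>k. of_nat k ^ m) k * x ^ k)"
    using Suc by (intro termdiff_converges[of x 1]) auto
  hence "summable (\<lambda>k. x * (diffs (\<lambda>k. of_nat k ^ m) k * x ^ k))" by (rule summable_mult)
  hence "summable (\<lambda>k. of_nat (Suc k) ^ Suc m * x ^ Suc k)"
    by (simp add: diffs_def mult_ac)
  thus ?case by (subst (asm) summable_Suc_iff)
qed (auto intro: summable_geometric)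

text \<open>Only \<open>x * d\<close> has to be known: substituting x = exp (-z) and differentiating
  in z supplies the factor -x.\<close>

lemma powser_sum_has_field_derivative:
  assumes "norm x < 1"
  shows "\<exists>d. (powser_sum m has_field_derivative d) (at x) \<and> x * d = powser_sum (Suc m) x"
proof -
  let ?d = "\<Sum>k. diffs (\<lambda>k. of_nat k ^ m) k * x ^ k"
  have 1: "(powser_sum m has_field_derivative ?d) (at x)"
    unfolding powser_sum_def using assms 
    by (intro termdiffs_strong'[of 1]) (auto intro: summable_powser_sum)
  have "summable (\<lambda>k. diffs (\<lambda>k. of_nat k ^ m) k * x ^ k)"
    using assms by (intro termdiff_converges[of x 1] summable_powser_sum) auto
  hence "x * ?d = (\<Sum>k. x * (diffs (\<lambda>k. of_nat k ^ m) k * x ^ k))" by (rule suminf_mult[symmetric])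
  also have "\<dots> = (\<Sum>k. of_nat (Suc k) ^ Suc m * x ^ Suc k)" by (simp add: diffs_def mult_ac)
  also have "\<dots> = powser_sum (Suc m) x"
    using summable_powser_sum[OF assms, of "Suc m"] unfolding powser_sum_def
    by (subst suminf_split_head) auto
  finally show ?thesis using 1 by blast
qed

lemma holomorphic_inverse_one_minus_exp: "(\<lambda>z. 1 / (1 - exp (- z))) holomorphic_on {z. Re z > 0}"
  by (intro holomorphic_intros) (auto simp: exp_eq_1 dest: sym)

lemma higher_deriv_inverse_one_minus_exp:
  assumes "Re z > 0"
  shows "(deriv ^^ m) (\<lambda>z. 1 / (1 - exp (- z))) z = (- 1) ^ m * powser_sum m (exp (- z))"
  using assms
proof (induction m arbitrary: z)
  case 0
  have "norm (exp (- z)) < 1" using 0 by simp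
  thus ?case by (simp add: powser_sum_def suminf_geometric)
next
  case (Suc m)
  have z: "norm (exp (- z)) < 1" using Suc.prems by simp
  from powser_sum_has_field_derivative[OF this, of m] obtain d where
    d: "(powser_sum m has_field_derivative d) (at (exp (- z)))" "exp (- z) * d = powser_sum (Suc m) (exp (- z))" by blast
  have "((\<lambda>z. exp (- z)) has_field_derivative - exp (- z)) (at z)"
    by (auto intro!: derivative_eq_intros)
  from DERIV_cmult[OF DERIV_chain2[OF d(1) this], of "(-1) ^ m"]
  have "((\<lambda>z. (- 1) ^ m * powser_sum m (exp (- z))) has_field_derivative (-1) ^ Suc m * powser_sum (Suc m) (exp (- z))) (at z)"
    by (simp add: d(2)[symmetric] mult_ac)
  hence "((deriv ^^ m) (\<lambda>z. 1 / (1 - exp (- z))) has_field_derivative (-1) ^ Suc m * powser_sum (Suc m) (exp (- z))) (at z)"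
    by (rule has_field_derivative_transform_within_open[of _ _ _ "{z. Re z > 0}"])
       (use Suc in \<open>auto simp: open_halfspace_Re_gt\<close>)
  thus ?case by (simp add: DERIV_imp_deriv)
qed

lemma higher_deriv_inverse:
  fixes z :: complex
  assumes "z \<noteq> 0"
  shows "(deriv ^^ m) (\<lambda>z. 1 / z) z = (- 1) ^ m * fact m / z ^ Suc m"
  using assms
proof (induction m arbitrary: z)
  case (Suc m)
  have "((\<lambda>z. (- 1) ^ m * fact m / z ^ Suc m) has_field_derivative (- 1) ^ Suc m * fact (Suc m) / z ^ Suc (Suc m)) (at z)"
    using Suc.prems by (auto intro!: derivative_eq_intros simp: field_simps simp del: power_Suc)
       (simp add: field_simps)
  hence "((deriv ^^ m) (\<lambda>z. 1 / z) has_field_derivative (- 1) ^ Suc m * fact (Suc m) / z ^ Suc (Suc m)) (at z)"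
    by (rule has_field_derivative_transform_within_open[of _ _ _ "- {0}"]) (use Suc in auto)
  thus ?case by (simp add: DERIV_imp_deriv)
qed auto

section \<open>The entire function (e^z - 1)/z and the pole-free part of 1/(1 - e^(-z))\<close>

definition expm1_quot :: "complex \<Rightarrow> complex" where
  "expm1_quot z = (if z = 0 then 1 else (exp z - 1) / z)"

lemma expm1_quot_0 [simp]: "expm1_quot 0 = 1"
  by (simp add: expm1_quot_def)

lemma expm1_quot_mult: "z * expm1_quot z = exp z - 1"
  by (simp add: expm1_quot_def)

lemma holomorphic_expm1_quot: "expm1_quot holomorphic_on UNIV"
proof -
  have "(\<lambda>z. if z = 0 then deriv exp 0 else (exp z - exp 0) / (z - 0 :: complex)) holomorphic_on UNIV"
    by (rule pole_lemma) (auto intro: holomorphic_intros)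
  moreover have "deriv exp (0::complex) = 1" using DERIV_imp_deriv[OF DERIV_exp[of "0::complex"]] by simp
  ultimately show ?thesis by (simp add: expm1_quot_def[abs_def] cong: if_cong)
qed

lemma expm1_quot_nonzero:
  assumes "\<bar>Im z\<bar> < 2 * pi"
  shows "expm1_quot z \<noteq> 0"
proof
  assume "expm1_quot z = 0"
  hence "z \<noteq> 0" "exp z = 1" using expm1_quot_mult[of z] by auto
  then obtain n where n: "Re z = 0" "Im z = real_of_int (2 * n) * pi" by (auto simp: exp_eq_1)
  hence "n \<noteq> 0" using \<open>z \<noteq> 0\<close> by (auto simp: complex_eq_iff)
  hence "1 * (2 * pi) \<le> \<bar>real_of_int n\<bar> * (2 * pi)" by (intro mult_right_mono) auto
  also have "\<dots> = \<bar>Im z\<bar>" by (simp add: n abs_mult)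
  finally show False using assms by simp
qed

text \<open>This is 1/(1 - e^(-z)) - 1/z with its singularity at 0 removed. Since
  \<open>1 / expm1_quot (- z)\<close> is z/(1 - e^(-z)), it is a difference quotient at 0, the form
  to which \<open>pole_lemma\<close> applies.\<close>

definition inverse_expm1_part :: "complex \<Rightarrow> complex" where
  "inverse_expm1_part z = (if z = 0 then deriv (\<lambda>z. 1 / expm1_quot (- z)) 0 else (1 / expm1_quot (- z) - 1) / z)"

lemma open_strip: "open {z::complex. \<bar>Im z\<bar> < r}"
  by (auto simp: abs_less_iff intro!: open_Collect_less continuous_intros open_Collect_conj)

lemma holomorphic_inverse_expm1_part: "inverse_expm1_part holomorphic_on {z. \<bar>Im z\<bar> < 2 * pi}"
proof -
  have "(\<lambda>z. 1 / expm1_quot (- z)) holomorphic_on {z. \<bar>Im z\<bar> < 2 * pi}"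
    using expm1_quot_nonzero
    by (intro holomorphic_intros holomorphic_on_compose_gen[OF _ holomorphic_expm1_quot, unfolded o_def]) auto
  hence "(\<lambda>z. if z = 0 then deriv (\<lambda>z. 1 / expm1_quot (- z)) 0
          else (1 / expm1_quot (- z) - 1 / expm1_quot (- 0)) / (z - 0)) holomorphic_on {z. \<bar>Im z\<bar> < 2 * pi}"
    by (rule pole_lemma) (simp add: interior_open open_strip)
  thus ?thesis by (simp add: inverse_expm1_part_def[abs_def] cong: if_cong)
qed

lemma inverse_expm1_part_eq: "z \<noteq> 0 \<Longrightarrow> inverse_expm1_part z = 1 / (1 - exp (- z)) - 1 / z"
  
proof -
  assume z: "z \<noteq> 0"
  have "expm1_quot (- z) = (1 - exp (- z)) / z" using z expm1_quot_mult[of "-z"] by (simp add: field_simps)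
  thus ?thesis using z by (simp add: inverse_expm1_part_def) (simp add: diff_divide_distrib)
qed

text \<open>Up to the same sign, the two terms are the m-th derivatives of 1/(1 - e^(-z)) and 1/z.
  Their difference is an m-th derivative of \<open>inverse_expm1_part\<close>, which is holomorphic
  for |Im z| < 2 pi, and Cauchy's inequality on discs of radius 3/2 applies. The region for z is the
  one in which \<open>decay_rate\<close> lies on the circle.\<close>

lemma powser_sum_approx:
  "\<exists>C\<ge>0. \<forall>z m. 0 < Re z \<longrightarrow> Re z \<le> 3 \<longrightarrow> \<bar>Im z\<bar> \<le> pi + 1 \<longrightarrow>
     norm (powser_sum m (exp (- z)) - fact m / z ^ Suc m) \<le> C * (fact m / (3/2) ^ m)"
proof -
  \<comment> \<open>A compact rectangle that contains every disc of radius 3/2 about an admissible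
    z. It stays in the strip because pi + 5/2 < 2 pi.\<close>
  define K where "K = cbox (Complex (- 2) (- (pi + 5/2))) (Complex 5 (pi + 5/2))"
  have K: "K \<subseteq> {z. \<bar>Im z\<bar> < 2 * pi}" using pi_gt3 by (auto simp: K_def in_cbox_complex_iff)
  have "continuous_on K inverse_expm1_part"
    using holomorphic_on_imp_continuous_on[OF holomorphic_inverse_expm1_part] K continuous_on_subset by blast
  hence "bounded (inverse_expm1_part ` K)"
    by (intro compact_imp_bounded compact_continuous_image) (auto simp: K_def)
  then obtain C where C: "\<And>z. z \<in> K \<Longrightarrow> norm (inverse_expm1_part z) \<le> C" unfolding bounded_iff by blast
  have "norm (powser_sum m (exp (- z)) - fact m / z ^ Suc m) \<le> max C 0 * (fact m / (3/2) ^ m)"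
    if z: "0 < Re z" "Re z \<le> 3" "\<bar>Im z\<bar> \<le> pi + 1" for z m
  proof -
    have sub: "cball z (3/2) \<subseteq> K"
    proof
      fix w assume "w \<in> cball z (3/2)"
      hence "\<bar>Re (w - z)\<bar> \<le> 3/2" "\<bar>Im (w - z)\<bar> \<le> 3/2"
        using abs_Re_le_cmod[of "w - z"] abs_Im_le_cmod[of "w - z"] by (auto simp: dist_norm norm_minus_commute)
      hence "\<bar>Re w - Re z\<bar> \<le> 3/2" "\<bar>Im w - Im z\<bar> \<le> 3/2" by simp_all
      hence "- 2 \<le> Re w" "Re w \<le> 5" "- (pi + 5/2) \<le> Im w" "Im w \<le> pi + 5/2" using z by linarith+
      thus "w \<in> K" by (simp add: K_def in_cbox_complex_iff)
    qed
    let ?H = "{z. Re z > 0} \<inter> {z. \<bar>Im z\<bar> < 2 * pi}"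
    have H: "open ?H" "z \<in> ?H" using z pi_gt3 by (auto intro: open_Int open_strip open_halfspace_Re_gt)
    have hol: "(\<lambda>z. 1 / (1 - exp (- z))) holomorphic_on ?H" "(\<lambda>z. 1 / z) holomorphic_on ?H"
         "inverse_expm1_part holomorphic_on ?H"
      by (auto intro: holomorphic_on_subset[OF holomorphic_inverse_one_minus_exp]
             holomorphic_on_subset[OF holomorphic_inverse_expm1_part] holomorphic_intros)
    have z0: "z \<noteq> 0" using z by auto
    have "(deriv ^^ m) inverse_expm1_part z = (deriv ^^ m) (\<lambda>z. 1 / (1 - exp (- z)) - 1 / z) z"
      by (rule higher_deriv_transform_within_open[OF _ _ H])
         (use hol in \<open>auto intro!: holomorphic_on_diff inverse_expm1_part_eq\<close>)
    also have "\<dots> = (deriv ^^ m) (\<lambda>z. 1 / (1 - exp (- z))) z - (deriv ^^ m) (\<lambda>z. 1 / z) z"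
      by (rule higher_deriv_diff[OF hol(1,2) H])
    also have "\<dots> = (- 1) ^ m * (powser_sum m (exp (- z)) - fact m / z ^ Suc m)"
      using z z0 by (simp add: higher_deriv_inverse_one_minus_exp higher_deriv_inverse algebra_simps del: power_Suc)
    finally have "norm (powser_sum m (exp (- z)) - fact m / z ^ Suc m) = norm ((deriv ^^ m) inverse_expm1_part z)"
      by (simp add: norm_mult norm_power)
    also have "\<dots> \<le> fact m * C / (3/2) ^ m"
    proof (rule Cauchy_inequality)
      show "inverse_expm1_part holomorphic_on ball z (3/2)"
        using sub K ball_subset_cball by (blast intro: holomorphic_on_subset[OF holomorphic_inverse_expm1_part])
      show "continuous_on (cball z (3/2)) inverse_expm1_part"
        using \<open>continuous_on K inverse_expm1_part\<close> sub continuous_on_subset by blast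
      fix w assume "norm (z - w) = 3/2"
      thus "norm (inverse_expm1_part w) \<le> C" using sub by (intro C) (auto simp: dist_norm)
    qed auto
    also have "\<dots> \<le> max C 0 * (fact m / (3/2) ^ m)"
      by (simp add: field_simps)
    finally show ?thesis .
  qed
  thus ?thesis by (intro exI[of _ "max C 0"]) auto
qed

section \<open>The logarithm of (e^z - 1)/z and its primitive\<close>

lemma norm_exp_minus_partial_le:
  fixes z :: complex
  shows "norm (exp z - (\<Sum>i<m. z ^ i / fact i)) \<le> exp (norm z) - (\<Sum>i<m. norm z ^ i / fact i)"
proof -
  have s: "(\<lambda>i. z ^ i / fact i) sums exp z" "(\<lambda>i. norm z ^ i / fact i) sums exp (norm z)"
    using exp_converges[of z] exp_converges[of "norm z"] by (simp_all add: scaleR_conv_of_real field_simps)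
  have "(\<lambda>i. z ^ (i + m) / fact (i + m)) sums (exp z - (\<Sum>i<m. z ^ i / fact i))"
    "(\<lambda>i. norm z ^ (i + m) / fact (i + m)) sums (exp (norm z) - (\<Sum>i<m. norm z ^ i / fact i))"
    using sums_split_initial_segment[OF s(1), of m] sums_split_initial_segment[OF s(2), of m] by auto
  note t = this
  have "norm (\<Sum>i. z ^ (i + m) / fact (i + m)) \<le> (\<Sum>i. norm z ^ (i + m) / fact (i + m))"
    using t(2) by (intro norm_suminf_le) (auto simp: norm_divide norm_power sums_iff)
  thus ?thesis using t by (simp add: sums_iff)
qed

text \<open>Half-angle formula together with the crude bound sin y >= y/4 on [0, pi/2]; only the
  quadratic order matters, not the constant.\<close>

lemma one_minus_cos_ge:
  fixes x :: real
  assumes "\<bar>x\<bar> \<le> pi"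
  shows "x\<^sup>2 / 32 \<le> 1 - cos x"
proof -
  have half: "y / 2 \<le> sin y" if "0 \<le> y" "y \<le> 1" for y :: real
  proof -
    have "sin 0 - 0 / 2 \<le> sin y - y / 2"
    proof (rule DERIV_nonneg_imp_nondecreasing[of 0 y])
      fix t assume t: "0 \<le> t" "t \<le> y"
      have "cos (pi / 3) \<le> cos t" using t that pi_gt3 by (intro cos_monotone_0_pi_le) auto
      hence "0 \<le> cos t - 1 / 2" by (simp add: cos_60)
      moreover have "((\<lambda>t. sin t - t / 2) has_real_derivative cos t - 1 / 2) (at t)"
        by (auto intro!: derivative_eq_intros)
      ultimately show "\<exists>d. ((\<lambda>t. sin t - t / 2) has_real_derivative d) (at t) \<and> 0 \<le> d" by blast
    qed (use that in auto)
    thus ?thesis by simp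
  qed
  have quarter: "y / 4 \<le> sin y" if y: "0 \<le> y" "y \<le> pi / 2" for y :: real
  proof (cases "y \<le> 1")
    case False
    have "sin 1 \<le> sin y" using False y by (intro sin_monotone_2pi_le) auto
    thus ?thesis using half[of 1] y pi_less_4 by linarith
  qed (use half[of y] y in auto)
  have "\<bar>x\<bar> / 8 \<le> sin (\<bar>x\<bar> / 2)" using quarter[of "\<bar>x\<bar> / 2"] assms by simp
  hence "(\<bar>x\<bar> / 8)\<^sup>2 \<le> (sin (\<bar>x\<bar> / 2))\<^sup>2" by (intro power_mono) auto
  also have "\<dots> = (1 - cos x) / 2" using cos_double_sin[of "\<bar>x\<bar> / 2"] by simp
  finally show ?thesis by (simp add: power_divide)
qed

lemma norm_expm1_quot_minus_one:
  assumes "norm z < 1"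
  shows "norm (expm1_quot z - 1) \<le> norm z"
proof (cases "z = 0")
  case False
  have "norm (z * (expm1_quot z - 1)) = norm (exp z - 1 - z)"
    by (simp add: right_diff_distrib expm1_quot_mult)
  also have "\<dots> \<le> exp (norm z) - 1 - norm z"
    using norm_exp_minus_partial_le[of z 2] by (simp add: eval_nat_numeral algebra_simps)
  also have "\<dots> \<le> (norm z)\<^sup>2" using exp_bound[of "norm z"] assms by simp
  finally show ?thesis using False by (simp add: norm_mult power2_eq_square)
qed auto

text \<open>This keeps \<open>expm1_quot\<close> off the cut of the principal logarithm on the unit
  disc, which contains the circle of radius ln 2.\<close>

lemma Re_expm1_quot_pos:
  assumes "norm z < 1"
  shows "Re (expm1_quot z) > 0"
proof -
  have "\<bar>Re (expm1_quot z - 1)\<bar> < 1"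
    using norm_expm1_quot_minus_one[OF assms] abs_Re_le_cmod[of "expm1_quot z - 1"] assms by linarith
  thus ?thesis by simp
qed

definition ln_expm1_quot :: "complex \<Rightarrow> complex" where
  "ln_expm1_quot z = Ln (expm1_quot z)"

lemma exp_ln_expm1_quot: "norm z < 1 \<Longrightarrow> exp (ln_expm1_quot z) = expm1_quot z"
  using Re_expm1_quot_pos[of z] by (auto simp: ln_expm1_quot_def intro: exp_Ln)

lemma Re_ln_expm1_quot: "norm z < 1 \<Longrightarrow> Re (ln_expm1_quot z) = ln (norm (expm1_quot z))"
  using Re_expm1_quot_pos[of z] unfolding ln_expm1_quot_def by (subst Re_Ln) auto

lemma holomorphic_ln_expm1_quot: "ln_expm1_quot holomorphic_on ball 0 1"
  unfolding ln_expm1_quot_def[abs_def] using Re_expm1_quot_pos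
  by (intro holomorphic_on_Ln' holomorphic_on_subset[OF holomorphic_expm1_quot])
     (force simp: complex_nonpos_Reals_iff)+

lemma expm1_quot_of_real: "expm1_quot (of_real x) = of_real (if x = 0 then 1 else (exp x - 1) / x)"
  by (simp add: expm1_quot_def exp_of_real[symmetric])

lemma ln_expm1_quot_of_real:
  assumes "0 \<le> x" "x < 1"
  shows "ln_expm1_quot (of_real x) = of_real (Re (ln_expm1_quot (of_real x)))"
proof -
  have "(if x = 0 then 1 else (exp x - 1) / x) > 0" using assms by auto
  thus ?thesis unfolding ln_expm1_quot_def expm1_quot_of_real by (simp add: Ln_of_real)
qed

text \<open>Split (e^z - 1)/z into 1 + z/2 and a tail. The tail has nonnegative coefficients, so its
  modulus is at most its value at the radius; the whole gain in the angle comes from |1 +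
  z/2|.\<close>

lemma norm_expm1_quot_le:
  assumes "0 \<le> \<xi>" "\<xi> < 1" "\<bar>\<theta>\<bar> \<le> pi"
  shows "norm (expm1_quot (\<xi> * cis \<theta>)) \<le> norm (expm1_quot (of_real \<xi>)) - \<xi> * (1 - cos \<theta>) / 3"
proof (cases "\<xi> = 0")
  case False
  define z where "z = \<xi> * cis \<theta>"
  have nz: "norm z = \<xi>" using assms by (simp add: z_def norm_mult)
  have z0: "z \<noteq> 0" using False nz by auto
  define d where "d = 1 - cos \<theta>"
  have d: "d \<ge> 0" by (simp add: d_def)
  have "norm (expm1_quot z - (1 + z / 2)) = norm (exp z - (\<Sum>i<3. z ^ i / fact i)) / \<xi>"
  proof -
    have "expm1_quot z - (1 + z / 2) = (exp z - (\<Sum>i<3. z ^ i / fact i)) / z"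
      using z0 by (simp add: expm1_quot_def eval_nat_numeral field_simps)
    thus ?thesis by (simp add: norm_divide nz)
  qed
  also have "\<dots> \<le> (exp \<xi> - (\<Sum>i<3. \<xi> ^ i / fact i)) / \<xi>"
    using norm_exp_minus_partial_le[of z 3] assms by (intro divide_right_mono) (auto simp: nz)
  also have "\<dots> = norm (expm1_quot (of_real \<xi>)) - (1 + \<xi> / 2)"
    unfolding expm1_quot_of_real norm_of_real using False assms
    by (simp add: eval_nat_numeral field_simps)
  finally have 1: "norm (expm1_quot z - (1 + z / 2)) \<le> norm (expm1_quot (of_real \<xi>)) - (1 + \<xi> / 2)" .
  have 2: "norm (1 + z / 2) \<le> 1 + \<xi> / 2 - \<xi> * d / 3"
  proof (rule power2_le_imp_le)
    have "(norm (1 + z / 2))\<^sup>2 = (1 + \<xi> * cos \<theta> / 2)\<^sup>2 + (\<xi> * sin \<theta> / 2)\<^sup>2"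
      by (simp add: cmod_power2 z_def)
    also have "\<dots> = (1 + \<xi> * cos \<theta> / 2)\<^sup>2 + \<xi>\<^sup>2 / 4 * (1 - (cos \<theta>)\<^sup>2)"
      by (simp only: power_mult_distrib power_divide sin_squared_eq) simp
    also have "\<dots> = (1 + \<xi> / 2)\<^sup>2 - \<xi> * d"
      by (simp add: d_def power2_eq_square field_simps)
    \<comment> \<open>The squared modulus is smaller by exactly \<open>\<xi> * d\<close>. Taking
      \<open>\<xi> * d / 3\<close> off the modulus costs at most that much because (2 +
      \<open>\<xi>\<close>)/3 <= 1.\<close>
    also have "\<dots> \<le> (1 + \<xi> / 2)\<^sup>2 - 2 * (1 + \<xi> / 2) * (\<xi> * d / 3) + (\<xi> * d / 3)\<^sup>2"
    proof -
      have "2 * (1 + \<xi> / 2) * (\<xi> * d / 3) = \<xi> * d * ((2 + \<xi>) / 3)" by (simp add: field_simps)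
      also have "\<dots> \<le> \<xi> * d * 1" using assms d by (intro mult_left_mono) auto
      finally show ?thesis by (smt (verit) zero_le_power2)
    qed
    also have "\<dots> = (1 + \<xi> / 2 - \<xi> * d / 3)\<^sup>2" by (simp add: power2_eq_square algebra_simps)
    finally show "(norm (1 + z / 2))\<^sup>2 \<le> (1 + \<xi> / 2 - \<xi> * d / 3)\<^sup>2" .
    have "d \<le> 2" using cos_ge_minus_one[of \<theta>] unfolding d_def by linarith
    hence "\<xi> * d \<le> 1 * 2" using assms d by (intro mult_mono) auto
    thus "0 \<le> 1 + \<xi> / 2 - \<xi> * d / 3" using assms by simp
  qed
  have "norm (expm1_quot z) \<le> norm (expm1_quot z - (1 + z / 2)) + norm (1 + z / 2)"
    by (metis diff_add_cancel norm_triangle_ineq)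
  with 1 2 show ?thesis by (simp add: z_def d_def)
qed auto

text \<open>The constant is 192 = 32 * 3 * 2: from the cosine bound, from
  \<open>norm_expm1_quot_le\<close>, and from the bound 2 on the value at the radius, by which one
  divides when passing to logarithms.\<close>

lemma Re_ln_expm1_quot_le:
  assumes "0 \<le> \<xi>" "\<xi> < 1" "\<bar>\<theta>\<bar> \<le> pi"
  shows "Re (ln_expm1_quot (\<xi> * cis \<theta>)) \<le> Re (ln_expm1_quot (of_real \<xi>)) - \<xi> * \<theta>\<^sup>2 / 192"
proof -
  define p q where "p = norm (expm1_quot (\<xi> * cis \<theta>))" and "q = norm (expm1_quot (of_real \<xi>))"
  have n: "norm (\<xi> * cis \<theta>) < 1" "norm (complex_of_real \<xi>) < 1" using assms by (auto simp: norm_mult)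
  have p: "p > 0" "q > 0" using Re_expm1_quot_pos[OF n(1)] Re_expm1_quot_pos[OF n(2)] 
    by (auto simp: p_def q_def)
  have "q \<le> norm (expm1_quot (of_real \<xi>) - 1) + norm (1::complex)"
    unfolding q_def by (metis diff_add_cancel norm_triangle_ineq)
  also have "\<dots> \<le> 2" using norm_expm1_quot_minus_one[OF n(2)] assms by simp
  finally have q2: "q \<le> 2" .
  have "\<xi> * (\<theta>\<^sup>2 / 32) / 3 \<le> \<xi> * (1 - cos \<theta>) / 3"
    using one_minus_cos_ge[OF assms(3)] assms by (intro divide_right_mono mult_left_mono) auto
  hence pq: "\<xi> * \<theta>\<^sup>2 / 96 \<le> q - p" using norm_expm1_quot_le[OF assms] by (simp add: p_def q_def)
  have "ln p - ln q = ln (p / q)" using p by (simp add: ln_div)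
  also have "\<dots> \<le> p / q - 1" using p by (intro ln_le_minus_one) auto
  also have "\<dots> = - ((q - p) / q)" using p by (simp add: field_simps)
  finally have "ln p - ln q \<le> - ((q - p) / q)" .
  moreover have "(q - p) / q \<ge> (\<xi> * \<theta>\<^sup>2 / 96) / 2"
    using pq p q2 order.trans[OF _ pq, of 0] assms by (intro frac_le) auto
  ultimately have "ln p \<le> ln q - \<xi> * \<theta>\<^sup>2 / 192" by linarith
  thus ?thesis using n by (simp add: Re_ln_expm1_quot p_def q_def)
qed

text \<open>Lambda(z) of the overview is \<open>ln_expm1_primitive z\<close> + z log z - z.
  Splitting off z log z - z leaves a function holomorphic at 0; the split part is what Stirling's
  formula for k! (s/k)^k accounts for.\<close>

definition ln_expm1_primitive :: "complex \<Rightarrow> complex" where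
  "ln_expm1_primitive = (SOME F. F 0 = 0 \<and> 
     (\<forall>z\<in>ball 0 1. (F has_field_derivative ln_expm1_quot z) (at z)))"

lemma
  ln_expm1_primitive_0 [simp]: "ln_expm1_primitive 0 = 0" and
  has_field_derivative_ln_expm1_primitive:
    "norm z < 1 \<Longrightarrow> (ln_expm1_primitive has_field_derivative ln_expm1_quot z) (at z)"
proof -
  obtain g where g: "\<And>z. z \<in> ball 0 1 \<Longrightarrow> (g has_field_derivative ln_expm1_quot z) (at z within ball 0 1)"
    using holomorphic_convex_primitive'[OF _ _ holomorphic_ln_expm1_quot] by auto
  have "\<exists>F. F 0 = 0 \<and> (\<forall>z\<in>ball 0 1. (F has_field_derivative ln_expm1_quot z) (at z))"
  proof (intro exI conjI ballI)
    fix z :: complex assume z: "z \<in> ball 0 1"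
    have "(g has_field_derivative ln_expm1_quot z) (at z)" using g[OF z] at_within_open[OF z] by simp
    from DERIV_diff[OF this DERIV_const[of "g 0"]] show "((\<lambda>z. g z - g 0) has_field_derivative ln_expm1_quot z) (at z)" by simp
  qed auto
  from someI_ex[OF this] show "ln_expm1_primitive 0 = 0"
    "norm z < 1 \<Longrightarrow> (ln_expm1_primitive has_field_derivative ln_expm1_quot z) (at z)"
    unfolding ln_expm1_primitive_def[symmetric] by auto
qed


lemma holomorphic_ln_expm1_primitive: "ln_expm1_primitive holomorphic_on ball 0 1"
  unfolding holomorphic_on_open[OF open_ball]
  using has_field_derivative_ln_expm1_primitive mem_ball_0 by blast

section \<open>The dilogarithm and the value of the primitive at log 2\<close>

lemma alternating_inverse_squares_sums:
  "(\<lambda>n. (- 1) ^ n / (real n + 1)\<^sup>2) sums (pi\<^sup>2 / 12)"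
proof -
  \<comment> \<open>Twice the part of the series of inverse squares with even denominators.
    Subtracting it flips the signs of these terms and halves the sum pi^2/6.\<close>
  define f where "f = (\<lambda>n. if odd n then 2 / (real n + 1)\<^sup>2 else 0)"
  have sq: "(\<lambda>n. 1 / (real n + 1)\<^sup>2) sums (pi\<^sup>2 / 6)"
    using inverse_squares_sums by (simp add: add_ac)
  have "(\<lambda>n. f (2 * n + 1)) = (\<lambda>n. 1 / 2 * (1 / (real n + 1)\<^sup>2))"
  proof
    fix n
    have "(real (2 * n + 1) + 1)\<^sup>2 = 4 * (real n + 1)\<^sup>2" by (simp add: power2_eq_square algebra_simps)
    thus "f (2 * n + 1) = 1 / 2 * (1 / (real n + 1)\<^sup>2)" by (simp add: f_def)
  qed
  hence "(\<lambda>n. f (2 * n + 1)) sums (1 / 2 * (pi\<^sup>2 / 6))"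
    using sums_mult[OF sq, of "1 / 2"] by simp
  hence "f sums (1 / 2 * (pi\<^sup>2 / 6))"
  proof (subst (asm) sums_mono_reindex)
    fix n :: nat assume n: "n \<notin> range (\<lambda>n. 2 * n + 1)"
    have "even n"
    proof (rule ccontr)
      assume "odd n"
      then obtain m where "n = 2 * m + 1" by (rule oddE)
      with n show False by blast
    qed
    thus "f n = 0" by (simp add: f_def)
  qed (auto simp: strict_mono_def)
  from sums_diff[OF sq this]
  have "(\<lambda>n. 1 / (real n + 1)\<^sup>2 - f n) sums (pi\<^sup>2 / 12)" by simp
  moreover have "1 / (real n + 1)\<^sup>2 - f n = (- 1) ^ n / (real n + 1)\<^sup>2" for n
    by (auto simp: f_def diff_divide_distrib[symmetric])
  ultimately show ?thesis by simp
qed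

text \<open>This is $-\mathrm{Li}_2(-x)$.\<close>

definition dilog_neg :: "real \<Rightarrow> real" where
  "dilog_neg x = (\<Sum>n. (- 1) ^ n / (real n + 1)\<^sup>2 * x ^ Suc n)"

lemma dilog_neg_0 [simp]: "dilog_neg 0 = 0"
  by (simp add: dilog_neg_def)

lemma dilog_neg_1: "dilog_neg 1 = pi\<^sup>2 / 12"
  using alternating_inverse_squares_sums by (simp add: dilog_neg_def sums_iff)

text \<open>Continuity is needed up to x = 1, on the boundary of the disc of convergence, where the
  value pi^2/12 is read off; the derivative is available only inside.\<close>

lemma continuous_on_dilog_neg: "continuous_on {0..1} dilog_neg"
proof (rule uniform_limit_theorem)
  show "uniform_limit {0..1} (\<lambda>n x. \<Sum>i<n. (- 1) ^ i / (real i + 1)\<^sup>2 * x ^ Suc i) dilog_neg sequentially"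
    unfolding dilog_neg_def
  proof (rule Weierstrass_m_test)
    show "summable (\<lambda>n. 1 / (real n + 1)\<^sup>2)"
      using inverse_squares_sums by (simp add: add_ac sums_iff)
    fix n and x :: real assume "x \<in> {0..1}"
    hence "\<bar>x ^ Suc n\<bar> \<le> 1" by (auto intro!: mult_le_one power_le_one simp: abs_mult power_abs)
    hence "\<bar>x ^ Suc n\<bar> / (real n + 1)\<^sup>2 \<le> 1 / (real n + 1)\<^sup>2" by (intro divide_right_mono) auto
    thus "norm ((- 1) ^ n / (real n + 1)\<^sup>2 * x ^ Suc n) \<le> 1 / (real n + 1)\<^sup>2"
      by (simp add: abs_mult power_abs del: power_Suc)
  qed
  show "\<forall>\<^sub>F n in sequentially. continuous_on {0..1} (\<lambda>x. \<Sum>i<n. (- 1) ^ i / (real i + 1)\<^sup>2 * x ^ Suc i)"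
    by (intro always_eventually allI continuous_intros)
qed auto

lemma has_field_derivative_dilog_neg:
  assumes "0 < x" "x < 1"
  shows "(dilog_neg has_real_derivative ln (1 + x) / x) (at x)"
proof -
  define f where "f = (\<lambda>n. if n = 0 then 0 else (- 1) ^ (n - 1) / (real n)\<^sup>2)"
  have summ: "summable (\<lambda>n. f n * y ^ n)" if "norm y < 1" for y :: real
  proof (rule summable_comparison_test'[where N = 0])
    show "summable (\<lambda>n. norm y ^ n)" using that by simp
    fix n show "norm (f n * y ^ n) \<le> norm y ^ n"
    proof (cases "n = 0")
      case False
      hence "1 / (real n)\<^sup>2 \<le> 1" by simp
      hence "1 / (real n)\<^sup>2 * norm y ^ n \<le> 1 * norm y ^ n" by (intro mult_right_mono) auto
      thus ?thesis using False by (simp add: f_def abs_mult power_abs)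
    qed (auto simp: f_def)
  qed
  have eq: "dilog_neg y = (\<Sum>n. f n * y ^ n)" if "norm y < 1" for y
    using suminf_split_head[OF summ[OF that]] by (simp add: dilog_neg_def f_def add_ac)
  have "((\<lambda>y. \<Sum>n. f n * y ^ n) has_field_derivative (\<Sum>n. diffs f n * x ^ n)) (at x)"
    using assms summ by (intro termdiffs_strong'[of 1]) auto
  hence "(dilog_neg has_field_derivative (\<Sum>n. diffs f n * x ^ n)) (at x)"
    by (rule has_field_derivative_transform_within_open[of _ _ _ "{-1<..<1}"]) (use assms eq in auto)
  moreover have "(\<Sum>n. diffs f n * x ^ n) = ln (1 + x) / x"
  proof -
    have "(\<lambda>n. - ((- x) ^ n) / real n) sums ln (1 + x)" using assms by (intro ln_series') auto
    hence "(\<lambda>n. - ((- x) ^ Suc n) / real (Suc n)) sums (ln (1 + x) - (- ((- x) ^ 0) / real 0))"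
      by (subst sums_Suc_iff) auto
    hence "(\<lambda>n. - ((- x) ^ Suc n) / real (Suc n) / x) sums (ln (1 + x) / x)"
      by (intro sums_divide) simp
    moreover have "- ((- x) ^ Suc n) / real (Suc n) / x = diffs f n * x ^ n" for n
    proof -
      have "- ((- x) ^ Suc n) / real (Suc n) / x = (- x) ^ n / real (Suc n)" using assms by simp
      also have "\<dots> = (- 1) ^ n * x ^ n / real (Suc n)" by (simp only: power_minus[of x])
      also have "\<dots> = diffs f n * x ^ n" by (simp add: diffs_def f_def power2_eq_square del: of_nat_Suc)
      finally show ?thesis .
    qed
    ultimately show ?thesis by (simp add: sums_iff)
  qed
  ultimately show ?thesis by simp
qed

lemma ln2_less_1: "ln (2::real) < 1"
  using ln2_le_25_over_36 by simp

text \<open>Integration by parts of ln ((e^t - 1)/t): the remaining integrand is t e^t/(e^t - 1) -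
  1, and its first term is the derivative of \<open>dilog_neg (exp t - 1)\<close>.\<close>

lemma ln_expm1_primitive_of_real_aux:
  assumes "0 < t" "t < ln 2"
  shows "((\<lambda>t. t + t * Re (ln_expm1_quot (of_real t)) - dilog_neg (exp t - 1)) has_real_derivative
     Re (ln_expm1_quot (of_real t))) (at t)"
proof -
  have t1: "t < 1" using assms ln2_less_1 by simp
  have e: "exp t > 1" "exp t < 2" using assms exp_less_cancel_iff[of t "ln 2"] by auto
  have eq: "Re (ln_expm1_quot (of_real y)) = ln (exp y - 1) - ln y" if "y \<in> {0<..<1}" for y
    using that by (simp add: Re_ln_expm1_quot expm1_quot_of_real ln_div del: of_real_divide of_real_diff)
  have "((\<lambda>y. ln (exp y - 1) - ln y) has_real_derivative exp t / (exp t - 1) - 1 / t) (at t)"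
    using assms e by (auto intro!: derivative_eq_intros)
  hence d1: "((\<lambda>y. Re (ln_expm1_quot (of_real y))) has_real_derivative exp t / (exp t - 1) - 1 / t) (at t)"
    by (rule has_field_derivative_transform_within_open[of _ _ _ "{0<..<1}"]) (use assms t1 eq in auto)
  have d2: "((\<lambda>t. dilog_neg (exp t - 1)) has_real_derivative ln (1 + (exp t - 1)) / (exp t - 1) * exp t) (at t)"
    using e by (intro DERIV_chain2[OF has_field_derivative_dilog_neg]) (auto intro!: derivative_eq_intros)
  have "((\<lambda>t. t + t * Re (ln_expm1_quot (of_real t)) - dilog_neg (exp t - 1)) has_real_derivative
      1 + (1 * Re (ln_expm1_quot (of_real t)) + (exp t / (exp t - 1) - 1 / t) * t) - ln (1 + (exp t - 1)) / (exp t - 1) * exp t) (at t)"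
    by (intro DERIV_add DERIV_diff DERIV_mult DERIV_ident d1 d2)
  moreover have "(exp t / (exp t - 1) - 1 / t) * t = t / (exp t - 1) * exp t - 1"
    using assms by (simp add: left_diff_distrib)
  ultimately show ?thesis by simp
qed

text \<open>The primitive and its closed form agree at 0 and have equal derivatives on (0, ln 2). At
  ln 2 the argument of \<open>dilog_neg\<close> is exactly 1, so the endpoint is reached by
  continuity.\<close>

lemma ln_expm1_primitive_ln2:
  "ln_expm1_primitive (of_real (ln 2)) = of_real (ln 2 - ln 2 * ln (ln 2) - pi\<^sup>2 / 12)"
proof -
  define h where "h = (\<lambda>t. t + t * Re (ln_expm1_quot (of_real t)) - dilog_neg (exp t - 1))"
  let ?D = "\<lambda>t. ln_expm1_primitive (of_real t) - of_real (h t)"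
  have sub: "complex_of_real ` {0..ln 2} \<subseteq> ball 0 1" using ln2_less_1 by auto
  have c1: "continuous_on {0..ln 2} (\<lambda>t. ln_expm1_primitive (of_real t))"
    by (intro continuous_on_compose2[OF holomorphic_on_imp_continuous_on[OF holomorphic_ln_expm1_primitive] _ sub] continuous_intros)
  have c2: "continuous_on {0..ln 2} (\<lambda>t. ln_expm1_quot (of_real t))"
    by (intro continuous_on_compose2[OF holomorphic_on_imp_continuous_on[OF holomorphic_ln_expm1_quot] _ sub] continuous_intros)
  have "(\<lambda>t. exp t - 1) ` {0..ln 2} \<subseteq> {0..1::real}"
    by (auto simp: ln_ge_iff)
  hence c3: "continuous_on {0..ln 2} (\<lambda>t. dilog_neg (exp t - 1))"
    by (intro continuous_on_compose2[OF continuous_on_dilog_neg] continuous_intros)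
  have "?D (ln 2) = 0"
  proof (rule has_derivative_zero_unique_strong_interval[of "{0, ln 2}" 0 "ln 2" ?D])
    show "continuous_on {0..ln 2} ?D" unfolding h_def by (intro continuous_intros c1 c2 c3)
    fix t :: real assume "t \<in> {0..ln 2} - {0, ln 2}"
    hence t: "0 < t" "t < ln 2" by auto
    hence t1: "t < 1" using ln2_less_1 by linarith
    have "((\<lambda>t. ln_expm1_primitive (of_real t)) has_vector_derivative ln_expm1_quot (of_real t)) (at t)"
      using t t1 by (intro has_vector_derivative_real_field has_field_derivative_ln_expm1_primitive) auto
    moreover have "((\<lambda>t. complex_of_real (h t)) has_vector_derivative of_real (Re (ln_expm1_quot (of_real t)))) (at t)"
      unfolding h_def by (intro has_vector_derivative_of_real ln_expm1_primitive_of_real_aux[OF t])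
    ultimately have "(?D has_vector_derivative ln_expm1_quot (of_real t) - of_real (Re (ln_expm1_quot (of_real t)))) (at t)"
      by (rule has_vector_derivative_diff)
    hence "(?D has_vector_derivative 0) (at t)" using ln_expm1_quot_of_real[of t] t t1 by simp
    thus "(?D has_derivative (\<lambda>h. 0)) (at t within {0..ln 2})"
      by (auto simp: has_vector_derivative_def intro: has_derivative_at_withinI)
  qed (auto simp: h_def)
  moreover have "h (ln 2) = ln 2 - ln 2 * ln (ln 2) - pi\<^sup>2 / 12"
  proof -
    have "Re (ln_expm1_quot (of_real (ln 2))) = ln ((2 - 1) / ln 2)"
      using ln2_less_1 by (simp add: Re_ln_expm1_quot expm1_quot_of_real del: of_real_divide of_real_diff)
    also have "\<dots> = - ln (ln 2)" by (simp add: ln_div)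
    finally show ?thesis by (simp add: h_def dilog_neg_1)
  qed
  ultimately show ?thesis by simp
qed

section \<open>The saddle point\<close>

text \<open>Equivalent to e^2 < 2^3. The strictness gives 1/ln 2 - 1 < 1/2, the radius in
  \<open>norm_Ln_le\<close>.\<close>

lemma ln2_gt_two_thirds: "2 / 3 < ln (2::real)"
proof -
  have "exp (2::real) = exp 1 * exp 1" by (simp add: exp_add[symmetric])
  also have "\<dots> \<le> (272/100) * (272/100)" using e_less_272 by (intro mult_mono) auto
  also have "\<dots> < 2 ^ 3" by simp
  finally have "ln (exp (2::real)) < ln (2 ^ 3)" by (subst ln_less_cancel_iff) auto
  moreover have "ln ((2::real) ^ 3) = 3 * ln 2" by (subst ln_realpow) auto
  ultimately show ?thesis by simp
qed

text \<open>By convexity, exp lies below its chord on [0, ln 2], so exp |z| <= 1 + |z|/ln 2. Hence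
  \<open>expm1_quot z\<close> is within 1/ln 2 - 1 < 1/2 of 1, and \<open>norm_Ln_le\<close> at most
  doubles this distance.\<close>

lemma norm_ln_expm1_quot_le_1:
  assumes "norm z \<le> ln 2"
  shows "norm (ln_expm1_quot z) \<le> 1"
proof (cases "z = 0")
  case False
  define u where "u = norm z / ln 2"
  have u: "0 \<le> u" "u \<le> 1" "norm z = u * ln 2" "norm z > 0" using assms False by (auto simp: u_def)
  have "exp ((1 - u) *\<^sub>R 0 + u *\<^sub>R ln 2) \<le> (1 - u) * exp 0 + u * exp (ln (2::real))"
    using u by (intro convex_onD[OF exp_convex]) auto
  hence e: "exp (norm z) \<le> 1 + u" by (simp add: u algebra_simps)
  have "norm z * norm (expm1_quot z - 1) = norm (exp z - 1 - z)"
    by (simp add: right_diff_distrib expm1_quot_mult flip: norm_mult)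
  also have "\<dots> \<le> exp (norm z) - 1 - norm z"
    using norm_exp_minus_partial_le[of z 2] by (simp add: eval_nat_numeral algebra_simps)
  also have "\<dots> \<le> u - norm z" using e by simp
  also have "\<dots> = norm z * (1 / ln 2 - 1)" by (simp add: u_def field_simps)
  finally have "norm (expm1_quot z - 1) \<le> 1 / ln 2 - 1" using u(4) by (rule mult_left_le_imp_le)
  also have "\<dots> < 1 / 2" using ln2_gt_two_thirds by (simp add: field_simps)
  finally have "norm (expm1_quot z - 1) < 1 / 2" .
  with norm_Ln_le[OF this] show ?thesis by (simp add: ln_expm1_quot_def)
qed (simp add: ln_expm1_quot_def)

lemma norm_ln_expm1_primitive_le:
  assumes "norm z \<le> ln 2"
  shows "norm (ln_expm1_primitive z) \<le> norm z"
proof -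
  have "norm (ln_expm1_primitive z - ln_expm1_primitive 0) \<le> 1 * norm (z - 0)"
  proof (rule field_differentiable_bound[of "cball 0 (ln 2)" _ ln_expm1_quot])
    fix w :: complex assume w: "w \<in> cball 0 (ln 2)"
    thus "norm (ln_expm1_quot w) \<le> 1" by (intro norm_ln_expm1_quot_le_1) auto
    show "(ln_expm1_primitive has_field_derivative ln_expm1_quot w) (at w within cball 0 (ln 2))"
      by (rule has_field_derivative_at_within, rule has_field_derivative_ln_expm1_primitive)
         (use w ln2_less_1 in auto)
  qed (use assms in auto)
  thus ?thesis by simp
qed

text \<open>The angle is taken complex so that expansions at the saddle, angle 0, are Taylor
  expansions of holomorphic functions.\<close>

definition circ :: "complex \<Rightarrow> complex" where
  "circ z = of_real (ln 2) * exp (\<i> * z)"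

text \<open>This is -Lambda(s) at s = \<open>circ z\<close>, with log s represented by ln (ln 2) + i
  z.\<close>

definition saddle_phase :: "complex \<Rightarrow> complex" where
  "saddle_phase z = circ z * (1 - of_real (ln (ln 2)) - \<i> * z) - ln_expm1_primitive (circ z)"

text \<open>This is eta(s) = -Lambda(s)/s on the circle, the exponential rate in k of the k-th
  product.\<close>

definition decay_rate :: "real \<Rightarrow> complex" where
  "decay_rate \<theta> = 1 - of_real (ln (ln 2)) - \<i> * of_real \<theta> - ln_expm1_primitive (circ \<theta>) / circ \<theta>"

lemma circ_nonzero: "circ z \<noteq> 0"
  by (simp add: circ_def)

lemma circ_of_real: "circ (of_real \<theta>) = of_real (ln 2) * cis \<theta>"
  by (simp add: circ_def cis_conv_exp)

lemma norm_circ: "norm (circ (of_real \<theta>)) = ln 2"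
  by (simp add: circ_of_real norm_mult)

lemma saddle_phase_of_real: "saddle_phase (of_real \<theta>) = circ \<theta> * decay_rate \<theta>"
  by (simp add: saddle_phase_def decay_rate_def circ_nonzero right_diff_distrib)

lemma circ_0: "circ 0 = of_real (ln 2)"
  by (simp add: circ_def)

lemma saddle_phase_0: "saddle_phase 0 = of_real (pi\<^sup>2 / 12)"
  unfolding saddle_phase_def circ_0 ln_expm1_primitive_ln2 by (simp add: algebra_simps)

text \<open>These place \<open>decay_rate\<close> in the region covered by
  \<open>powser_sum_approx\<close>. They follow from |\<open>ln_expm1_primitive s\<close> / s| <= 1
  and -ln (ln 2) <= 1.\<close>

lemma decay_rate_bounds:
  shows "\<bar>\<theta>\<bar> \<le> pi \<Longrightarrow> \<bar>Im (decay_rate \<theta>)\<bar> \<le> pi + 1" and "Re (decay_rate \<theta>) \<le> 3"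
proof -
  define q where "q = ln_expm1_primitive (circ \<theta>) / circ \<theta>"
  have "norm q \<le> 1"
    using norm_ln_expm1_primitive_le[of "circ \<theta>"] by (simp add: q_def norm_divide norm_circ)
  hence q: "\<bar>Re q\<bar> \<le> 1" "\<bar>Im q\<bar> \<le> 1" using abs_Re_le_cmod[of q] abs_Im_le_cmod[of q] by linarith+
  have "ln (exp (-1)) \<le> ln (ln (2::real))"
  proof (subst ln_le_cancel_iff)
    have "2 \<le> exp (1::real)" using exp_ge_add_one_self[of 1] by simp
    hence "exp (-1::real) \<le> 1 / 2" by (simp add: exp_minus field_simps)
    thus "exp (-1) \<le> ln (2::real)" using ln2_ge_two_thirds by simp
  qed auto
  hence "- 1 \<le> ln (ln (2::real))" by simp
  thus "Re (decay_rate \<theta>) \<le> 3" using q by (simp add: decay_rate_def q_def[symmetric])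
  show "\<bar>Im (decay_rate \<theta>)\<bar> \<le> pi + 1" if "\<bar>\<theta>\<bar> \<le> pi"
    using q that by (simp add: decay_rate_def q_def[symmetric])
qed

text \<open>The quotient \<open>ln_expm1_primitive s / s\<close> is the average of
  \<open>ln_expm1_quot (t * s)\<close> over 0 <= t <= 1. Averaging the gain t ln 2 theta^2 / 192 of
  \<open>Re_ln_expm1_quot_le\<close> gives ln 2 theta^2 / 384, and the first summand is the value at
  angle 0.\<close>

lemma Re_decay_rate_ge:
  assumes "\<bar>\<theta>\<bar> \<le> pi"
  shows "pi\<^sup>2 / (12 * ln 2) + ln 2 * \<theta>\<^sup>2 / 384 \<le> Re (decay_rate \<theta>)"
proof -
  define q where "q = (\<lambda>z t. Re (ln_expm1_primitive (of_real t * z) / z))"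
  have dq: "(q z has_real_derivative Re (ln_expm1_quot (of_real t * z))) (at t)"
    if "0 \<le> t" "t \<le> 1" "norm z = ln 2" for z t
  proof -
    have z: "z \<noteq> 0" using that by auto
    have "t * norm z \<le> 1 * norm z" using that by (intro mult_right_mono) auto
    hence "t * norm z < 1" using that ln2_less_1 by linarith
    hence n: "norm (of_real t * z) < 1" using that by (simp add: norm_mult)
    have "((\<lambda>w. ln_expm1_primitive (w * z)) has_field_derivative ln_expm1_quot (of_real t * z) * z) (at (of_real t))"
    proof (rule DERIV_chain2[where g = "\<lambda>w. w * z"])
      show "(ln_expm1_primitive has_field_derivative ln_expm1_quot (of_real t * z)) (at (of_real t * z))"
        by (rule has_field_derivative_ln_expm1_primitive[OF n])
      show "((\<lambda>w. w * z) has_field_derivative z) (at (of_real t))"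
        by (auto intro!: derivative_eq_intros)
    qed
    hence "((\<lambda>w. ln_expm1_primitive (w * z) / z) has_field_derivative ln_expm1_quot (of_real t * z)) (at (of_real t))"
      using z by (auto dest: DERIV_cdivide[of _ _ _ _ z])
    hence "((\<lambda>t. ln_expm1_primitive (of_real t * z) / z) has_vector_derivative ln_expm1_quot (of_real t * z)) (at t)"
      by (rule has_vector_derivative_real_field)
    thus ?thesis unfolding q_def by (rule has_field_derivative_Re)
  qed
  \<comment> \<open>The averaging is done by monotonicity: \<open>f\<close> starts at 0, and its
    derivative is the nonnegative defect in \<open>Re_ln_expm1_quot_le\<close> at t.\<close>
  define f where "f = (\<lambda>t. q (of_real (ln 2)) t - q (circ \<theta>) t - ln 2 * \<theta>\<^sup>2 / 384 * t\<^sup>2)"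
  have "f 0 \<le> f 1"
  proof (rule DERIV_nonneg_imp_nondecreasing[of 0 1])
    fix t :: real assume t: "0 \<le> t" "t \<le> 1"
    have "t * ln 2 \<le> 1 * ln (2::real)" using t by (intro mult_right_mono) auto
    hence "t * ln (2::real) < 1" using ln2_less_1 by linarith
    from Re_ln_expm1_quot_le[OF _ this assms] 
    have "Re (ln_expm1_quot (of_real t * circ \<theta>)) \<le> Re (ln_expm1_quot (of_real t * of_real (ln 2))) - t * ln 2 * \<theta>\<^sup>2 / 192"
      using t by (simp add: circ_of_real mult_ac)
    moreover have "(f has_real_derivative Re (ln_expm1_quot (of_real t * of_real (ln 2))) - Re (ln_expm1_quot (of_real t * circ \<theta>))
       - ln 2 * \<theta>\<^sup>2 / 384 * (2 * t)) (at t)"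
      unfolding f_def
    proof (intro DERIV_diff)
      show "(q (of_real (ln 2)) has_real_derivative Re (ln_expm1_quot (of_real t * of_real (ln 2)))) (at t)"
        by (rule dq) (use t in auto)
      show "(q (circ \<theta>) has_real_derivative Re (ln_expm1_quot (of_real t * circ \<theta>))) (at t)"
        by (rule dq) (use t in \<open>auto simp: norm_circ\<close>)
      show "((\<lambda>t. ln 2 * \<theta>\<^sup>2 / 384 * t\<^sup>2) has_real_derivative ln 2 * \<theta>\<^sup>2 / 384 * (2 * t)) (at t)"
        by (auto intro!: derivative_eq_intros)
    qed
    ultimately show "\<exists>d. (f has_real_derivative d) (at t) \<and> 0 \<le> d" by (intro exI conjI) auto
  qed auto
  hence le: "q (circ \<theta>) 1 \<le> q (of_real (ln 2)) 1 - ln 2 * \<theta>\<^sup>2 / 384"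
  proof -
    have "q z 0 = 0" for z by (simp add: q_def)
    with \<open>f 0 \<le> f 1\<close> show ?thesis unfolding f_def by simp
  qed
  have "q (of_real (ln 2)) 1 = (ln 2 - ln 2 * ln (ln 2) - pi\<^sup>2 / 12) / ln 2"
    unfolding q_def of_real_1 mult_1 ln_expm1_primitive_ln2 of_real_divide[symmetric] by (rule Re_complex_of_real)
  also have "\<dots> = 1 - ln (ln 2) - pi\<^sup>2 / (12 * ln 2)" by (simp add: diff_divide_distrib)
  finally show ?thesis using le by (simp add: decay_rate_def q_def)
qed

text \<open>Multiplying the bound for Re eta by ln 2 gives a quadratic lower bound; it is weakened
  here to the exponential form that \<open>laplace_integral\<close> assumes. The constant 5000 is
  not sharp.\<close>

lemma norm_saddle_phase_ge:
  assumes "\<bar>\<theta>\<bar> \<le> pi"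
  shows "pi\<^sup>2 / 12 * exp (\<theta>\<^sup>2 / 5000) \<le> norm (saddle_phase \<theta>)"
proof -
  define x where "x = \<theta>\<^sup>2 / 5000"
  have "\<theta>\<^sup>2 \<le> pi\<^sup>2" using assms by (metis abs_le_square_iff abs_of_pos pi_gt_zero)
  moreover have "pi\<^sup>2 \<le> 4 ^ 2" using pi_less_4 by (intro power_mono) auto
  ultimately have x: "0 \<le> x" "x \<le> 1" and p: "pi\<^sup>2 \<le> 16" by (auto simp: x_def)
  have l2: "4/9 \<le> (ln (2::real))\<^sup>2" 
    using power_mono[OF ln2_ge_two_thirds, of 2] by (simp add: power2_eq_square)
  have "exp x \<le> 1 + x + x\<^sup>2" using x by (intro exp_bound) auto
  also have "x\<^sup>2 \<le> x" using x by (simp add: power2_eq_square mult_left_le)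
  finally have "pi\<^sup>2 / 12 * exp x \<le> pi\<^sup>2 / 12 * (1 + 2 * x)" by (intro mult_left_mono) auto
  also have "\<dots> = pi\<^sup>2 / 12 + pi\<^sup>2 * (\<theta>\<^sup>2 / 30000)" by (simp add: x_def field_simps)
  also have "\<dots> \<le> pi\<^sup>2 / 12 + 16 * (\<theta>\<^sup>2 / 30000)"
    using p by (intro add_left_mono mult_right_mono) auto
  also have "\<dots> \<le> pi\<^sup>2 / 12 + (4/9) * \<theta>\<^sup>2 / 384" by simp
  also have "\<dots> \<le> pi\<^sup>2 / 12 + (ln 2)\<^sup>2 * \<theta>\<^sup>2 / 384"
    using l2 by (intro add_left_mono divide_right_mono mult_right_mono) auto
  also have "\<dots> = ln 2 * (pi\<^sup>2 / (12 * ln 2) + ln 2 * \<theta>\<^sup>2 / 384)" by (simp add: field_simps power2_eq_square)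
  also have "\<dots> \<le> ln 2 * norm (decay_rate \<theta>)"
    using Re_decay_rate_ge[OF assms] complex_Re_le_cmod[of "decay_rate \<theta>"] by (intro mult_left_mono) auto
  also have "\<dots> = norm (saddle_phase \<theta>)" by (simp add: saddle_phase_of_real norm_mult norm_circ)
  finally show ?thesis by (simp add: x_def)
qed

section \<open>Taylor expansions of the phase and the weights at the saddle\<close>

lemma holomorphic_taylor_bound:
  assumes "f holomorphic_on ball 0 e" "e > 0"
  shows "\<exists>C\<ge>0. \<forall>z\<in>cball 0 (e / 2). 
     norm (f z - (\<Sum>i\<le>n. (deriv ^^ i) f 0 * z ^ i / fact i)) \<le> C * norm z ^ Suc n"
proof -
  have hol: "(deriv ^^ i) f holomorphic_on ball 0 e" for i
    by (rule holomorphic_higher_deriv[OF assms(1)]) auto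
  have sub: "cball 0 (e / 2) \<subseteq> ball (0::complex) e" using assms by auto
  have "bounded ((deriv ^^ Suc n) f ` cball 0 (e / 2))"
    by (rule compact_imp_bounded, rule compact_continuous_image)
       (use holomorphic_on_imp_continuous_on[OF holomorphic_on_subset[OF hol sub]] in \<open>auto simp del: funpow.simps\<close>)
  then obtain B where B: "\<And>z. z \<in> cball 0 (e / 2) \<Longrightarrow> norm ((deriv ^^ Suc n) f z) \<le> B"
    unfolding bounded_iff by blast
  have B0: "B \<ge> 0" using B[of 0] assms norm_ge_zero order_trans by (metis centre_in_cball half_gt_zero less_imp_le)
  have "norm ((deriv ^^ 0) f z - (\<Sum>i\<le>n. (deriv ^^ i) f 0 * (z - 0) ^ i / fact i)) \<le> B * norm (z - 0) ^ Suc n / fact n"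
    if z: "z \<in> cball 0 (e / 2)" for z
  proof (rule complex_Taylor[of "cball 0 (e / 2)"])
    fix i x assume "x \<in> cball (0::complex) (e / 2)"
    hence "x \<in> ball 0 e" using sub by blast
    thus "((deriv ^^ i) f has_field_derivative (deriv ^^ Suc i) f x) (at x within cball 0 (e / 2))"
      using holomorphic_derivI[OF hol open_ball] by (auto intro: has_field_derivative_at_within)
  qed (use z B assms in auto)
  hence "\<forall>z\<in>cball 0 (e / 2). norm (f z - (\<Sum>i\<le>n. (deriv ^^ i) f 0 * z ^ i / fact i)) \<le> B / fact n * norm z ^ Suc n"
    by auto
  moreover have "B / fact n \<ge> 0" using B0 by simp
  ultimately show ?thesis by blast
qed

lemma norm_circ_less_1:
  assumes "norm z < 1 / 4"
  shows "norm (circ z) < 1"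
proof -
  have "norm (circ z) = ln 2 * exp (- Im z)" by (simp add: circ_def norm_mult)
  also have "\<dots> \<le> (25/36) * exp (1/4)"
    using abs_Im_le_cmod[of z] assms ln2_le_25_over_36 by (intro mult_mono) auto
  also have "\<dots> \<le> (25/36) * (1 + 1/4 + (1/4)\<^sup>2)" by (intro mult_left_mono exp_bound) auto
  also have "\<dots> < 1" by (simp add: power2_eq_square)
  finally show ?thesis .
qed

lemma has_field_derivative_circ: "(circ has_field_derivative \<i> * circ z) (at z)"
  unfolding circ_def[abs_def] by (auto intro!: derivative_eq_intros)

text \<open>The bracket is log s + log ((e^s - 1)/s) = log (e^s - 1) at s = \<open>circ z\<close>,
  so it vanishes at s = ln 2.\<close>

definition saddle_phase_deriv :: "complex \<Rightarrow> complex" where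
  "saddle_phase_deriv z = - \<i> * circ z * (of_real (ln (ln 2)) + \<i> * z + ln_expm1_quot (circ z))"

lemma has_field_derivative_saddle_phase:
  assumes "norm z < 1 / 4"
  shows "(saddle_phase has_field_derivative saddle_phase_deriv z) (at z)"
proof -
  have "((\<lambda>z. ln_expm1_primitive (circ z)) has_field_derivative ln_expm1_quot (circ z) * (\<i> * circ z)) (at z)"
    by (rule DERIV_chain2[OF has_field_derivative_ln_expm1_primitive[OF norm_circ_less_1[OF assms]] has_field_derivative_circ])
  thus ?thesis unfolding saddle_phase_def[abs_def] saddle_phase_deriv_def
    by (auto intro!: derivative_eq_intros has_field_derivative_circ simp: algebra_simps)
qed

lemma ln_expm1_quot_ln2: "ln_expm1_quot (of_real (ln 2)) = of_real (- ln (ln 2))"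
proof -
  have "expm1_quot (of_real (ln 2)) = of_real (1 / ln 2)" by (simp add: expm1_quot_of_real del: of_real_divide)
  also have "Ln \<dots> = of_real (ln (1 / ln 2))" by (rule Ln_of_real) auto
  finally show ?thesis by (simp add: ln_expm1_quot_def ln_div)
qed

lemma has_field_derivative_ln_expm1_quot_ln2:
  "(ln_expm1_quot has_field_derivative of_real (2 - 1 / ln 2)) (at (of_real (ln 2)))"
proof -
  let ?r = "complex_of_real (ln 2)"
  have e: "exp ?r = 2" using exp_of_real[of "ln 2"] by simp
  have q: "(exp ?r - 1) / ?r \<notin> \<real>\<^sub>\<le>\<^sub>0"
  proof -
    have "(exp ?r - 1) / ?r = of_real (1 / ln 2)" by (simp add: e)
    thus ?thesis by (simp del: of_real_divide)
  qed
  have "((\<lambda>z. Ln ((exp z - 1) / z)) has_field_derivative 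
      inverse ((exp ?r - 1) / ?r) * ((exp ?r * ?r - (exp ?r - 1)) / (?r * ?r))) (at ?r)"
    using q by (intro DERIV_chain2[OF has_field_derivative_Ln]) (auto intro!: derivative_eq_intros)
  also have "inverse ((exp ?r - 1) / ?r) * ((exp ?r * ?r - (exp ?r - 1)) / (?r * ?r)) = of_real (2 - 1 / ln 2)"
    by (simp add: e field_simps)
  finally show ?thesis
    by (rule has_field_derivative_transform_within_open[of _ _ _ "- {0}"])
       (auto simp: ln_expm1_quot_def expm1_quot_def)
qed

lemma saddle_phase_deriv_0: "saddle_phase_deriv 0 = 0"
  by (simp add: saddle_phase_deriv_def circ_0 ln_expm1_quot_ln2)

text \<open>The bracket in \<open>saddle_phase_deriv\<close> is zero at 0, so only its own
  derivative i + (2 - 1/ln 2) i ln 2 = 2 i ln 2 contributes, multiplied by -i ln 2.\<close>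

lemma has_field_derivative_saddle_phase_deriv_0:
  "(saddle_phase_deriv has_field_derivative of_real (2 * (ln 2)\<^sup>2)) (at 0)"
proof -
  have "(ln_expm1_quot has_field_derivative of_real (2 - 1 / ln 2)) (at (circ 0))"
    using has_field_derivative_ln_expm1_quot_ln2 by (simp add: circ_0)
  from DERIV_chain2[OF this has_field_derivative_circ]
  have *: "((\<lambda>z. ln_expm1_quot (circ z)) has_field_derivative of_real (2 - 1 / ln 2) * (\<i> * circ 0)) (at 0)" .
  have "(saddle_phase_deriv has_field_derivative
     - \<i> * (\<i> * circ 0) * (of_real (ln (ln 2)) + \<i> * 0 + ln_expm1_quot (circ 0)) + 
     (\<i> + of_real (2 - 1 / ln 2) * (\<i> * circ 0)) * (- \<i> * circ 0)) (at 0)"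
    unfolding saddle_phase_deriv_def[abs_def]
    by (intro DERIV_mult DERIV_cmult has_field_derivative_circ) (auto intro!: derivative_eq_intros *)
  thus ?thesis
    by (rule DERIV_cong) (simp add: circ_0 ln_expm1_quot_ln2 field_simps power2_eq_square)
qed

lemma saddle_phase_nonzero_near_0:
  "\<exists>e>0. e \<le> 1 / 4 \<and> saddle_phase holomorphic_on ball 0 e \<and> (\<forall>z\<in>ball 0 e. Re (saddle_phase z) > 0)"
proof -
  have hol: "saddle_phase holomorphic_on ball 0 (1 / 4)"
    unfolding holomorphic_on_open[OF open_ball] using has_field_derivative_saddle_phase mem_ball_0 by blast
  have "open (ball 0 (1 / 4) \<inter> saddle_phase -` {w. Re w > 0})"
    using holomorphic_on_imp_continuous_on[OF hol] open_halfspace_Re_gt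
    by (intro continuous_open_preimage) auto
  moreover have "0 \<in> ball 0 (1 / 4) \<inter> saddle_phase -` {w. Re w > 0}"
    by (simp add: saddle_phase_0 del: of_real_divide of_real_power)
  ultimately obtain e where e: "e > 0" "ball 0 e \<subseteq> ball 0 (1 / 4) \<inter> saddle_phase -` {w. Re w > 0}"
    by (rule openE)
  have "\<forall>z\<in>ball 0 (min e (1/4)). Re (saddle_phase z) > 0" using e(2) by auto
  moreover have "saddle_phase holomorphic_on ball 0 (min e (1/4))"
    by (rule holomorphic_on_subset[OF hol]) auto
  ultimately show ?thesis using e(1) by (intro exI[of _ "min e (1/4)"]) auto
qed

text \<open>Third-order Taylor expansion of the logarithm \<open>l\<close> of the normalised phase.
  As the first derivative of the phase vanishes, l''(0) = 2 (ln 2)^2 / (pi^2/12), and half of it is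
  the quadratic coefficient. The cubic coefficient need not be known.\<close>

lemma saddle_phase_local:
  "\<exists>b C \<delta>. C \<ge> 0 \<and> \<delta> > 0 \<and> (\<forall>\<theta>. \<bar>\<theta>\<bar> \<le> \<delta> \<longrightarrow> (\<exists>\<xi>. saddle_phase (of_real \<theta>) = 
     of_real (pi\<^sup>2 / 12) * exp (of_real (12 * (ln 2)\<^sup>2 / pi\<^sup>2 * \<theta>\<^sup>2) + b * of_real \<theta> ^ 3 + \<xi>) \<and> norm \<xi> \<le> C * \<theta> ^ 4))"
proof -
  obtain e where e: "e > 0" "e \<le> 1 / 4" and hol: "saddle_phase holomorphic_on ball 0 e" 
    and pos: "\<And>z. z \<in> ball 0 e \<Longrightarrow> Re (saddle_phase z) > 0"
    using saddle_phase_nonzero_near_0 by blast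
  let ?al = "complex_of_real (pi\<^sup>2 / 12)"
  define l where "l = (\<lambda>z. Ln (saddle_phase z / ?al))"
  have re: "Re (saddle_phase z / ?al) > 0" if "z \<in> ball 0 e" for z using pos[OF that] by simp
  have dl: "(l has_field_derivative saddle_phase_deriv z / saddle_phase z) (at z)" if z: "z \<in> ball 0 e" for z
  proof -
    have n: "norm z < 1 / 4" using z e by simp
    have nz: "saddle_phase z \<noteq> 0" using pos[OF z] by auto
    have "saddle_phase z / ?al \<notin> \<real>\<^sub>\<le>\<^sub>0" using re[OF z] complex_nonpos_Reals_iff by force
    from DERIV_chain2[OF has_field_derivative_Ln[OF this] DERIV_cdivide[OF has_field_derivative_saddle_phase[OF n]]]
    show ?thesis unfolding l_def by (rule DERIV_cong) (use nz in \<open>simp add: field_simps\<close>)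
  qed
  have holl: "l holomorphic_on ball 0 e" unfolding holomorphic_on_open[OF open_ball] using dl by blast
  have l0: "l 0 = 0" by (simp add: l_def saddle_phase_0)
  have d0: "deriv l 0 = 0" using DERIV_imp_deriv[OF dl[of 0]] e by (simp add: saddle_phase_deriv_0)
  have d1: "deriv (deriv l) 0 = 2 * of_real (12 * (ln 2)\<^sup>2 / pi\<^sup>2)"
  proof -
    have "((\<lambda>z. saddle_phase_deriv z / saddle_phase z) has_field_derivative
       (of_real (2 * (ln 2)\<^sup>2) * saddle_phase 0 - saddle_phase_deriv 0 * saddle_phase_deriv 0) / (saddle_phase 0 * saddle_phase 0)) (at 0)"
      by (intro DERIV_divide has_field_derivative_saddle_phase_deriv_0 has_field_derivative_saddle_phase)
         (auto simp: saddle_phase_0)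
    hence "((\<lambda>z. saddle_phase_deriv z / saddle_phase z) has_field_derivative 2 * of_real (12 * (ln 2)\<^sup>2 / pi\<^sup>2)) (at 0)"
      by (rule DERIV_cong) (simp add: saddle_phase_0 saddle_phase_deriv_0 power4_eq_xxxx power2_eq_square)
    hence "(deriv l has_field_derivative 2 * of_real (12 * (ln 2)\<^sup>2 / pi\<^sup>2)) (at 0)"
      by (rule has_field_derivative_transform_within_open[of _ _ _ "ball 0 e"])
         (use e in \<open>auto intro: DERIV_imp_deriv[OF dl, symmetric]\<close>)
    thus ?thesis by (rule DERIV_imp_deriv)
  qed
  define b where "b = (deriv ^^ 3) l 0 / 6"
  have S: "(\<Sum>i\<le>3. (deriv ^^ i) l 0 * z ^ i / fact i) = of_real (12 * (ln 2)\<^sup>2 / pi\<^sup>2) * z\<^sup>2 + b * z ^ 3" for z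
    using d1 by (simp add: eval_nat_numeral l0 d0 b_def)
  from holomorphic_taylor_bound[OF holl e(1), of 3] obtain C where C: "C \<ge> 0"
    "\<And>z. z \<in> cball 0 (e / 2) \<Longrightarrow> norm (l z - (of_real (12 * (ln 2)\<^sup>2 / pi\<^sup>2) * z\<^sup>2 + b * z ^ 3)) \<le> C * norm z ^ 4"
    unfolding S by auto
  show ?thesis
  proof (rule exI[of _ b], rule exI[of _ C], rule exI[of _ "e / 2"], intro conjI allI impI)
    fix \<theta> :: real assume th: "\<bar>\<theta>\<bar> \<le> e / 2"
    define \<xi> where "\<xi> = l \<theta> - (of_real (12 * (ln 2)\<^sup>2 / pi\<^sup>2) * (of_real \<theta>)\<^sup>2 + b * of_real \<theta> ^ 3)"
    have "complex_of_real \<theta> \<in> ball 0 e" using th e by simp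
    hence "saddle_phase \<theta> = ?al * exp (l \<theta>)"
      using pos[of \<theta>] by (subst l_def, subst exp_Ln) auto
    also have "l \<theta> = of_real (12 * (ln 2)\<^sup>2 / pi\<^sup>2 * \<theta>\<^sup>2) + b * of_real \<theta> ^ 3 + \<xi>"
      by (simp add: \<xi>_def)
    finally have "saddle_phase \<theta> = ?al * exp (of_real (12 * (ln 2)\<^sup>2 / pi\<^sup>2 * \<theta>\<^sup>2) + b * of_real \<theta> ^ 3 + \<xi>)" .
    moreover have "norm \<xi> \<le> C * \<theta> ^ 4"
      using C(2)[of "of_real \<theta>"] th by (simp add: \<xi>_def power_even_abs)
    ultimately show "\<exists>\<xi>. saddle_phase \<theta> = ?al * exp (of_real (12 * (ln 2)\<^sup>2 / pi\<^sup>2 * \<theta>\<^sup>2) + b * of_real \<theta> ^ 3 + \<xi>) \<and> norm \<xi> \<le> C * \<theta> ^ 4"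
      by blast
  qed (use C e in auto)
qed

text \<open>\<open>j = 0\<close> and \<open>j = 1\<close> are the weights of the two terms of the linearised square root.\<close>

definition saddle_weight :: "nat \<Rightarrow> complex \<Rightarrow> complex" where
  "saddle_weight j z = exp (ln_expm1_quot (circ z) / 2) * (circ z / saddle_phase z) ^ Suc j"

lemma saddle_weight_0: "saddle_weight j 0 = of_real (1 / sqrt (ln 2) * (12 * ln 2 / pi\<^sup>2) ^ Suc j)"
proof -
  have "exp (ln_expm1_quot (circ 0) / 2) = of_real (exp (- ln (ln 2) / 2))"
    unfolding circ_0 ln_expm1_quot_ln2 by (simp flip: exp_of_real)
  also have "- ln (ln 2) / 2 = - ln (sqrt (ln (2::real)))" by (simp add: ln_sqrt)
  also have "exp (- ln (sqrt (ln (2::real)))) = 1 / sqrt (ln 2)" by (simp add: exp_minus inverse_eq_divide)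
  finally show ?thesis by (simp add: saddle_weight_def circ_0 saddle_phase_0 mult_ac)
qed

lemma saddle_weight_local:
  "\<exists>d C \<delta>. C \<ge> 0 \<and> \<delta> > 0 \<and> (\<forall>\<theta>. \<bar>\<theta>\<bar> \<le> \<delta> \<longrightarrow>
     norm (saddle_weight j (of_real \<theta>) - saddle_weight j 0 - d * of_real \<theta>) \<le> C * \<theta>\<^sup>2)"
proof -
  obtain e where e: "e > 0" "e \<le> 1 / 4" and hol: "saddle_phase holomorphic_on ball 0 e" 
    and pos: "\<And>z. z \<in> ball 0 e \<Longrightarrow> Re (saddle_phase z) > 0"
    using saddle_phase_nonzero_near_0 by blast
  have "circ holomorphic_on ball 0 e" unfolding circ_def[abs_def] by (intro holomorphic_intros)
  moreover have "circ ` ball 0 e \<subseteq> ball 0 1" using norm_circ_less_1 e by auto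
  ultimately have "(\<lambda>z. ln_expm1_quot (circ z)) holomorphic_on ball 0 e"
    using holomorphic_on_compose_gen[OF _ holomorphic_ln_expm1_quot, unfolded o_def] by blast
  moreover have "saddle_phase z \<noteq> 0" if "z \<in> ball 0 e" for z using pos[OF that] by auto
  ultimately have "saddle_weight j holomorphic_on ball 0 e"
    unfolding saddle_weight_def[abs_def] using hol \<open>circ holomorphic_on _\<close>
    by (intro holomorphic_intros) auto
  from holomorphic_taylor_bound[OF this e(1), of 1] obtain C where C: "C \<ge> 0"
    "\<And>z. z \<in> cball 0 (e / 2) \<Longrightarrow> norm (saddle_weight j z - saddle_weight j 0 - deriv (saddle_weight j) 0 * z) \<le> C * (norm z)\<^sup>2"
    by (auto simp: power2_eq_square algebra_simps)
  show ?thesis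
  proof (rule exI[of _ "deriv (saddle_weight j) 0"], rule exI[of _ C], rule exI[of _ "e / 2"], intro conjI allI impI)
    fix \<theta> :: real assume "\<bar>\<theta>\<bar> \<le> e / 2"
    thus "norm (saddle_weight j (of_real \<theta>) - saddle_weight j 0 - deriv (saddle_weight j) 0 * of_real \<theta>) \<le> C * \<theta>\<^sup>2"
      using C(2)[of "of_real \<theta>"] by simp
  qed (use C e in auto)
qed

lemma continuous_on_circ_compose:
  shows "continuous_on S (\<lambda>\<theta>. circ (of_real \<theta>))"
    and "continuous_on S (\<lambda>\<theta>. ln_expm1_quot (circ (of_real \<theta>)))"
    and "continuous_on S (\<lambda>\<theta>. ln_expm1_primitive (circ (of_real \<theta>)))"
proof -
  show c: "continuous_on S (\<lambda>\<theta>. circ (of_real \<theta>))"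
    unfolding circ_def by (intro continuous_intros)
  have sub: "(\<lambda>\<theta>. circ (of_real \<theta>)) ` S \<subseteq> ball 0 1" using ln2_less_1 by (auto simp: norm_circ)
  show "continuous_on S (\<lambda>\<theta>. ln_expm1_quot (circ (of_real \<theta>)))"
    by (rule continuous_on_compose2[OF holomorphic_on_imp_continuous_on[OF holomorphic_ln_expm1_quot] c sub])
  show "continuous_on S (\<lambda>\<theta>. ln_expm1_primitive (circ (of_real \<theta>)))"
    by (rule continuous_on_compose2[OF holomorphic_on_imp_continuous_on[OF holomorphic_ln_expm1_primitive] c sub])
qed

lemma saddle_phase_nonzero: "\<bar>\<theta>\<bar> \<le> pi \<Longrightarrow> saddle_phase (of_real \<theta>) \<noteq> 0"
  using norm_saddle_phase_ge[of \<theta>] by (metis divide_pos_pos exp_gt_zero mult_pos_pos norm_zero not_le pi_gt_zero zero_less_numeral zero_less_power)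

lemma continuous_on_saddle_phase: "continuous_on S (\<lambda>\<theta>. saddle_phase (of_real \<theta>))"
  unfolding saddle_phase_def by (intro continuous_intros continuous_on_circ_compose)

lemma saddle_integral:
  "\<exists>D. \<forall>n\<ge>1. norm ((pi\<^sup>2 / 12) ^ n * integral {-pi..pi} (\<lambda>\<theta>. saddle_weight j (of_real \<theta>) / saddle_phase (of_real \<theta>) ^ n) -
     saddle_weight j 0 * sqrt (pi / (n * (12 * (ln 2)\<^sup>2 / pi\<^sup>2)))) \<le> D / (n * sqrt n)"
proof -
  obtain b C1 \<delta>1 where 1: "C1 \<ge> 0" "\<delta>1 > 0" "\<And>\<theta>. \<bar>\<theta>\<bar> \<le> \<delta>1 \<Longrightarrow> \<exists>\<xi>. saddle_phase (of_real \<theta>) = 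
     of_real (pi\<^sup>2 / 12) * exp (of_real (12 * (ln 2)\<^sup>2 / pi\<^sup>2 * \<theta>\<^sup>2) + b * of_real \<theta> ^ 3 + \<xi>) \<and> norm \<xi> \<le> C1 * \<theta> ^ 4"
    using saddle_phase_local by blast
  obtain d C2 \<delta>2 where 2: "C2 \<ge> 0" "\<delta>2 > 0" "\<And>\<theta>. \<bar>\<theta>\<bar> \<le> \<delta>2 \<Longrightarrow>
     norm (saddle_weight j (of_real \<theta>) - saddle_weight j 0 - d * of_real \<theta>) \<le> C2 * \<theta>\<^sup>2"
    using saddle_weight_local by blast
  define C \<delta> where "C = max C1 C2" and "\<delta> = min (min \<delta>1 \<delta>2) pi"
  show ?thesis
  proof (rule laplace_integral[where \<kappa> = "1 / 5000" and \<delta> = \<delta> and C = C and b = b])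
    show "continuous_on {-pi..pi} (\<lambda>\<theta>. saddle_weight j (of_real \<theta>))"
      unfolding saddle_weight_def
      by (intro continuous_intros continuous_on_circ_compose continuous_on_saddle_phase ballI saddle_phase_nonzero) auto
    fix \<theta> :: real
    show "pi\<^sup>2 / 12 * exp (1 / 5000 * \<theta>\<^sup>2) \<le> norm (saddle_phase (of_real \<theta>))" if "\<theta> \<in> {-pi..pi}"
      using norm_saddle_phase_ge[of \<theta>] that by auto
    assume th: "\<bar>\<theta>\<bar> \<le> \<delta>"
    have le: "C1 * \<theta> ^ 4 \<le> C * \<theta> ^ 4" "C2 * \<theta>\<^sup>2 \<le> C * \<theta>\<^sup>2" 
      by (auto simp: C_def intro!: mult_right_mono)
    show "\<exists>\<xi>. saddle_phase (of_real \<theta>) = of_real (pi\<^sup>2 / 12) *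
         exp (of_real (12 * (ln 2)\<^sup>2 / pi\<^sup>2 * \<theta>\<^sup>2) + b * of_real \<theta> ^ 3 + \<xi>) \<and> norm \<xi> \<le> C * \<theta> ^ 4"
      using 1(3)[of \<theta>] th le order_trans by (auto simp: \<delta>_def)
    show "norm (saddle_weight j (of_real \<theta>) - saddle_weight j 0 - d * of_real \<theta>) \<le> C * \<theta>\<^sup>2"
      using 2(3)[of \<theta>] th le order_trans by (auto simp: \<delta>_def)
  qed (use 1 2 in \<open>auto simp: C_def \<delta>_def continuous_on_saddle_phase\<close>)
qed

section \<open>Trapezoidal rule for the logarithm of the product\<close>

text \<open>Expanding the primitive to second order and its derivative to first order about u, the
  terms with the second derivative cancel in the trapezoidal combination. A cubic remainder is
  left.\<close>

lemma trapezoid_interval: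
  "\<exists>B\<ge>0. \<forall>u v. norm u \<le> ln 2 \<longrightarrow> norm v \<le> ln 2 \<longrightarrow>
     norm (ln_expm1_primitive v - ln_expm1_primitive u - 
       (v - u) * (ln_expm1_quot u + ln_expm1_quot v) / 2) \<le> B * norm (v - u) ^ 3"
proof -
  \<comment> \<open>\<open>f i\<close> is the i-th derivative of \<open>ln_expm1_primitive\<close>,
    so \<open>B\<close> bounds the third one on the disc.\<close>
  define f where "f = (\<lambda>i. case i of 0 \<Rightarrow> ln_expm1_primitive | Suc i \<Rightarrow> (deriv ^^ i) ln_expm1_quot)"
  let ?S = "cball (0::complex) (ln 2)"
  have S: "?S \<subseteq> ball 0 1" using ln2_less_1 by auto
  have hol: "(deriv ^^ i) ln_expm1_quot holomorphic_on ball 0 1" for i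
    by (rule holomorphic_higher_deriv[OF holomorphic_ln_expm1_quot]) auto
  have df: "(f i has_field_derivative f (Suc i) z) (at z within ?S)" if "z \<in> ?S" for i z
  proof -
    have z: "z \<in> ball 0 1" using that S by blast
    have "(f i has_field_derivative f (Suc i) z) (at z)"
      using has_field_derivative_ln_expm1_primitive[of z] holomorphic_derivI[OF hol open_ball z] z
      by (auto simp: f_def split: nat.splits)
    thus ?thesis by (rule has_field_derivative_at_within)
  qed
  have "continuous_on ?S (f 3)" unfolding f_def 
    using holomorphic_on_imp_continuous_on[OF holomorphic_on_subset[OF hol S]] by (simp add: numeral_3_eq_3 del: funpow.simps)
  hence "bounded (f 3 ` ?S)" by (intro compact_imp_bounded compact_continuous_image) auto
  then obtain B where B: "\<And>z. z \<in> ?S \<Longrightarrow> norm (f 3 z) \<le> B" unfolding bounded_iff by blast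
  have B0: "B \<ge> 0" by (rule order.trans[OF norm_ge_zero B[of 0]]) simp
  have "norm (f 0 v - f 0 u - (v - u) * (f 1 u + f 1 v) / 2) \<le> B * norm (v - u) ^ 3"
    if uv: "u \<in> ?S" "v \<in> ?S" for u v
  proof -
    have "norm (f 0 v - (\<Sum>i\<le>2. f i u * (v - u) ^ i / fact i)) \<le> B * norm (v - u) ^ Suc 2 / fact 2"
      by (rule complex_Taylor[of ?S]) (use df uv B in \<open>auto simp: numeral_3_eq_3\<close>)
    hence 1: "norm (f 0 v - f 0 u - f 1 u * (v - u) - f 2 u * (v - u)\<^sup>2 / 2) \<le> B * norm (v - u) ^ 3 / 2"
      by (simp add: numeral_2_eq_2 numeral_3_eq_3 diff_diff_eq)
    have "norm (f (Suc 0) v - (\<Sum>i\<le>1. f (Suc i) u * (v - u) ^ i / fact i)) \<le> B * norm (v - u) ^ Suc 1 / fact 1"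
      by (rule complex_Taylor[of ?S "1" "\<lambda>i. f (Suc i)"]) (use df uv B in \<open>auto simp: numeral_3_eq_3\<close>)
    hence "norm (f 1 v - f 1 u - f 2 u * (v - u)) \<le> B * (norm (v - u))\<^sup>2"
      by (simp add: numeral_2_eq_2 diff_diff_eq)
    hence "norm (v - u) / 2 * norm (f 1 v - f 1 u - f 2 u * (v - u)) \<le> norm (v - u) / 2 * (B * (norm (v - u))\<^sup>2)"
      by (intro mult_left_mono) auto
    hence 2: "norm ((v - u) / 2 * (f 1 v - f 1 u - f 2 u * (v - u))) \<le> B * norm (v - u) ^ 3 / 2"
      by (simp add: norm_mult power2_eq_square power3_eq_cube norm_divide mult_ac)
    have "f 0 v - f 0 u - (v - u) * (f 1 u + f 1 v) / 2 =
       (f 0 v - f 0 u - f 1 u * (v - u) - f 2 u * (v - u)\<^sup>2 / 2) - (v - u) / 2 * (f 1 v - f 1 u - f 2 u * (v - u))"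
      by (simp add: field_simps power2_eq_square)
    also have "norm \<dots> \<le> B * norm (v - u) ^ 3 / 2 + B * norm (v - u) ^ 3 / 2"
      by (rule order.trans[OF norm_triangle_ineq4 add_mono[OF 1 2]])
    finally show ?thesis by simp
  qed
  thus ?thesis using B0 by (intro exI[of _ B]) (auto simp: f_def)
qed

text \<open>Trapezoidal rule on the ray from 0 to s with k steps h = s/k. The k local errors of
  order |h|^3, divided by |h|, add up to O(1/k). The term \<open>ln_expm1_quot s / 2\<close> is the
  half weight of the endpoint s.\<close>

lemma trapezoid_sum:
  "\<exists>B\<ge>0. \<forall>s k. norm s = ln 2 \<longrightarrow> k \<ge> 1 \<longrightarrow>
     norm ((\<Sum>j\<in>{1..k}. ln_expm1_quot (of_nat j * s / of_nat k)) - 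
       of_nat k * (ln_expm1_primitive s / s) - ln_expm1_quot s / 2) \<le> B / real k"
proof -
  obtain B where B: "B \<ge> 0" "\<And>u v. norm u \<le> ln 2 \<Longrightarrow> norm v \<le> ln 2 \<Longrightarrow>
     norm (ln_expm1_primitive v - ln_expm1_primitive u - 
       (v - u) * (ln_expm1_quot u + ln_expm1_quot v) / 2) \<le> B * norm (v - u) ^ 3"
    using trapezoid_interval by blast
  have "norm ((\<Sum>j\<in>{1..k}. ln_expm1_quot (of_nat j * s / of_nat k)) - 
       of_nat k * (ln_expm1_primitive s / s) - ln_expm1_quot s / 2) \<le> B / real k"
    if s: "norm s = ln 2" and k: "k \<ge> 1" for s k
  proof -
    define p where "p = (\<lambda>j. of_nat j * s / of_nat k)"
    define h where "h = s / of_nat k"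
    have h: "h \<noteq> 0" "norm h = ln 2 / k" using s k by (auto simp: h_def norm_divide)
    have p: "norm (p j) \<le> ln 2" if "j \<le> k" for j
    proof -
      have "real j / real k * norm s \<le> 1 * norm s" using that k by (intro mult_right_mono) auto
      thus ?thesis using s by (simp add: p_def norm_mult norm_divide)
    qed
    have step: "p (Suc j) - p j = h" for j by (simp add: p_def h_def add_divide_distrib algebra_simps)
    define F G where "F = ln_expm1_primitive" and "G = ln_expm1_quot"
    have G0: "G 0 = 0" by (simp add: G_def ln_expm1_quot_def)
    have pk: "p 0 = 0" "p k = s" using k by (auto simp: p_def)
    have "(\<Sum>j<k. F (p (Suc j)) - F (p j)) = F s"
      using sum_lessThan_telescope[of "\<lambda>j. F (p j)" k] pk by (simp add: F_def)
    moreover have "(\<Sum>j<k. h * (G (p j) + G (p (Suc j))) / 2) = h * ((\<Sum>j\<in>{1..k}. G (p j)) - G s / 2)"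
    proof -
      \<comment> \<open>The endpoint 0 contributes nothing because \<open>G 0 = 0\<close>, so the
        sum may start at j = 1.\<close>
      have "(\<Sum>j<k. G (p j)) = (\<Sum>j\<in>{1..k}. G (p j)) - G s"
      proof -
        have "(\<Sum>j<Suc k. G (p j)) = G (p 0) + (\<Sum>j<k. G (p (Suc j)))" by (rule sum.lessThan_Suc_shift)
        thus ?thesis using pk G0 by (simp add: sum.atLeast1_atMost_eq eq_diff_eq)
      qed
      moreover have "(\<Sum>j<k. G (p (Suc j))) = (\<Sum>j\<in>{1..k}. G (p j))" by (simp add: sum.atLeast1_atMost_eq)
      ultimately have "(\<Sum>j<k. G (p j) + G (p (Suc j))) = 2 * ((\<Sum>j\<in>{1..k}. G (p j)) - G s / 2)"
        by (simp add: sum.distrib)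
      thus ?thesis by (simp flip: sum_distrib_left sum_divide_distrib)
    qed
    ultimately have "F s - h * ((\<Sum>j\<in>{1..k}. G (p j)) - G s / 2) =
        (\<Sum>j<k. F (p (Suc j)) - F (p j) - (p (Suc j) - p j) * (G (p j) + G (p (Suc j))) / 2)"
      by (simp add: sum_subtractf step)
    also have "norm \<dots> \<le> (\<Sum>j<k. B * norm (p (Suc j) - p j) ^ 3)"
      unfolding F_def G_def by (intro sum_norm_le B(2) p) auto
    also have "\<dots> = real k * (B * norm h ^ 3)" by (simp add: step)
    finally have "norm (F s - h * ((\<Sum>j\<in>{1..k}. G (p j)) - G s / 2)) / norm h \<le> real k * (B * norm h ^ 3) / norm h"
      by (intro divide_right_mono) auto
    also have "real k * (B * norm h ^ 3) / norm h = B * (ln 2)\<^sup>2 / k"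
      using k by (simp add: h power2_eq_square power3_eq_cube)
    also have "\<dots> \<le> B / k"
    proof -
      have "(ln (2::real))\<^sup>2 \<le> 1" using ln2_less_1 by (intro power_le_one) auto
      thus ?thesis using B(1) by (intro divide_right_mono mult_left_le) auto
    qed
    also have "norm (F s - h * ((\<Sum>j\<in>{1..k}. G (p j)) - G s / 2)) / norm h =
       norm ((F s - h * ((\<Sum>j\<in>{1..k}. G (p j)) - G s / 2)) / h)" by (simp add: norm_divide)
    also have "(F s - h * ((\<Sum>j\<in>{1..k}. G (p j)) - G s / 2)) / h = F s / h - ((\<Sum>j\<in>{1..k}. G (p j)) - G s / 2)"
      using h by (simp add: diff_divide_distrib)
    also have "F s / h = of_nat k * (F s / s)" by (simp add: h_def)
    also have "norm (of_nat k * (F s / s) - ((\<Sum>j\<in>{1..k}. G (p j)) - G s / 2)) = 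
       norm ((\<Sum>j\<in>{1..k}. G (p j)) - of_nat k * (F s / s) - G s / 2)"
      by (subst norm_minus_commute) (simp add: algebra_simps)
    finally show ?thesis by (simp add: F_def G_def p_def)
  qed
  thus ?thesis using B(1) by blast
qed

section \<open>Factorisation of the products on the circle and linearisation of the square
  root\<close>

definition expm1_prod :: "nat \<Rightarrow> complex \<Rightarrow> complex" where
  "expm1_prod k z = (\<Prod>j\<in>{1..k}. exp (of_nat j * z) - 1)"

text \<open>An exact identity. Each factor e^(js/k) - 1 is (js/k) times \<open>expm1_quot\<close>;
  the linear parts multiply to k! (s/k)^k, which the Stirling ratio rewrites without error. The last
  exponential holds precisely the error of the trapezoidal rule.\<close>

lemma expm1_prod_circ:
  assumes "k \<ge> 1"
  shows "expm1_prod k (circ (of_real \<theta>) / of_nat k) = of_real (stirling_ratio k * sqrt k) * 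
    (exp (- decay_rate \<theta>) ^ k * exp (ln_expm1_quot (circ (of_real \<theta>)) / 2)) *
    exp ((\<Sum>j\<in>{1..k}. ln_expm1_quot (of_nat j * circ (of_real \<theta>) / of_nat k)) - 
       of_nat k * (ln_expm1_primitive (circ (of_real \<theta>)) / circ (of_real \<theta>)) - ln_expm1_quot (circ (of_real \<theta>)) / 2)"
proof -
  define s where "s = circ (of_real \<theta>)"
  define \<Sigma> where "\<Sigma> = (\<Sum>j\<in>{1..k}. ln_expm1_quot (of_nat j * s / of_nat k))"
  define q where "q = ln_expm1_primitive s / s"
  have n: "norm (of_nat j * s / of_nat k) < 1" if "j \<in> {1..k}" for j
  proof -
    have "real j / real k * ln 2 \<le> 1 * ln 2" using that by (intro mult_right_mono) auto
    thus ?thesis using ln2_less_1 by (simp add: norm_mult norm_divide s_def norm_circ)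
  qed
  have "expm1_prod k (s / of_nat k) = (\<Prod>j\<in>{1..k}. (of_nat j * s / of_nat k) * exp (ln_expm1_quot (of_nat j * s / of_nat k)))"
    unfolding expm1_prod_def by (intro prod.cong refl) (simp only: exp_ln_expm1_quot[OF n] expm1_quot_mult times_divide_eq_right)
  also have "\<dots> = (\<Prod>j\<in>{1..k}. of_nat j) * (s / of_nat k) ^ k * exp \<Sigma>"
    by (simp add: prod.distrib exp_sum \<Sigma>_def prod_dividef power_divide)
  also have "(\<Prod>j\<in>{1..k}. of_nat j) = (fact k :: complex)" by (simp add: fact_prod)
  also have "s ^ k = exp (of_nat k * (of_real (ln (ln 2)) + \<i> * of_real \<theta>))"
    by (simp add: s_def circ_def exp_of_nat_mult exp_add exp_of_real)
  hence "(s / of_nat k) ^ k = of_real (1 / real k ^ k) * exp (of_nat k * (of_real (ln (ln 2)) + \<i> * of_real \<theta>))"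
    by (simp add: power_divide)
  also have "fact k * (of_real (1 / real k ^ k) * exp (of_nat k * (of_real (ln (ln 2)) + \<i> * of_real \<theta>))) * exp \<Sigma> =
     of_real (fact k / real k ^ k) * exp (of_nat k * (of_real (ln (ln 2)) + \<i> * of_real \<theta>) + \<Sigma>)"
    by (simp add: exp_add)
  also have "of_nat k * (of_real (ln (ln 2)) + \<i> * of_real \<theta>) + \<Sigma> = 
     of_real (real k) + (of_nat k * (- decay_rate \<theta>) + (ln_expm1_quot s / 2 + (\<Sigma> - of_nat k * q - ln_expm1_quot s / 2)))"
    by (simp add: decay_rate_def q_def s_def algebra_simps)
  also have "exp \<dots> = of_real (exp (real k)) * (exp (- decay_rate \<theta>) ^ k * (exp (ln_expm1_quot s / 2) * exp (\<Sigma> - of_nat k * q - ln_expm1_quot s / 2)))"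
    by (simp only: exp_add exp_of_nat_mult exp_of_real)
  also have "of_real (fact k / real k ^ k) * \<dots> = of_real (fact k * exp (real k) / real k ^ k) * 
       (exp (- decay_rate \<theta>) ^ k * exp (ln_expm1_quot s / 2)) * exp (\<Sigma> - of_nat k * q - ln_expm1_quot s / 2)"
    by simp
  also have "fact k * exp (real k) / real k ^ k = stirling_ratio k * sqrt k"
    using assms by (simp add: stirling_ratio_def)
  finally show ?thesis by (simp add: s_def \<Sigma>_def q_def)
qed

lemma norm_exp_minus_one_le:
  fixes u :: complex
  shows "norm (exp u - 1) \<le> norm u * exp (norm u)"
  using Taylor_exp_field[of u 0] by (simp add: mult.commute)

text \<open>With x = sqrt k and y = sqrt K, the distance from sqrt k to its tangent at K is exactly
  (x - y)^2/(2y), and (x - y)^2 <= (k - K)^2/K. Both bounds involve only integer powers of k, so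
  they can be summed against k^n e^(-Rk).\<close>

lemma sqrt_linearisation:
  fixes k K :: real
  assumes "k > 0" "K > 0"
  shows "\<bar>sqrt k - sqrt K / 2 * (1 + k / K)\<bar> \<le> (k - K)\<^sup>2 / K / sqrt K"
    and "1 / sqrt k \<le> (1 + K / k) / sqrt K"
proof -
  define x y where "x = sqrt k" and "y = sqrt K"
  have xy: "x > 0" "y > 0" "k = x\<^sup>2" "K = y\<^sup>2" using assms by (auto simp: x_def y_def)
  have "x - y / 2 * (1 + x\<^sup>2 / y\<^sup>2) = - ((x - y)\<^sup>2 / (2 * y))"
    using xy by (simp add: field_simps power2_eq_square)
  also have "\<bar>\<dots>\<bar> = (x - y)\<^sup>2 / (2 * y)" using xy by simp
  also have "\<dots> \<le> (x\<^sup>2 - y\<^sup>2)\<^sup>2 / y\<^sup>2 / y"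
  proof -
    have "y\<^sup>2 \<le> (x + y)\<^sup>2" using xy by (intro power_mono) auto
    hence "(x - y)\<^sup>2 * y\<^sup>2 \<le> (x - y)\<^sup>2 * (x + y)\<^sup>2" by (intro mult_left_mono) auto
    also have "\<dots> = (x\<^sup>2 - y\<^sup>2)\<^sup>2" by (simp add: power_mult_distrib[symmetric] square_diff_square_factored power2_eq_square mult_ac)
    finally have "(x - y)\<^sup>2 \<le> (x\<^sup>2 - y\<^sup>2)\<^sup>2 / y\<^sup>2" using xy by (simp add: field_simps)
    hence "(x - y)\<^sup>2 / y \<le> (x\<^sup>2 - y\<^sup>2)\<^sup>2 / y\<^sup>2 / y" using xy by (intro divide_right_mono) auto
    moreover have "(x - y)\<^sup>2 / (2 * y) \<le> (x - y)\<^sup>2 / y" using xy by (intro divide_left_mono) auto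
    ultimately show ?thesis by linarith
  qed
  finally show "\<bar>sqrt k - sqrt K / 2 * (1 + k / K)\<bar> \<le> (k - K)\<^sup>2 / K / sqrt K"
    using xy by (simp add: x_def[symmetric] y_def[symmetric])
  have "0 \<le> (x - y)\<^sup>2 + x * y" using xy by simp
  hence "x * y \<le> x\<^sup>2 + y\<^sup>2" by (simp add: power2_eq_square algebra_simps)
  hence "1 / x \<le> (1 + y\<^sup>2 / x\<^sup>2) / y" using xy by (simp add: field_simps power2_eq_square)
  thus "1 / sqrt k \<le> (1 + K / k) / sqrt K" using xy by (simp add: x_def[symmetric] y_def[symmetric])
qed

section \<open>Coefficients as integrals\<close>

text \<open>Stirling and the trapezoidal rule each have relative error O(1/k), hence absolute error
  of order sqrt k / k = 1/sqrt k, which \<open>sqrt_linearisation\<close> bounds by (1 + K/k)/sqrt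
  K. The tangent adds (k - K)^2/K^(3/2). The reference point K stays free, to be chosen in terms of
  n.\<close>

lemma expm1_prod_approx:
  "\<exists>C\<ge>0. \<forall>k\<ge>1. \<forall>K>0. \<forall>\<theta>.
     norm (expm1_prod k (circ (of_real \<theta>) / of_nat k) - 
        of_real (sqrt (2 * pi) * (sqrt K / 2 * (1 + k / K))) * 
          (exp (- decay_rate \<theta>) ^ k * exp (ln_expm1_quot (circ (of_real \<theta>)) / 2)))
     \<le> C / sqrt K * ((1 + K / k + (k - K)\<^sup>2 / K) * exp (- Re (decay_rate \<theta>)) ^ k)"
proof -
  obtain B where B: "B \<ge> 0" "\<And>s k. norm s = ln 2 \<Longrightarrow> k \<ge> 1 \<Longrightarrow>
     norm ((\<Sum>j\<in>{1..k}. ln_expm1_quot (of_nat j * s / of_nat k)) - 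
       of_nat k * (ln_expm1_primitive s / s) - ln_expm1_quot s / 2) \<le> B / real k"
    using trapezoid_sum by blast
  define D where "D = sqrt (2 * pi) * (2 * B * exp B + 1)"
  have "norm (expm1_prod k (circ (of_real \<theta>) / of_nat k) - 
        of_real (sqrt (2 * pi) * (sqrt K / 2 * (1 + k / K))) * 
          (exp (- decay_rate \<theta>) ^ k * exp (ln_expm1_quot (circ (of_real \<theta>)) / 2)))
     \<le> (3 * (2 * D)) / sqrt K * ((1 + K / k + (k - K)\<^sup>2 / K) * exp (- Re (decay_rate \<theta>)) ^ k)"
    if k: "k \<ge> 1" and K: "K > 0" for k :: nat and K \<theta> :: real
  proof -
    let ?s = "circ (of_real \<theta>)"
    define \<epsilon> where "\<epsilon> = (\<Sum>j\<in>{1..k}. ln_expm1_quot (of_nat j * ?s / of_nat k)) - 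
       of_nat k * (ln_expm1_primitive ?s / ?s) - ln_expm1_quot ?s / 2"
    define q where "q = exp (- decay_rate \<theta>) ^ k * exp (ln_expm1_quot ?s / 2)"
    define m where "m = stirling_ratio k * sqrt k"
    define d where "d = sqrt (2 * pi) * (sqrt K / 2 * (1 + k / K))"
    define X where "X = exp (- Re (decay_rate \<theta>)) ^ k"
    define P where "P = 1 + K / k + (k - K)\<^sup>2 / K"
    have X: "X \<ge> 0" by (simp add: X_def)
    have P: "P \<ge> 1 + K / k" "P \<ge> 0" "P \<ge> (k - K)\<^sup>2 / K" using K by (auto simp: P_def)
    have \<epsilon>: "norm \<epsilon> \<le> B / k" unfolding \<epsilon>_def by (rule B(2)[OF norm_circ k])
    have "B / k \<le> B / 1" using k B(1) by (intro divide_left_mono) auto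
    with \<epsilon> have \<epsilon>2: "norm \<epsilon> \<le> B" by simp
    have e1: "norm (exp \<epsilon> - 1) \<le> B / k * exp B"
      using \<epsilon> \<epsilon>2 B(1) by (intro order.trans[OF norm_exp_minus_one_le] mult_mono) auto
    have q: "norm q \<le> 3 * X"
    proof -
      have "Re (ln_expm1_quot ?s) \<le> 1"
        using norm_ln_expm1_quot_le_1[of ?s] complex_Re_le_cmod[of "ln_expm1_quot ?s"] by (simp add: norm_circ)
      hence "exp (Re (ln_expm1_quot ?s) / 2) \<le> exp 1" by simp
      also have "\<dots> \<le> (3::real)" by (rule exp_le)
      finally show ?thesis by (simp add: q_def X_def norm_mult norm_power)
    qed
    have rt: "1 / sqrt k \<le> P / sqrt K"
      using sqrt_linearisation(2)[of k K] divide_right_mono[OF P(1), of "sqrt K"] k K by simp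
    have st: "\<bar>stirling_ratio k - sqrt (2 * pi)\<bar> \<le> sqrt (2 * pi) / k" using k by (intro stirling_ratio_approx) auto
    have "sqrt (2 * pi) / k \<le> sqrt (2 * pi) / 1" using k by (intro divide_left_mono) auto
    with st have st2: "stirling_ratio k \<le> 2 * sqrt (2 * pi)" by simp
    have m: "\<bar>m\<bar> \<le> 2 * sqrt (2 * pi) * sqrt k"
      using st2 stirling_ratio_pos[of k] k by (simp add: m_def abs_mult)
    have kk: "sqrt k / k = 1 / sqrt k" using k by (simp add: field_simps)
    have md: "\<bar>m - d\<bar> \<le> sqrt (2 * pi) * (2 * (P / sqrt K))"
    proof -
      have "\<bar>m - sqrt (2 * pi) * sqrt k\<bar> = \<bar>stirling_ratio k - sqrt (2 * pi)\<bar> * sqrt k"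
        by (simp add: m_def abs_mult left_diff_distrib[symmetric])
      also have "\<dots> \<le> sqrt (2 * pi) / k * sqrt k" using st by (intro mult_right_mono) auto
      also have "\<dots> = sqrt (2 * pi) * (sqrt k / k)" by simp
      also have "\<dots> = sqrt (2 * pi) * (1 / sqrt k)" unfolding kk ..
      also have "\<dots> \<le> sqrt (2 * pi) * (P / sqrt K)" using rt by (intro mult_left_mono) auto
      finally have 1: "\<bar>m - sqrt (2 * pi) * sqrt k\<bar> \<le> sqrt (2 * pi) * (P / sqrt K)" .
      have "\<bar>sqrt (2 * pi) * sqrt k - d\<bar> = sqrt (2 * pi) * \<bar>sqrt k - sqrt K / 2 * (1 + k / K)\<bar>"
        unfolding d_def right_diff_distrib[symmetric] abs_mult by simp
      also have "\<dots> \<le> sqrt (2 * pi) * ((k - K)\<^sup>2 / K / sqrt K)"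
        using k K by (intro mult_left_mono sqrt_linearisation) auto
      also have "\<dots> \<le> sqrt (2 * pi) * (P / sqrt K)"
        using P K by (intro mult_left_mono divide_right_mono) auto
      finally have 2: "\<bar>sqrt (2 * pi) * sqrt k - d\<bar> \<le> sqrt (2 * pi) * (P / sqrt K)" .
      have "\<bar>m - d\<bar> \<le> \<bar>m - sqrt (2 * pi) * sqrt k\<bar> + \<bar>sqrt (2 * pi) * sqrt k - d\<bar>"
        using abs_triangle_ineq[of "m - sqrt (2 * pi) * sqrt k" "sqrt (2 * pi) * sqrt k - d"] by simp
      also have "\<dots> \<le> sqrt (2 * pi) * (P / sqrt K) + sqrt (2 * pi) * (P / sqrt K)" by (rule add_mono[OF 1 2])
      finally show ?thesis by (simp add: mult_ac)
    qed
    have "expm1_prod k (?s / of_nat k) = of_real m * q * exp \<epsilon>"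
      unfolding m_def q_def \<epsilon>_def by (rule expm1_prod_circ[OF k])
    hence "expm1_prod k (?s / of_nat k) - of_real d * q = of_real m * q * (exp \<epsilon> - 1) + of_real (m - d) * q"
      by (simp add: algebra_simps)
    also have "norm \<dots> \<le> norm (of_real m * q * (exp \<epsilon> - 1)) + norm (of_real (m - d) * q)" by (rule norm_triangle_ineq)
    also have "\<dots> = \<bar>m\<bar> * norm q * norm (exp \<epsilon> - 1) + \<bar>m - d\<bar> * norm q"
      unfolding norm_mult norm_of_real by simp
    also have "\<dots> \<le> (2 * sqrt (2 * pi) * sqrt k) * (3 * X) * (B / k * exp B) + (sqrt (2 * pi) * (2 * (P / sqrt K))) * (3 * X)"
      using m q e1 md X B(1) P(2) K by (intro add_mono mult_mono mult_nonneg_nonneg) (auto intro: order.trans[OF abs_ge_zero])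
    also have "\<dots> \<le> sqrt (2 * pi) * (6 * B * exp B * X) * (P / sqrt K) + (sqrt (2 * pi) * (2 * (P / sqrt K))) * (3 * X)"
    proof (rule add_right_mono)
      have "(2 * sqrt (2 * pi) * sqrt k) * (3 * X) * (B / k * exp B) = sqrt (2 * pi) * (6 * B * exp B * X) * (sqrt k / k)" by simp
      also have "\<dots> \<le> sqrt (2 * pi) * (6 * B * exp B * X) * (P / sqrt K)"
        unfolding kk using rt X B(1) by (intro mult_left_mono) auto
      finally show "(2 * sqrt (2 * pi) * sqrt k) * (3 * X) * (B / k * exp B) \<le> sqrt (2 * pi) * (6 * B * exp B * X) * (P / sqrt K)" .
    qed
    also have "sqrt (2 * pi) * (6 * B * exp B * X) * (P / sqrt K) + (sqrt (2 * pi) * (2 * (P / sqrt K))) * (3 * X) = 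
       (6 * sqrt (2 * pi) * (B * exp B + 1)) / sqrt K * (P * X)" using K by (simp add: field_simps)
    also have "\<dots> \<le> (3 * (2 * D)) / sqrt K * (P * X)"
      using B(1) P X K by (intro mult_right_mono divide_right_mono) (auto simp: D_def algebra_simps)
    finally show ?thesis unfolding P_def X_def d_def q_def .
  qed
  moreover have "3 * (2 * D) \<ge> 0" using B(1) by (simp add: D_def)
  ultimately show ?thesis by blast
qed

section \<open>Cauchy's formula for the coefficients of the products\<close>

lemma circle_integral_coeff:
  fixes f :: "complex \<Rightarrow> complex"
  assumes f: "f holomorphic_on UNIV" "f has_fps_expansion F" and \<xi>: "\<xi> > 0"
  shows "of_real (2 * pi) * fps_nth F n = integral {-pi..pi} (\<lambda>t. f (of_real \<xi> * cis t) / (of_real \<xi> * cis t) ^ n)"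
proof -
  define h where "h = (\<lambda>t. f (of_real \<xi> * cis t) / (of_real \<xi> * cis t) ^ n)"
  have cont: "continuous_on S h" for S
  proof -
    have "continuous_on S (\<lambda>t. f (of_real \<xi> * cis t))"
      by (rule continuous_on_compose2[OF holomorphic_on_imp_continuous_on[OF f(1)]]) (auto intro!: continuous_intros)
    thus ?thesis unfolding h_def using \<xi> by (intro continuous_intros) auto
  qed
  have per: "h (t + 2 * pi) = h t" for t by (simp add: h_def cis.ctr)
  have "fps_nth F n = (deriv ^^ n) f 0 / fact n" by (rule fps_nth_fps_expansion[OF f(2)])
  also have "(deriv ^^ n) f 0 = fact n / (of_real (2 * pi) * \<i>) * contour_integral (circlepath 0 \<xi>) (\<lambda>u. f u / (u - 0) ^ Suc n)"
    by (rule Cauchy_higher_derivative_integral_circlepath)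
       (use \<xi> f(1) in \<open>auto intro: holomorphic_on_subset holomorphic_on_imp_continuous_on\<close>)
  also have "contour_integral (circlepath 0 \<xi>) (\<lambda>u. f u / (u - 0) ^ Suc n) = integral {0..2 * pi} (\<lambda>t. \<i> * h t)"
    unfolding circlepath_def using \<xi>
    by (subst contour_integral_part_circlepath_eq) (auto simp: h_def field_simps intro!: integral_cong)
  also have "\<dots> = \<i> * integral {0..2 * pi} h" by simp
  \<comment> \<open>Periodicity moves the interval so that the saddle, at angle 0, is
    interior.\<close>
  also have "integral {0..2 * pi} h = integral {-pi..pi} h"
  proof -
    have "integral {0..2 * pi} h = integral {0..pi} h + integral {pi..2 * pi} h"
      by (rule Henstock_Kurzweil_Integration.integral_combine[symmetric]) (auto intro: integrable_continuous_interval cont)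
    also have "integral {pi..2 * pi} h = integral {pi - 2 * pi..2 * pi - 2 * pi} (\<lambda>t. h (t + 2 * pi))"
      by (rule integral_shift_real_ivl[symmetric])
    also have "\<dots> = integral {-pi..0} h" by (simp add: per)
    also have "integral {0..pi} h + integral {-pi..0} h = integral {-pi..pi} h"
      by (subst add.commute, rule Henstock_Kurzweil_Integration.integral_combine) (auto intro: integrable_continuous_interval cont)
    finally show ?thesis .
  qed
  finally show ?thesis by (simp add: h_def field_simps)
qed

lemma fps_nth_prod_of_real:
  "fps_nth (\<Prod>j\<in>{1..k}. fps_exp (of_nat j :: complex) - 1) n = 
     of_real (fps_nth (\<Prod>j\<in>{1..k}. fps_exp (of_nat j :: real) - 1) n)"
proof (induction k arbitrary: n)
  case (Suc k)
  have "fps_nth (fps_exp (of_nat m :: complex) - 1) i = of_real (fps_nth (fps_exp (of_nat m :: real) - 1) i)" for m i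
    by (simp add: fps_exp_def)
  moreover have "{1..Suc k} = insert (Suc k) {1..k}" by auto
  ultimately show ?case using Suc.IH by (simp add: fps_mult_nth)
qed auto

lemma expm1_prod_coeff_integral:
  assumes "k \<ge> 1"
  shows "of_real (2 * pi * fps_nth (\<Prod>j\<in>{1..k}. fps_exp (of_nat j :: real) - 1) n) = 
    integral {-pi..pi} (\<lambda>\<theta>. of_nat k ^ n * expm1_prod k (circ (of_real \<theta>) / of_nat k) / circ (of_real \<theta>) ^ n)"
proof -
  have "expm1_prod k holomorphic_on UNIV" unfolding expm1_prod_def[abs_def] by (intro holomorphic_intros)
  moreover have "expm1_prod k has_fps_expansion (\<Prod>j\<in>{1..k}. fps_exp (of_nat j) - 1)"
    unfolding expm1_prod_def[abs_def]
    by (intro has_fps_expansion_prod has_fps_expansion_diff has_fps_expansion_exp has_fps_expansion_1)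
  ultimately have "of_real (2 * pi) * fps_nth (\<Prod>j\<in>{1..k}. fps_exp (of_nat j :: complex) - 1) n =
      integral {-pi..pi} (\<lambda>t. expm1_prod k (of_real (ln 2 / real k) * cis t) / (of_real (ln 2 / real k) * cis t) ^ n)"
    using assms by (intro circle_integral_coeff) auto
  also have "(\<lambda>t. of_real (ln 2 / real k) * cis t) = (\<lambda>t. circ (of_real t) / of_nat k)"
    by (simp add: circ_of_real)
  hence eq: "of_real (ln 2 / real k) * cis t = circ (of_real t) / of_nat k" for t by meson
  hence "(\<lambda>t. expm1_prod k (of_real (ln 2 / real k) * cis t) / (of_real (ln 2 / real k) * cis t) ^ n) = 
    (\<lambda>\<theta>. of_nat k ^ n * expm1_prod k (circ (of_real \<theta>) / of_nat k) / circ (of_real \<theta>) ^ n)"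
    unfolding eq by (simp add: power_divide mult_ac)
  finally show ?thesis unfolding fps_nth_prod_of_real of_real_mult[symmetric] .
qed

lemma integral_gaussian_le:
  fixes p T :: real
  assumes "p > 0"
  shows "integral {-T..T} (\<lambda>x. exp (- p * x\<^sup>2)) \<le> sqrt (pi / p)"
proof -
  note g = has_bochner_integral_gaussian(1)[OF assms]
  have int: "integrable lborel (\<lambda>x. exp (- p * x\<^sup>2))" using g by (simp add: has_bochner_integral_iff)
  have si: "set_integrable lborel {-T..T} (\<lambda>x. exp (- p * x\<^sup>2))"
    unfolding set_integrable_def by (rule borel_integrable_compact) (auto intro!: continuous_intros)
  have "integral {-T..T} (\<lambda>x. exp (- p * x\<^sup>2)) = (LINT x:{-T..T}|lborel. exp (- p * x\<^sup>2))"
    by (rule set_borel_integral_eq_integral(2)[OF si, symmetric])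
  also have "\<dots> \<le> (LINT x|lborel. exp (- p * x\<^sup>2))"
    unfolding set_lebesgue_integral_def using si int
    by (intro Bochner_Integration.integral_mono) (auto simp: set_integrable_def indicator_def)
  also have "\<dots> = sqrt (pi / p)" using g by (simp add: has_bochner_integral_iff)
  finally show ?thesis .
qed

section \<open>Summation over the number of factors\<close>

text \<open>This is eta(log 2), the value of \<open>decay_rate\<close> at angle 0.\<close>

definition saddle_decay :: real where
  "saddle_decay = pi\<^sup>2 / (12 * ln 2)"

text \<open>The bound 4/3 lies below the Cauchy radius 3/2 of \<open>powser_sum_approx\<close>;
  their ratio 8/9 is the geometric rate of the error in \<open>power_decay_bound\<close>.\<close>

lemma saddle_decay_bounds: "1 \<le> saddle_decay" "saddle_decay \<le> 4/3" "saddle_decay > 0"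
proof -
  have "12 * ln 2 \<le> (3::real)\<^sup>2" using ln2_le_25_over_36 by simp
  also have "\<dots> \<le> pi\<^sup>2" using pi_gt3 by (intro power_mono) auto
  finally show 1: "1 \<le> saddle_decay" by (simp add: saddle_decay_def)
  have "pi\<^sup>2 \<le> (16/5)\<^sup>2" using pi_approx by (intro power_mono) auto
  also have "\<dots> \<le> 4/3 * (12 * ln (2::real))" using ln2_ge_two_thirds by (simp add: power2_eq_square)
  finally show "saddle_decay \<le> 4/3" by (simp add: saddle_decay_def divide_le_eq)
  show "saddle_decay > 0" using 1 by linarith
qed

text \<open>For d = R - mu one has R/mu >= 1 + d/2 >= exp (d/4), so the n-th powers give exponential
  decay in n d. Half of this decay pays for the factor 1 + n d^2, because n d^2 <= 2 n d.\<close>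

lemma one_plus_linear_le_exp_diff:
  fixes R \<mu> :: real
  assumes "1 \<le> \<mu>" "\<mu> \<le> 2" "\<mu> \<le> R" "R \<le> 3"
  shows "(1 + n * (R - \<mu>)\<^sup>2) / R ^ n \<le> 17 * exp (- real n * (R - \<mu>) / 8) / \<mu> ^ n"
proof -
  define d where "d = R - \<mu>"
  have d: "0 \<le> d" "d \<le> 2" using assms by (auto simp: d_def)
  have "d / 4 \<le> (d / 2) / (1 + d / 2)" using d by (simp add: field_simps mult_left_mono)
  also have "\<dots> \<le> ln (1 + d / 2)"
  proof -
    have "ln (1 / (1 + d / 2)) \<le> 1 / (1 + d / 2) - 1" using d by (intro ln_le_minus_one) auto
    moreover have "ln (1 / (1 + d / 2)) = - ln (1 + d / 2)" using d by (subst ln_div) auto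
    moreover have "1 / (1 + d / 2) - 1 = - ((d / 2) / (1 + d / 2))" using d by (simp add: field_simps)
    ultimately show ?thesis by linarith
  qed
  finally have "exp (d / 4) \<le> 1 + d / 2" using d by (subst ln_ge_iff[symmetric]) auto
  also have "d / 2 \<le> d / \<mu>" using assms d by (intro divide_left_mono) auto
  hence "1 + d / 2 \<le> R / \<mu>" using assms by (simp add: d_def field_simps)
  finally have "exp (d / 4) ^ n \<le> (R / \<mu>) ^ n" by (intro power_mono) auto
  hence e: "exp (n * d / 4) * \<mu> ^ n \<le> R ^ n"
    using assms by (simp add: exp_of_nat_mult[symmetric] power_divide field_simps)
  have "n * d\<^sup>2 \<le> n * (2 * d)" using d by (intro mult_left_mono) (auto simp: power2_eq_square intro: mult_right_mono)
  also have "\<dots> = 16 * (n * d / 8)" by simp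
  also have "\<dots> \<le> 16 * exp (n * d / 8)" using exp_ge_add_one_self[of "n * d / 8"] by linarith
  moreover have "1 \<le> exp (n * d / 8)" using d by simp
  ultimately have "1 + n * d\<^sup>2 \<le> 17 * exp (n * d / 8)" by linarith
  hence "(1 + n * d\<^sup>2) / R ^ n \<le> 17 * exp (n * d / 8) / (exp (n * d / 4) * \<mu> ^ n)"
    using e assms by (intro frac_le) auto
  also have "\<dots> = 17 * (exp (n * d / 8) / exp (n * d / 4)) / \<mu> ^ n" by simp
  also have "exp (n * d / 8) / exp (n * d / 4) = exp (- real n * d / 8)"
    by (simp add: exp_diff[symmetric] field_simps)
  finally show ?thesis by (simp add: d_def)
qed

lemma real_powser_sums:
  fixes x :: real
  assumes "0 \<le> x" "x < 1"
  shows "(\<lambda>k. real k ^ m * x ^ k) sums Re (powser_sum m (of_real x))"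
proof -
  have "norm (complex_of_real x) < 1" using assms by simp
  from summable_sums[OF summable_powser_sum[OF this, of m]]
  have "(\<lambda>k. complex_of_real (real k ^ m * x ^ k)) sums powser_sum m (of_real x)" by (simp add: powser_sum_def)
  from sums_Re[OF this] show ?thesis unfolding Re_complex_of_real .
qed

text \<open>A second-moment estimate for k under the weights k^n e^(-Rk), centred at K =
  n/\<open>saddle_decay\<close>. The power sums behave like m!/R^(m+1); their leading parts cancel,
  leaving a variance of order n and the square of the displacement between n/R and K. The
  displacement appears as n (R - \<open>saddle_decay\<close>)^2, which vanishes at the
  saddle.\<close>

lemma quadratic_weighted_sum_le:
  "\<exists>C\<ge>0. \<forall>n\<ge>2. \<forall>R. saddle_decay \<le> R \<longrightarrow> R \<le> 3 \<longrightarrow> (\<forall>N.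
     (\<Sum>k\<in>{1..N}. real k ^ n * ((1 + (n / saddle_decay) / k + (k - n / saddle_decay)\<^sup>2 / (n / saddle_decay)) * exp (- R) ^ k))
      \<le> C * (fact n * ((1 + n * (R - saddle_decay)\<^sup>2) / R ^ n) + n * (fact n / (3/2) ^ n)))"
proof -
  obtain C where C: "C \<ge> 0" "\<And>z m. 0 < Re z \<Longrightarrow> Re z \<le> 3 \<Longrightarrow> \<bar>Im z\<bar> \<le> pi + 1 \<Longrightarrow>
     norm (powser_sum m (exp (- z)) - fact m / z ^ Suc m) \<le> C * (fact m / (3/2) ^ m)"
    using powser_sum_approx by blast
  have "(\<Sum>k\<in>{1..N}. real k ^ n * ((1 + K / k + (k - K)\<^sup>2 / K) * exp (- R) ^ k)) \<le> 
     (9 + 20 * C) * (fact n * ((1 + n * (R - \<mu>)\<^sup>2) / R ^ n) + n * (fact n / (3/2) ^ n))"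
    if n: "n \<ge> 2" and R: "\<mu> \<le> R" "R \<le> 3" and \<mu>: "\<mu> = saddle_decay" and K: "K = n / \<mu>" for n N R \<mu> K
  proof -
    have mu: "1 \<le> \<mu>" "\<mu> \<le> 2" using saddle_decay_bounds by (auto simp: \<mu>)
    have R1: "R \<ge> 1" "R > 0" using mu R by auto
    have Kpos: "K > 0" "K \<le> n" "1 / K \<le> 2 / n" using mu n by (auto simp: K field_simps)
    define x where "x = exp (- R)"
    have x: "0 \<le> x" "x < 1" using R1 by (auto simp: x_def)
    define S where "S = (\<lambda>m. Re (powser_sum m (of_real x)))"
    have S: "(\<lambda>k. real k ^ m * x ^ k) sums S m" for m unfolding S_def by (rule real_powser_sums[OF x])
    define p where "p = (\<lambda>m. fact m / R ^ Suc m)"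
    define e where "e = (\<lambda>m. C * (fact m / (3/2) ^ m))"
    have Sp: "\<bar>S m - p m\<bar> \<le> e m" for m
    proof -
      have "norm (powser_sum m (exp (- complex_of_real R)) - fact m / complex_of_real R ^ Suc m) \<le> e m"
        unfolding e_def using R R1 by (intro C) auto
      hence *: "norm (powser_sum m (of_real x) - of_real (p m)) \<le> e m"
        by (simp add: x_def p_def exp_of_real[symmetric])
      have "\<bar>Re (powser_sum m (of_real x) - of_real (p m))\<bar> \<le> e m"
        using order.trans[OF abs_Re_le_cmod *] .
      thus ?thesis by (simp add: S_def)
    qed
    \<comment> \<open>Expanding the square gives power sums with exponents from n - 1 to n + 2. At k
      = 0 all terms vanish because n - 1 >= 1, while the factored form divides by k and is used only
      for k >= 1.\<close>
    define f where "f = (\<lambda>k. real k ^ n * x ^ k + K * (real k ^ (n - 1) * x ^ k) + 1 / K * (real k ^ (n + 2) * x ^ k)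
        - 2 * (real k ^ (n + 1) * x ^ k) + K * (real k ^ n * x ^ k))"
    have f: "f sums (S n + K * S (n - 1) + 1 / K * S (n + 2) - 2 * S (n + 1) + K * S n)"
      unfolding f_def by (intro sums_add sums_diff sums_mult S)
    have f_eq: "f k = real k ^ n * ((1 + K / k + (k - K)\<^sup>2 / K) * x ^ k)" if "k \<ge> 1" for k
    proof -
      define u where "u = real k ^ (n - 1)"
      have a1: "real k ^ n = real k * u" unfolding u_def using n by (cases n) auto
      have a2: "real k ^ (n + 2) = real k * u * (real k)\<^sup>2" "real k ^ (n + 1) = real k * u * real k"
        by (simp_all only: power_add a1 power_one_right)
      have "t * u * y + K * (u * y) + 1 / K * (t * u * t\<^sup>2 * y) - 2 * (t * u * t * y) + K * (t * u * y) =
          t * u * ((1 + K / t + (t - K)\<^sup>2 / K) * y)" if "t > 0" for t u y :: real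
      proof -
        have eq: "(t - K)\<^sup>2 / K = t\<^sup>2 / K - 2 * t + K" using Kpos(1) by (simp add: field_simps power2_eq_square)
        have "t * u * ((1 + K / t + (t - K)\<^sup>2 / K) * y) = u * y * (t + t * (K / t) + t * ((t - K)\<^sup>2 / K))"
          by (simp add: algebra_simps)
        also have "\<dots> = u * y * (t + K + t * (t\<^sup>2 / K - 2 * t + K))" unfolding eq using that by simp
        also have "\<dots> = t * u * y + K * (u * y) + 1 / K * (t * u * t\<^sup>2 * y) - 2 * (t * u * t * y) + K * (t * u * y)"
          by (simp add: algebra_simps)
        finally show ?thesis by simp
      qed
      from this[of "real k" u "x ^ k"] show ?thesis
        using that unfolding f_def a1 a2 u_def[symmetric] by simp
    qed
    have f0: "f k \<ge> 0" for k
    proof (cases "k = 0")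
      case False
      thus ?thesis using Kpos x by (subst f_eq) (auto intro!: mult_nonneg_nonneg add_nonneg_nonneg)
    qed (use n Kpos in \<open>simp add: f_def power_0_left\<close>)
    have "(\<Sum>k\<in>{1..N}. real k ^ n * ((1 + K / k + (k - K)\<^sup>2 / K) * x ^ k)) = (\<Sum>k\<in>{1..N}. f k)"
      by (intro sum.cong refl) (simp add: f_eq)
    also have "\<dots> \<le> suminf f" using f f0 by (intro sum_le_suminf) (auto simp: sums_iff)
    also have "\<dots> = S n + K * S (n - 1) + 1 / K * S (n + 2) - 2 * S (n + 1) + K * S n" using f by (simp add: sums_iff)
    also have "\<dots> \<le> (p n + e n) + K * (p (n - 1) + e (n - 1)) + 1 / K * (p (n + 2) + e (n + 2)) - 2 * (p (n + 1) - e (n + 1)) + K * (p n + e n)"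
    proof -
      have up: "S m \<le> p m + e m" and lo: "p m - e m \<le> S m" for m using Sp[of m] by linarith+
      show ?thesis using Kpos by (intro add_mono diff_mono mult_left_mono up lo) auto
    qed
    also have "\<dots> = (p n + K * p (n - 1) + 1 / K * p (n + 2) - 2 * p (n + 1) + K * p n) + 
        (e n + K * e (n - 1) + 1 / K * e (n + 2) + 2 * e (n + 1) + K * e n)" by (simp add: algebra_simps)
    also have "p n + K * p (n - 1) + 1 / K * p (n + 2) - 2 * p (n + 1) + K * p n \<le> 9 * (fact n * ((1 + n * (R - \<mu>)\<^sup>2) / R ^ n))"
    proof -
      define F where "F = fact n / R ^ Suc n"
      have F: "F \<ge> 0" using R1 by (simp add: F_def)
      obtain m where m: "n = Suc m" using n by (cases n) auto
      have "p n = F" "K * p (n - 1) = F * (R / \<mu>)" "1 / K * p (n + 2) = F * ((n + 1) * (n + 2) * \<mu> / (n * R\<^sup>2))"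
        "2 * p (n + 1) = F * (2 * (n + 1) / R)" "K * p n = F * (n / \<mu>)"
        using R1 mu n by (simp_all add: p_def F_def K m field_simps power2_eq_square)
      hence "p n + K * p (n - 1) + 1 / K * p (n + 2) - 2 * p (n + 1) + K * p n = 
         F * (1 + R / \<mu> + (n + 1) * (n + 2) * \<mu> / (n * R\<^sup>2) - 2 * (n + 1) / R + n / \<mu>)"
        by (simp add: algebra_simps)
      \<comment> \<open>The terms linear in n combine to a square: n mu/R^2 - 2n/R + n/mu = n (R -
        mu)^2/(mu R^2).\<close>
      also have "1 + R / \<mu> + (n + 1) * (n + 2) * \<mu> / (n * R\<^sup>2) - 2 * (n + 1) / R + n / \<mu> = 
         1 + R / \<mu> + n * (R - \<mu>)\<^sup>2 / (\<mu> * R\<^sup>2) + (3 + 2 / n) * (\<mu> / R\<^sup>2) - 2 / R"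
        using R1 mu n by (simp add: field_simps power2_eq_square)
      also have "\<dots> \<le> 1 + 3 + n * (R - \<mu>)\<^sup>2 + 5 * 1 - 0"
      proof (intro add_mono diff_mono order.refl)
        have "R / \<mu> \<le> 3 / 1" using R R1 mu by (intro frac_le) auto
        thus "R / \<mu> \<le> 3" by simp
        have R2: "R\<^sup>2 \<ge> R" using R1 by (simp add: power2_eq_square)
        have "\<mu> * R\<^sup>2 \<ge> 1 * 1" using R1 R2 mu by (intro mult_mono) auto
        hence "n * (R - \<mu>)\<^sup>2 / (\<mu> * R\<^sup>2) \<le> n * (R - \<mu>)\<^sup>2 / 1" by (intro divide_left_mono) auto
        thus "n * (R - \<mu>)\<^sup>2 / (\<mu> * R\<^sup>2) \<le> n * (R - \<mu>)\<^sup>2" by simp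
        have "\<mu> / R\<^sup>2 \<le> 1" using R2 R R1 by (simp add: field_simps)
        moreover have "3 + 2 / real n \<le> 5" using n by (simp add: field_simps)
        ultimately show "(3 + 2 / n) * (\<mu> / R\<^sup>2) \<le> 5 * 1" using mu R1 by (intro mult_mono) auto
        show "0 \<le> 2 / R" using R1 by simp
      qed
      also have "\<dots> \<le> 9 * (1 + n * (R - \<mu>)\<^sup>2)" by simp
      finally have "p n + K * p (n - 1) + 1 / K * p (n + 2) - 2 * p (n + 1) + K * p n \<le> F * (9 * (1 + n * (R - \<mu>)\<^sup>2))"
        using F by (simp add: mult_left_mono)
      also have "\<dots> \<le> (fact n / R ^ n) * (9 * (1 + n * (R - \<mu>)\<^sup>2))"
      proof (intro mult_right_mono)
        have "R ^ n \<le> R ^ Suc n" using R1 by (intro power_increasing) auto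
        thus "F \<le> fact n / R ^ n" unfolding F_def using R1 by (intro divide_left_mono) auto
      qed auto
      also have "(fact n / R ^ n) * (9 * (1 + n * (R - \<mu>)\<^sup>2)) = 9 * (fact n * ((1 + n * (R - \<mu>)\<^sup>2) / R ^ n))"
      proof -
        have "(a / b) * (9 * q) = 9 * (a * (q / b))" for a b q :: real by simp
        thus ?thesis .
      qed
      finally show ?thesis .
    qed
    also have "e n + K * e (n - 1) + 1 / K * e (n + 2) + 2 * e (n + 1) + K * e n \<le> 20 * C * (n * (fact n / (3/2) ^ n))"
    proof -
      define g where "g = C * (fact n / (3/2) ^ n)"
      have g: "g \<ge> 0" using C by (simp add: g_def)
      obtain m where m: "n = Suc m" using n by (cases n) auto
      have nr: "real n \<ge> 2" using n by simp
      have e1: "e n = g" by (simp add: e_def g_def)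
      have e2: "n * e (n - 1) = 3/2 * g" by (simp add: e_def g_def m field_simps)
      have e3: "e (n + 1) = 2/3 * (n + 1) * g" by (simp add: e_def g_def field_simps)
      have e4: "e (n + 2) = 4/9 * (n + 1) * (n + 2) * g" by (simp add: e_def g_def field_simps power2_eq_square)
      define H where "H = real n * g"
      have f1: "K * e (n - 1) \<le> 3/2 * g"
      proof -
        have "K * e (n - 1) \<le> n * e (n - 1)" using Kpos C by (intro mult_right_mono) (auto simp: e_def)
        thus ?thesis unfolding e2 .
      qed
      have f2: "1 / K * e (n + 2) \<le> 6 * H"
      proof -
        have "2 / n * (4/9 * (n + 1) * (n + 2)) = 8/9 * (real n + 3 + 2 / real n)" using nr by (simp add: field_simps)
        also have "\<dots> \<le> 6 * real n" 
        proof -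
          define t where "t = 2 / real n"
          have "t \<le> 1" using nr by (simp add: t_def)
          hence "8/9 * (real n + 3 + t) \<le> 6 * real n" using nr by (simp add: field_simps)
          thus ?thesis unfolding t_def .
        qed
        finally have "2 / n * (4/9 * (n + 1) * (n + 2)) \<le> 6 * real n" .
        from mult_right_mono[OF this g] have "2 / n * e (n + 2) \<le> 6 * H"
          unfolding e4 H_def by (simp only: mult.assoc)
        moreover have "1 / K * e (n + 2) \<le> 2 / n * e (n + 2)" using Kpos C by (intro mult_right_mono) (auto simp: e_def)
        ultimately show ?thesis by linarith
      qed
      have f3: "K * e n \<le> H" using Kpos g by (simp add: e1 H_def mult_right_mono)
      have f4: "2 * e (n + 1) \<le> 2 * H"
      proof -
        have "2 * (2/3 * (n + 1)) \<le> 2 * real n" using nr by simp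
        from mult_right_mono[OF this g] show ?thesis unfolding e3 H_def by (simp only: mult.assoc)
      qed
      have f5: "g \<le> H" unfolding H_def using nr g mult_right_mono[of 1 "real n" g] by simp
      have "e n + K * e (n - 1) + 1 / K * e (n + 2) + 2 * e (n + 1) + K * e n \<le> g + 3/2 * g + 6 * H + 2 * H + H"
        by (intro add_mono f1 f2 f3 f4) (simp add: e1)
      also have "\<dots> \<le> 20 * (n * g)" using f5 g unfolding H_def[symmetric] by simp
      finally have "e n + K * e (n - 1) + 1 / K * e (n + 2) + 2 * e (n + 1) + K * e n \<le> 20 * (n * g)" .
      thus ?thesis by (simp add: g_def mult_ac)
    qed
    also have "9 * (fact n * ((1 + n * (R - \<mu>)\<^sup>2) / R ^ n)) + 20 * C * (n * (fact n / (3/2) ^ n)) \<le>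
       (9 + 20 * C) * (fact n * ((1 + n * (R - \<mu>)\<^sup>2) / R ^ n) + n * (fact n / (3/2) ^ n))"
    proof -
      have "0 \<le> fact n * ((1 + n * (R - \<mu>)\<^sup>2) / R ^ n)" "0 \<le> n * (fact n / (3/2) ^ n :: real)" using R1 by auto
      moreover have "9 * u + 20 * C * v \<le> (9 + 20 * C) * (u + v)" if "0 \<le> u" "0 \<le> v" for u v
        using that C(1) by (simp add: algebra_simps)
      ultimately show ?thesis by blast
    qed
    finally show ?thesis by (simp add: x_def)
  qed
  thus ?thesis using C(1) by (intro exI[of _ "9 + 20 * C"]) auto
qed

text \<open>The coefficient is a finite sum over k whose length may be any large N. Integrating its
  approximation requires one N for all angles, hence a tail bound uniform in |x| <= y.\<close>

lemma powser_sum_tail_uniform: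
  fixes \<delta> :: real
  assumes "0 \<le> y" "y < 1" "\<delta> > 0"
  shows "\<exists>N0. \<forall>N\<ge>N0. \<forall>x. norm x \<le> y \<longrightarrow> norm (powser_sum m x - (\<Sum>k\<le>N. of_nat k ^ m * x ^ k)) \<le> \<delta>"
proof -
  have sy: "summable (\<lambda>k. real k ^ m * y ^ k)" using real_powser_sums[OF assms(1,2)] by (simp add: sums_iff)
  then obtain N0 where N0: "\<And>N. N \<ge> N0 \<Longrightarrow> norm (\<Sum>k. real (k + N) ^ m * y ^ (k + N)) < \<delta>"
    using suminf_exist_split[OF assms(3) sy] by blast
  have "norm (powser_sum m x - (\<Sum>k\<le>N. of_nat k ^ m * x ^ k)) \<le> \<delta>" if N: "N \<ge> N0" and x: "norm x \<le> y" for N x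
  proof -
    have "summable (\<lambda>k. of_nat k ^ m * x ^ k)" using x assms by (intro summable_powser_sum) auto
    hence "powser_sum m x - (\<Sum>k\<le>N. of_nat k ^ m * x ^ k) = (\<Sum>k. of_nat (k + Suc N) ^ m * x ^ (k + Suc N))"
      unfolding powser_sum_def lessThan_Suc_atMost[symmetric] by (rule suminf_minus_initial_segment[symmetric])
    also have "norm \<dots> \<le> (\<Sum>k. real (k + Suc N) ^ m * y ^ (k + Suc N))"
    proof (rule norm_suminf_le)
      fix k show "norm (of_nat (k + Suc N) ^ m * x ^ (k + Suc N)) \<le> real (k + Suc N) ^ m * y ^ (k + Suc N)"
        unfolding norm_mult norm_power norm_of_nat using x by (intro mult_left_mono power_mono) auto
      show "summable (\<lambda>k. real (k + Suc N) ^ m * y ^ (k + Suc N))" using sy by (rule summable_ignore_initial_segment)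
    qed
    also have "\<dots> \<le> \<delta>" using N0[of "Suc N"] N by (simp del: of_nat_Suc of_nat_add add_Suc_right)
    finally show ?thesis .
  qed
  thus ?thesis by blast
qed

text \<open>The weight 1 + k/K is affine, so only the power sums of exponents n and n + 1 occur,
  each replaced by its factorial term. On the circle |e^(-eta)| <= e^(-\<open>saddle_decay\<close>),
  which makes the truncation uniform in the angle.\<close>

lemma powser_sum_linear_weight:
  "\<exists>C\<ge>0. \<forall>n\<ge>2. \<exists>N0. \<forall>N\<ge>N0. \<forall>\<theta>. \<bar>\<theta>\<bar> \<le> pi \<longrightarrow>
     norm ((\<Sum>k\<in>{1..N}. of_nat k ^ n * (of_real (1 + real k / (n / saddle_decay)) * exp (- decay_rate \<theta>) ^ k)) -
       (fact n / decay_rate \<theta> ^ Suc n + of_real (saddle_decay / n) * (fact (Suc n) / decay_rate \<theta> ^ Suc (Suc n))))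
     \<le> C * (n * (fact n / (3/2) ^ n))"
proof -
  obtain C where C: "C \<ge> 0" "\<And>z m. 0 < Re z \<Longrightarrow> Re z \<le> 3 \<Longrightarrow> \<bar>Im z\<bar> \<le> pi + 1 \<Longrightarrow>
     norm (powser_sum m (exp (- z)) - fact m / z ^ Suc m) \<le> C * (fact m / (3/2) ^ m)"
    using powser_sum_approx by blast
  show ?thesis
  proof (intro exI[of _ "4 * (C + 1)"] conjI allI impI)
    show "0 \<le> 4 * (C + 1)" using C by simp
    fix n :: nat assume n: "n \<ge> 2"
    define y where "y = exp (- saddle_decay)"
    have y: "0 \<le> y" "y < 1" using saddle_decay_bounds by (auto simp: y_def)
    \<comment> \<open>The truncation tolerance is chosen of the same order as the error of
      \<open>powser_sum_approx\<close>.\<close>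
    define g where "g = fact n / (3/2 :: real) ^ n"
    have g: "g > 0" by (simp add: g_def)
    have "\<exists>N0. \<forall>N\<ge>N0. \<forall>x. norm x \<le> y \<longrightarrow> norm (powser_sum m x - (\<Sum>k\<le>N. of_nat k ^ m * x ^ k)) \<le> g" for m
      by (rule powser_sum_tail_uniform[OF y g])
    then obtain N0 where N0: "\<And>m N x. N \<ge> N0 m \<Longrightarrow> norm x \<le> y \<Longrightarrow> norm (powser_sum m x - (\<Sum>k\<le>N. of_nat k ^ m * x ^ k)) \<le> g"
      by metis
    show "\<exists>N0. \<forall>N\<ge>N0. \<forall>\<theta>. \<bar>\<theta>\<bar> \<le> pi \<longrightarrow>
     norm ((\<Sum>k\<in>{1..N}. of_nat k ^ n * (of_real (1 + real k / (n / saddle_decay)) * exp (- decay_rate \<theta>) ^ k)) -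
       (fact n / decay_rate \<theta> ^ Suc n + of_real (saddle_decay / n) * (fact (Suc n) / decay_rate \<theta> ^ Suc (Suc n))))
     \<le> 4 * (C + 1) * (n * (fact n / (3/2) ^ n))"
    proof (intro exI[of _ "max (N0 n) (N0 (Suc n))"] allI impI)
      fix N \<theta> assume N: "max (N0 n) (N0 (Suc n)) \<le> N" and th: "\<bar>\<theta>\<bar> \<le> pi"
      define x where "x = exp (- decay_rate \<theta>)"
      have R: "saddle_decay \<le> Re (decay_rate \<theta>)"
        using Re_decay_rate_ge[OF th] by (simp add: saddle_decay_def) (smt (verit) divide_nonneg_nonneg ln_ge_zero mult_nonneg_nonneg zero_le_power2)
      hence nx: "norm x \<le> y" by (simp add: x_def y_def)
      have T: "norm ((\<Sum>k\<in>{1..N}. of_nat k ^ m * x ^ k) - fact m / decay_rate \<theta> ^ Suc m) \<le> g + C * (fact m / (3/2) ^ m)"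
        if m: "m \<ge> 1" "N \<ge> N0 m" for m
      proof -
        have "(\<Sum>k\<le>N. of_nat k ^ m * x ^ k) = (\<Sum>k\<in>{1..N}. of_nat k ^ m * x ^ k)"
          using m by (intro sum.mono_neutral_right) auto
        hence 1: "norm ((\<Sum>k\<in>{1..N}. of_nat k ^ m * x ^ k) - powser_sum m x) \<le> g"
          using N0[OF m(2) nx] by (simp add: norm_minus_commute)
        have 2: "norm (powser_sum m x - fact m / decay_rate \<theta> ^ Suc m) \<le> C * (fact m / (3/2) ^ m)"
          unfolding x_def using R saddle_decay_bounds decay_rate_bounds[of \<theta>] th by (intro C) auto
        show ?thesis using norm_triangle_le[OF add_mono[OF 1 2]] by simp
      qed
      have sp: "(\<Sum>k\<in>{1..N}. of_nat k ^ n * (of_real (1 + real k / (n / saddle_decay)) * x ^ k)) =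
          (\<Sum>k\<in>{1..N}. of_nat k ^ n * x ^ k) + of_real (saddle_decay / n) * (\<Sum>k\<in>{1..N}. of_nat k ^ Suc n * x ^ k)"
        unfolding sum_distrib_left sum.distrib[symmetric] by (intro sum.cong refl) (simp add: algebra_simps)
      have nr: "real n \<ge> 2" using n by simp
      have "norm ((\<Sum>k\<in>{1..N}. of_nat k ^ n * (of_real (1 + real k / (n / saddle_decay)) * x ^ k)) -
         (fact n / decay_rate \<theta> ^ Suc n + of_real (saddle_decay / n) * (fact (Suc n) / decay_rate \<theta> ^ Suc (Suc n)))) =
        norm (((\<Sum>k\<in>{1..N}. of_nat k ^ n * x ^ k) - fact n / decay_rate \<theta> ^ Suc n) + 
         of_real (saddle_decay / n) * ((\<Sum>k\<in>{1..N}. of_nat k ^ Suc n * x ^ k) - fact (Suc n) / decay_rate \<theta> ^ Suc (Suc n)))"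
        unfolding sp by (simp only: right_diff_distrib) (simp only: algebra_simps)
      also have "\<dots> \<le> (g + C * (fact n / (3/2) ^ n)) + 1 * (g + C * (fact (Suc n) / (3/2) ^ Suc n))"
      proof (intro norm_triangle_le add_mono)
        show "norm ((\<Sum>k\<in>{1..N}. of_nat k ^ n * x ^ k) - fact n / decay_rate \<theta> ^ Suc n) \<le> g + C * (fact n / (3/2) ^ n)"
          using n N by (intro T) auto
        have "saddle_decay / n \<le> 1" "saddle_decay / n \<ge> 0" using saddle_decay_bounds nr by (auto simp: field_simps)
        moreover have "norm ((\<Sum>k\<in>{1..N}. of_nat k ^ Suc n * x ^ k) - fact (Suc n) / decay_rate \<theta> ^ Suc (Suc n)) \<le> g + C * (fact (Suc n) / (3/2) ^ Suc n)"
          using n N by (intro T) auto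
        ultimately show "norm (of_real (saddle_decay / n) * ((\<Sum>k\<in>{1..N}. of_nat k ^ Suc n * x ^ k) - fact (Suc n) / decay_rate \<theta> ^ Suc (Suc n)))
          \<le> 1 * (g + C * (fact (Suc n) / (3/2) ^ Suc n))"
          unfolding norm_mult norm_of_real by (intro mult_mono) auto
      qed
      also have "fact (Suc n) / (3/2) ^ Suc n = 2/3 * (real n + 1) * g" by (simp add: g_def field_simps)
      also have "(g + C * (fact n / (3/2) ^ n)) + 1 * (g + C * (2/3 * (real n + 1) * g)) = 
          (2 + C + C * (2/3 * (real n + 1))) * g" by (simp add: g_def[symmetric] algebra_simps)
      also have "\<dots> \<le> (4 * (C + 1) * n) * g"
      proof (intro mult_right_mono)
        define H where "H = C * real n"
        have "C * 1 \<le> H" "C * (2/3 * (real n + 1)) \<le> C * (2 * real n)" unfolding H_def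
          using C nr by (intro mult_left_mono; simp)+
        moreover have "C * (2 * real n) = 2 * H" by (simp add: H_def)
        moreover have "H \<ge> 0" using C by (simp add: H_def)
        ultimately have "2 + C + C * (2/3 * (real n + 1)) \<le> 4 * H + 4 * real n" using nr by linarith
        also have "\<dots> = 4 * (C + 1) * n" by (simp add: H_def algebra_simps)
        finally show "2 + C + C * (2/3 * (real n + 1)) \<le> 4 * (C + 1) * n" .
      qed (use g in auto)
      finally show "norm ((\<Sum>k\<in>{1..N}. of_nat k ^ n * (of_real (1 + real k / (n / saddle_decay)) * exp (- decay_rate \<theta>) ^ k)) -
         (fact n / decay_rate \<theta> ^ Suc n + of_real (saddle_decay / n) * (fact (Suc n) / decay_rate \<theta> ^ Suc (Suc n)))) \<le> 
         4 * (C + 1) * (n * (fact n / (3/2) ^ n))"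
        unfolding x_def g_def by (simp add: mult_ac)
    qed
  qed
qed

text \<open>Two replacements: \<open>U\<close> by \<open>q * V\<close>, putting the affine weight in
  place of sqrt k, and \<open>V\<close> by \<open>Z\<close>, putting factorial terms in place of
  power sums. As \<open>saddle_phase\<close> is s times eta, \<open>q * Z / s ^ n\<close> is exactly
  the stated combination of the two weights. The error has a Gaussian part carrying 1/sqrt n and a
  part that is geometrically smaller.\<close>

lemma saddle_integrand_approx:
  "\<exists>C\<ge>0. \<forall>n\<ge>2. \<exists>N0. \<forall>N\<ge>N0. \<forall>\<theta>. \<bar>\<theta>\<bar> \<le> pi \<longrightarrow>
     norm ((\<Sum>k\<in>{1..N}. of_nat k ^ n * expm1_prod k (circ (of_real \<theta>) / of_nat k) / circ (of_real \<theta>) ^ n) -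
       of_real (sqrt (2 * pi) * sqrt (n / saddle_decay) / 2 * fact n) *
         (saddle_weight 0 \<theta> / saddle_phase \<theta> ^ n + of_real (saddle_decay * (real n + 1) / real n) * (saddle_weight 1 \<theta> / saddle_phase \<theta> ^ n)))
     \<le> C * (fact n / ln 2 ^ n) * (1 / sqrt n * exp (- (n / 5000) * \<theta>\<^sup>2) / saddle_decay ^ n + (real n)\<^sup>2 / (3/2) ^ n)"
proof -
  obtain C1 where C1: "C1 \<ge> 0" "\<And>k K \<theta>. k \<ge> 1 \<Longrightarrow> K > 0 \<Longrightarrow>
     norm (expm1_prod k (circ (of_real \<theta>) / of_nat k) - 
        of_real (sqrt (2 * pi) * (sqrt K / 2 * (1 + k / K))) * 
          (exp (- decay_rate \<theta>) ^ k * exp (ln_expm1_quot (circ (of_real \<theta>)) / 2)))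
     \<le> C1 / sqrt K * ((1 + K / k + (k - K)\<^sup>2 / K) * exp (- Re (decay_rate \<theta>)) ^ k)"
    using expm1_prod_approx by blast
  obtain C2 where C2: "C2 \<ge> 0" "\<And>n R N. n \<ge> 2 \<Longrightarrow> saddle_decay \<le> R \<Longrightarrow> R \<le> 3 \<Longrightarrow>
     (\<Sum>k\<in>{1..N}. real k ^ n * ((1 + (n / saddle_decay) / k + (k - n / saddle_decay)\<^sup>2 / (n / saddle_decay)) * exp (- R) ^ k))
      \<le> C2 * (fact n * ((1 + n * (R - saddle_decay)\<^sup>2) / R ^ n) + n * (fact n / (3/2) ^ n))"
    using quadratic_weighted_sum_le by blast
  obtain C3 where C3: "C3 \<ge> 0" "\<And>n. n \<ge> 2 \<Longrightarrow> \<exists>N0. \<forall>N\<ge>N0. \<forall>\<theta>. \<bar>\<theta>\<bar> \<le> pi \<longrightarrow>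
     norm ((\<Sum>k\<in>{1..N}. of_nat k ^ n * (of_real (1 + real k / (n / saddle_decay)) * exp (- decay_rate \<theta>) ^ k)) -
       (fact n / decay_rate \<theta> ^ Suc n + of_real (saddle_decay / n) * (fact (Suc n) / decay_rate \<theta> ^ Suc (Suc n))))
     \<le> C3 * (n * (fact n / (3/2) ^ n))"
    using powser_sum_linear_weight by blast
  define C where "C = 34 * C1 * C2 + 2 * C1 * C2 + 6 * C3"
  have C0: "C \<ge> 0" using C1 C2 C3 by (simp add: C_def)
  show ?thesis
  proof (intro exI[of _ C] conjI C0 allI impI)
    fix n :: nat assume n: "n \<ge> 2"
    define K where "K = real n / saddle_decay"
    have nr: "real n \<ge> 2" using n by simp
    have sd: "saddle_decay \<ge> 1" "saddle_decay > 0" "saddle_decay \<le> 2" using saddle_decay_bounds by auto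
    have K: "K > 0" "K \<le> n" using sd nr by (auto simp: K_def field_simps)
    have rK: "1 / sqrt K \<le> 2 / sqrt n"
    proof -
      have "sqrt saddle_decay \<le> sqrt (2\<^sup>2)" using sd by (intro real_sqrt_le_mono) auto
      hence "sqrt saddle_decay \<le> 2" by simp
      hence "sqrt saddle_decay / sqrt n \<le> 2 / sqrt n" by (intro divide_right_mono) auto
      thus ?thesis by (simp add: K_def real_sqrt_divide)
    qed
    from C3(2)[OF n] obtain N0 where N0: "\<And>N \<theta>. N \<ge> N0 \<Longrightarrow> \<bar>\<theta>\<bar> \<le> pi \<Longrightarrow>
     norm ((\<Sum>k\<in>{1..N}. of_nat k ^ n * (of_real (1 + real k / K) * exp (- decay_rate \<theta>) ^ k)) -
       (fact n / decay_rate \<theta> ^ Suc n + of_real (saddle_decay / n) * (fact (Suc n) / decay_rate \<theta> ^ Suc (Suc n))))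
     \<le> C3 * (n * (fact n / (3/2) ^ n))" unfolding K_def by blast
    show "\<exists>N0. \<forall>N\<ge>N0. \<forall>\<theta>. \<bar>\<theta>\<bar> \<le> pi \<longrightarrow>
     norm ((\<Sum>k\<in>{1..N}. of_nat k ^ n * expm1_prod k (circ (of_real \<theta>) / of_nat k) / circ (of_real \<theta>) ^ n) -
       of_real (sqrt (2 * pi) * sqrt (n / saddle_decay) / 2 * fact n) *
         (saddle_weight 0 \<theta> / saddle_phase \<theta> ^ n + of_real (saddle_decay * (real n + 1) / real n) * (saddle_weight 1 \<theta> / saddle_phase \<theta> ^ n)))
     \<le> C * (fact n / ln 2 ^ n) * (1 / sqrt n * exp (- (n / 5000) * \<theta>\<^sup>2) / saddle_decay ^ n + (real n)\<^sup>2 / (3/2) ^ n)"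
    proof (intro exI[of _ N0] allI impI)
      fix N \<theta> assume N: "N \<ge> N0" and th: "\<bar>\<theta>\<bar> \<le> pi"
      define s \<eta> W R where "s = circ (of_real \<theta>)" and "\<eta> = decay_rate \<theta>" and "W = exp (ln_expm1_quot s / 2)" and "R = Re \<eta>"
      have s: "s \<noteq> 0" "norm s = ln 2" by (auto simp: s_def circ_nonzero norm_circ)
      have R: "saddle_decay + ln 2 * \<theta>\<^sup>2 / 384 \<le> R" "R \<le> 3"
        using Re_decay_rate_ge[OF th] decay_rate_bounds(2)[of \<theta>] by (auto simp: R_def \<eta>_def saddle_decay_def)
      have l0: "0 \<le> ln 2 * \<theta>\<^sup>2 / 384" by simp
      have R': "saddle_decay \<le> R" using R(1) l0 by linarith
      have \<eta>0: "\<eta> \<noteq> 0" using R' sd by (auto simp: R_def)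
      have W: "norm W \<le> 3"
      proof -
        have "Re (ln_expm1_quot s) \<le> 1"
          using norm_ln_expm1_quot_le_1[of s] complex_Re_le_cmod[of "ln_expm1_quot s"] by (simp add: s)
        hence "exp (Re (ln_expm1_quot s) / 2) \<le> exp 1" by simp
        also have "\<dots> \<le> (3::real)" by (rule exp_le)
        finally show ?thesis by (simp add: W_def)
      qed
      define g where "g = fact n / (3/2 :: real) ^ n"
      have g: "g \<ge> 0" by (simp add: g_def)
      define E where "E = exp (- (n / 5000) * \<theta>\<^sup>2)"
      define U where "U = (\<Sum>k\<in>{1..N}. of_nat k ^ n * expm1_prod k (s / of_nat k))"
      define V where "V = (\<Sum>k\<in>{1..N}. of_nat k ^ n * (of_real (1 + real k / K) * exp (- \<eta>) ^ k))"
      define Z where "Z = fact n / \<eta> ^ Suc n + of_real (saddle_decay / n) * (fact (Suc n) / \<eta> ^ Suc (Suc n))"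
      define q where "q = of_real (sqrt (2 * pi) * (sqrt K / 2)) * W"
      have UV: "norm (U - q * V) \<le> 2 / sqrt n * (C1 * C2 * (17 * fact n * E / saddle_decay ^ n + n * g))"
      proof -
        have eq: "U - q * V = (\<Sum>k\<in>{1..N}. of_nat k ^ n * (expm1_prod k (s / of_nat k) - 
             of_real (sqrt (2 * pi) * (sqrt K / 2 * (1 + k / K))) * (exp (- \<eta>) ^ k * W)))"
          unfolding U_def V_def q_def sum_distrib_left sum_subtractf[symmetric]
          by (intro sum.cong refl) (simp add: algebra_simps)
        have "norm (U - q * V) \<le> (\<Sum>k\<in>{1..N}. real k ^ n * (C1 / sqrt K * ((1 + K / k + (k - K)\<^sup>2 / K) * exp (- R) ^ k)))"
          unfolding eq
        proof (rule sum_norm_le)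
          fix k assume k: "k \<in> {1..N}"
          show "norm (of_nat k ^ n * (expm1_prod k (s / of_nat k) - 
             of_real (sqrt (2 * pi) * (sqrt K / 2 * (1 + k / K))) * (exp (- \<eta>) ^ k * W))) \<le>
             real k ^ n * (C1 / sqrt K * ((1 + K / k + (k - K)\<^sup>2 / K) * exp (- R) ^ k))"
            unfolding norm_mult[of "of_nat k ^ n"] norm_power norm_of_nat s_def \<eta>_def W_def R_def
            using k K by (intro mult_left_mono C1) auto
        qed
        also have "\<dots> = C1 / sqrt K * (\<Sum>k\<in>{1..N}. real k ^ n * ((1 + K / k + (k - K)\<^sup>2 / K) * exp (- R) ^ k))"
          unfolding sum_distrib_left by (intro sum.cong refl) (rule mult.left_commute)
        also have "\<dots> \<le> C1 / sqrt K * (C2 * (fact n * ((1 + n * (R - saddle_decay)\<^sup>2) / R ^ n) + n * g))"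
        proof (rule mult_left_mono)
          show "(\<Sum>k\<in>{1..N}. real k ^ n * ((1 + K / k + (k - K)\<^sup>2 / K) * exp (- R) ^ k)) \<le> 
              C2 * (fact n * ((1 + n * (R - saddle_decay)\<^sup>2) / R ^ n) + n * g)"
            unfolding K_def g_def by (rule C2(2)[OF n R' R(2)])
        qed (use C1(1) K in simp)
        also have "\<dots> \<le> C1 / sqrt K * (C2 * (fact n * (17 * E / saddle_decay ^ n) + n * g))"
        proof -
          have "(1 + n * (R - saddle_decay)\<^sup>2) / R ^ n \<le> 17 * exp (- real n * (R - saddle_decay) / 8) / saddle_decay ^ n"
            by (rule one_plus_linear_le_exp_diff[OF sd(1,3) R' R(2)])
          also have "\<dots> \<le> 17 * E / saddle_decay ^ n"
          proof -
            have "(2/3) * \<theta>\<^sup>2 / 384 \<le> ln 2 * \<theta>\<^sup>2 / 384"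
              using ln2_ge_two_thirds by (intro divide_right_mono mult_right_mono) auto
            hence "\<theta>\<^sup>2 / 576 \<le> R - saddle_decay" using R(1) by simp
            hence "n * (\<theta>\<^sup>2 / 576) \<le> n * (R - saddle_decay)" by (intro mult_left_mono) auto
            hence "n * (\<theta>\<^sup>2 / 576) / 8 \<le> n * (R - saddle_decay) / 8" by (rule divide_right_mono) simp
            \<comment> \<open>Here 576 * 8 = 4608 <= 5000: 576 comes from ln 2 >= 2/3 in the bound
              for R, and 8 from \<open>one_plus_linear_le_exp_diff\<close>.\<close>
            moreover have "(n / 5000) * \<theta>\<^sup>2 \<le> n * (\<theta>\<^sup>2 / 576) / 8" by (simp add: field_simps)
            ultimately have "(n / 5000) * \<theta>\<^sup>2 \<le> n * (R - saddle_decay) / 8" by (rule order.trans[rotated])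
            hence "- real n * (R - saddle_decay) / 8 \<le> - (n / 5000) * \<theta>\<^sup>2" by simp
            hence "exp (- real n * (R - saddle_decay) / 8) \<le> E" unfolding E_def by (simp only: exp_le_cancel_iff)
            thus ?thesis using sd by (intro divide_right_mono mult_left_mono) auto
          qed
          finally show ?thesis using C1(1) C2(1) K by (intro mult_left_mono add_right_mono) auto
        qed
        also have "\<dots> = (1 / sqrt K) * (C1 * C2 * (17 * fact n * E / saddle_decay ^ n + n * g))" by simp
        also have "\<dots> \<le> (2 / sqrt n) * (C1 * C2 * (17 * fact n * E / saddle_decay ^ n + n * g))"
          using rK C1(1) C2(1) g sd by (intro mult_right_mono mult_nonneg_nonneg add_nonneg_nonneg) (auto simp: E_def)
        finally show ?thesis .
      qed
      have VZ: "norm (q * V - q * Z) \<le> 6 * C3 * n\<^sup>2 * g"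
      proof -
        have "sqrt (2 * pi) \<le> sqrt (4\<^sup>2)" using pi_less_4 by (intro real_sqrt_le_mono) auto
        hence p: "sqrt (2 * pi) \<le> 4" by simp
        have "1 * sqrt n \<le> sqrt n * sqrt n" using nr by (intro mult_right_mono) auto
        hence "sqrt n \<le> n" using nr by simp
        moreover have "sqrt K \<le> sqrt n" using K by simp
        ultimately have "sqrt K \<le> n" by linarith
        hence "sqrt (2 * pi) * (sqrt K / 2) \<le> 4 * (n / 2)" using p K by (intro mult_mono) auto
        from mult_mono[OF this W] have "sqrt (2 * pi) * (sqrt K / 2) * norm W \<le> 4 * (n / 2) * 3" by simp
        moreover have "norm q = sqrt (2 * pi) * (sqrt K / 2) * norm W"
          unfolding q_def norm_mult norm_of_real using K by simp
        ultimately have nq: "norm q \<le> 4 * (n / 2) * 3" by simp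
        have "norm (q * V - q * Z) = norm q * norm (V - Z)" by (simp add: norm_mult flip: right_diff_distrib)
        also have "\<dots> \<le> (4 * (n / 2) * 3) * (C3 * (n * g))"
          using nq N0[OF N th] unfolding V_def Z_def g_def \<eta>_def by (intro mult_mono) auto
        finally show ?thesis by (simp add: power2_eq_square mult_ac)
      qed
      have main: "q * Z / s ^ n = of_real (sqrt (2 * pi) * sqrt (n / saddle_decay) / 2 * fact n) *
         (saddle_weight 0 \<theta> / saddle_phase \<theta> ^ n + of_real (saddle_decay * (real n + 1) / real n) * (saddle_weight 1 \<theta> / saddle_phase \<theta> ^ n))"
      proof -
        have ph: "saddle_phase \<theta> = s * \<eta>" by (simp add: saddle_phase_of_real s_def \<eta>_def)
        have w: "saddle_weight j \<theta> = W * (1 / \<eta>) ^ Suc j" for j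
          using s \<eta>0 unfolding saddle_weight_def ph by (simp add: s_def[symmetric] W_def)
        show ?thesis unfolding w ph q_def Z_def K_def using s \<eta>0 nr
          by (simp add: power_mult_distrib field_simps)
      qed
      have "(\<Sum>k\<in>{1..N}. of_nat k ^ n * expm1_prod k (s / of_nat k) / s ^ n) = U / s ^ n"
        unfolding U_def by (rule sum_divide_distrib[symmetric])
      hence "norm ((\<Sum>k\<in>{1..N}. of_nat k ^ n * expm1_prod k (s / of_nat k) / s ^ n) - q * Z / s ^ n) = norm ((U - q * Z) / s ^ n)"
        by (simp add: diff_divide_distrib)
      also have "\<dots> = norm (U - q * Z) / ln 2 ^ n" by (simp add: norm_divide norm_power s)
      also have "\<dots> \<le> (2 / sqrt n * (C1 * C2 * (17 * fact n * E / saddle_decay ^ n + n * g)) + 6 * C3 * n\<^sup>2 * g) / ln 2 ^ n"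
      proof (rule divide_right_mono)
        show "norm (U - q * Z) \<le> 2 / sqrt n * (C1 * C2 * (17 * fact n * E / saddle_decay ^ n + n * g)) + 6 * C3 * n\<^sup>2 * g"
          using norm_triangle_le[OF add_mono[OF UV VZ]] by simp
      qed auto
      also have "\<dots> \<le> (C * fact n * (1 / sqrt n * E / saddle_decay ^ n + (real n)\<^sup>2 / (3/2) ^ n)) / ln 2 ^ n"
      proof (intro divide_right_mono)
        define u v where "u = 1 / sqrt n * E / saddle_decay ^ n" and "v = (real n)\<^sup>2 / (3/2) ^ n"
        have uv: "u \<ge> 0" "v \<ge> 0" using sd by (auto simp: u_def v_def E_def)
        have "1 / sqrt n * (real n * g) \<le> n\<^sup>2 * g"
        proof -
          have "1 / sqrt n * real n \<le> 1 * real n" using nr by (intro mult_right_mono) auto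
          also have "\<dots> \<le> n\<^sup>2" using nr by (simp add: power2_eq_square)
          finally show ?thesis using mult_right_mono[OF _ g] by (metis mult.assoc)
        qed
        also have g': "n\<^sup>2 * g = fact n * v" by (simp add: g_def v_def)
        finally have v: "1 / sqrt n * (real n * g) \<le> fact n * v" .
        have "2 / sqrt n * (C1 * C2 * (17 * fact n * E / saddle_decay ^ n + n * g)) + 6 * C3 * n\<^sup>2 * g =
            34 * C1 * C2 * (fact n * u) + 2 * C1 * C2 * (1 / sqrt n * (real n * g)) + 6 * C3 * (n\<^sup>2 * g)"
          by (simp add: u_def algebra_simps add_divide_distrib)
        also have "\<dots> \<le> 34 * C1 * C2 * (fact n * u) + 2 * C1 * C2 * (fact n * v) + 6 * C3 * (fact n * v)"
          unfolding g' using v C1(1) C2(1) by (intro add_mono mult_left_mono order.refl) auto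
        also have "\<dots> \<le> C * (fact n * u) + C * (fact n * v)"
        proof -
          have "34 * C1 * C2 \<le> C" "2 * C1 * C2 + 6 * C3 \<le> C" using C1(1) C2(1) C3(1) by (auto simp: C_def)
          hence "34 * C1 * C2 * (fact n * u) \<le> C * (fact n * u)" "(2 * C1 * C2 + 6 * C3) * (fact n * v) \<le> C * (fact n * v)"
            using uv by (simp_all only: mult_right_mono mult_nonneg_nonneg fact_ge_zero)
          from add_mono[OF this] show ?thesis by (simp only: distrib_right add.assoc)
        qed
        also have "\<dots> = C * fact n * (u + v)" by (simp add: algebra_simps)
        finally show "2 / sqrt n * (C1 * C2 * (17 * fact n * E / saddle_decay ^ n + n * g)) + 6 * C3 * n\<^sup>2 * g \<le>
           C * fact n * (1 / sqrt n * E / saddle_decay ^ n + (real n)\<^sup>2 / (3/2) ^ n)" unfolding u_def v_def by simp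
      qed auto
      finally show "norm ((\<Sum>k\<in>{1..N}. of_nat k ^ n * expm1_prod k (circ (of_real \<theta>) / of_nat k) / circ (of_real \<theta>) ^ n) -
       of_real (sqrt (2 * pi) * sqrt (n / saddle_decay) / 2 * fact n) *
         (saddle_weight 0 \<theta> / saddle_phase \<theta> ^ n + of_real (saddle_decay * (real n + 1) / real n) * (saddle_weight 1 \<theta> / saddle_phase \<theta> ^ n)))
     \<le> C * (fact n / ln 2 ^ n) * (1 / sqrt n * exp (- (n / 5000) * \<theta>\<^sup>2) / saddle_decay ^ n + (real n)\<^sup>2 / (3/2) ^ n)"
        unfolding main s_def[symmetric] E_def by simp
    qed
  qed
qed

section \<open>The asymptotic expansion\<close>

text \<open>Products with k > n start beyond z^n, and the empty product k = 0 contributes only to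
  z^0. The upper limit N is left free so that it can pass the threshold of
  \<open>saddle_integrand_approx\<close>.\<close>

lemma a_coeff_sum:
  assumes "1 \<le> n" "n \<le> N"
  shows "a n = (\<Sum>k\<in>{1..N}. fps_nth (\<Prod>j\<in>{1..k}. fps_exp (of_nat j :: real) - 1) n)"
proof -
  let ?P = "\<lambda>k. \<Prod>j\<in>{1..k}. fps_exp (of_nat j :: real) - 1"
  have "(\<lambda>m. \<Sum>k<m. ?P k) \<longlonglongrightarrow> A" using A_sums by (simp only: sums_def)
  hence "\<forall>\<^sub>F m in sequentially. fps_nth (\<Sum>k<m. ?P k) n = fps_nth A n" by (simp only: tendsto_fps_iff)
  hence "\<forall>\<^sub>F m in sequentially. fps_nth (\<Sum>k<m. ?P k) n = fps_nth A n \<and> Suc N \<le> m"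
    using eventually_ge_at_top[of "Suc N"] by eventually_elim simp
  then obtain m where m: "fps_nth (\<Sum>k<m. ?P k) n = fps_nth A n" "Suc N \<le> m"
    using eventually_happens'[OF sequentially_bot] by blast
  have "a n = (\<Sum>k<m. fps_nth (?P k) n)" using m(1) by (simp only: a_def fps_sum_nth)
  also have "\<dots> = (\<Sum>k\<in>{1..N}. fps_nth (?P k) n)"
  proof (rule sum.mono_neutral_right)
    show "\<forall>k\<in>{..<m} - {1..N}. fps_nth (?P k) n = 0"
    proof
      fix k assume "k \<in> {..<m} - {1..N}"
      hence "k = 0 \<or> n < k" using assms by auto
      thus "fps_nth (?P k) n = 0"
      proof
        assume "n < k" thus ?thesis by (rule prod_nth_eq_0)
      qed (use assms in auto)
    qed
  qed (use m in auto)
  finally show ?thesis .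
qed

text \<open>Integration over the angle turns the Gaussian part of the error, already carrying 1/sqrt
  n, into order 1/n. The main term, sqrt n times an integral of order n^(-1/2), has order 1 after
  the same normalisation.\<close>

lemma a_integral_approx:
  "\<exists>C\<ge>0. \<forall>n\<ge>2. norm (of_real (2 * pi * a n) - of_real (sqrt (2 * pi) * sqrt (n / saddle_decay) / 2 * fact n) *
       (integral {-pi..pi} (\<lambda>\<theta>. saddle_weight 0 (of_real \<theta>) / saddle_phase (of_real \<theta>) ^ n) +
        of_real (saddle_decay * (real n + 1) / real n) * integral {-pi..pi} (\<lambda>\<theta>. saddle_weight 1 (of_real \<theta>) / saddle_phase (of_real \<theta>) ^ n)))
    \<le> C * (fact n / ln 2 ^ n) * (sqrt (5000 * pi) / (n * saddle_decay ^ n) + 2 * pi * (real n)\<^sup>2 / (3/2) ^ n)"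
proof -
  obtain C where C: "C \<ge> 0" "\<And>n. n \<ge> 2 \<Longrightarrow> \<exists>N0. \<forall>N\<ge>N0. \<forall>\<theta>. \<bar>\<theta>\<bar> \<le> pi \<longrightarrow>
     norm ((\<Sum>k\<in>{1..N}. of_nat k ^ n * expm1_prod k (circ (of_real \<theta>) / of_nat k) / circ (of_real \<theta>) ^ n) -
       of_real (sqrt (2 * pi) * sqrt (n / saddle_decay) / 2 * fact n) *
         (saddle_weight 0 \<theta> / saddle_phase \<theta> ^ n + of_real (saddle_decay * (real n + 1) / real n) * (saddle_weight 1 \<theta> / saddle_phase \<theta> ^ n)))
     \<le> C * (fact n / ln 2 ^ n) * (1 / sqrt n * exp (- (n / 5000) * \<theta>\<^sup>2) / saddle_decay ^ n + (real n)\<^sup>2 / (3/2) ^ n)"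
    using saddle_integrand_approx by blast
  show ?thesis
  proof (intro exI[of _ C] conjI C(1) allI impI)
    fix n :: nat assume n: "n \<ge> 2"
    define h where "h = of_real (sqrt (2 * pi) * sqrt (n / saddle_decay) / 2 * fact n :: real) * (1::complex)"
    define t where "t = complex_of_real (saddle_decay * (real n + 1) / real n)"
    define w where "w = (\<lambda>j \<theta>. saddle_weight j (of_real \<theta>) / saddle_phase (of_real \<theta>) ^ n)"
    define f where "f = (\<lambda>k \<theta>. of_nat k ^ n * expm1_prod k (circ (of_real \<theta>) / of_nat k) / circ (of_real \<theta>) ^ n)"
    define M where "M = C * (fact n / ln 2 ^ n)"
    define G where "G = (\<lambda>\<theta>. M * (1 / sqrt n * exp (- (n / 5000) * \<theta>\<^sup>2) / saddle_decay ^ n + (real n)\<^sup>2 / (3/2) ^ n))"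
    have M: "M \<ge> 0" using C by (simp add: M_def)
    have sd: "saddle_decay > 0" using saddle_decay_bounds by simp
    from C(2)[OF n] obtain N0 where N0: "\<And>N \<theta>. N \<ge> N0 \<Longrightarrow> \<bar>\<theta>\<bar> \<le> pi \<Longrightarrow> 
       norm ((\<Sum>k\<in>{1..N}. f k \<theta>) - h * (w 0 \<theta> + t * w 1 \<theta>)) \<le> G \<theta>"
      unfolding f_def h_def w_def t_def G_def M_def mult_1_right by blast
    define N where "N = max N0 n"
    have contw: "continuous_on {-pi..pi} (w j)" for j
      unfolding w_def saddle_weight_def
      by (intro continuous_intros continuous_on_circ_compose continuous_on_saddle_phase ballI saddle_phase_nonzero)
         (use saddle_phase_nonzero in \<open>auto simp: abs_le_iff\<close>)
    have contf: "continuous_on {-pi..pi} (f k)" for k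
      unfolding f_def expm1_prod_def
      by (intro continuous_intros continuous_on_circ_compose) (auto simp: circ_nonzero)
    have intf: "f k integrable_on {-pi..pi}" and intw: "w j integrable_on {-pi..pi}" for j k
      by (intro integrable_continuous_interval contf contw)+
    have "of_real (2 * pi * a n) = (\<Sum>k\<in>{1..N}. integral {-pi..pi} (f k))"
    proof -
      have "of_real (2 * pi * a n) = (\<Sum>k\<in>{1..N}. complex_of_real (2 * pi * fps_nth (\<Prod>j\<in>{1..k}. fps_exp (of_nat j :: real) - 1) n))"
        using a_coeff_sum[of n N] n by (simp add: N_def sum_distrib_left)
      also have "\<dots> = (\<Sum>k\<in>{1..N}. integral {-pi..pi} (f k))"
        unfolding f_def by (intro sum.cong refl expm1_prod_coeff_integral) auto
      finally show ?thesis .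
    qed
    also have "\<dots> = integral {-pi..pi} (\<lambda>\<theta>. \<Sum>k\<in>{1..N}. f k \<theta>)"
      using intf by (intro integral_sum[symmetric]) auto
    finally have 1: "of_real (2 * pi * a n) = integral {-pi..pi} (\<lambda>\<theta>. \<Sum>k\<in>{1..N}. f k \<theta>)" .
    have 2: "h * (integral {-pi..pi} (w 0) + t * integral {-pi..pi} (w 1)) = integral {-pi..pi} (\<lambda>\<theta>. h * (w 0 \<theta> + t * w 1 \<theta>))"
      using intw by (simp add: integral_add integrable_on_mult_right)
    have int1: "(\<lambda>\<theta>. \<Sum>k\<in>{1..N}. f k \<theta>) integrable_on {-pi..pi}" using intf by (intro integrable_sum) auto
    have int2: "(\<lambda>\<theta>. h * (w 0 \<theta> + t * w 1 \<theta>)) integrable_on {-pi..pi}"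
      by (intro integrable_continuous_interval continuous_intros contw)
    have "norm (of_real (2 * pi * a n) - h * (integral {-pi..pi} (w 0) + t * integral {-pi..pi} (w 1))) = 
       norm (integral {-pi..pi} (\<lambda>\<theta>. (\<Sum>k\<in>{1..N}. f k \<theta>) - h * (w 0 \<theta> + t * w 1 \<theta>)))"
      unfolding 1 2 by (subst Henstock_Kurzweil_Integration.integral_diff[OF int1 int2]) simp
    also have "\<dots> \<le> integral {-pi..pi} G"
    proof (rule Henstock_Kurzweil_Integration.integral_norm_bound_integral)
      show "(\<lambda>\<theta>. (\<Sum>k\<in>{1..N}. f k \<theta>) - h * (w 0 \<theta> + t * w 1 \<theta>)) integrable_on {-pi..pi}"
        by (intro Henstock_Kurzweil_Integration.integrable_diff int1 int2)
      show "G integrable_on {-pi..pi}" unfolding G_def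
        by (intro integrable_continuous_interval continuous_intros) (use n sd in auto)
    qed (intro N0, auto simp: N_def)
    also have "\<dots> = M * (1 / sqrt n / saddle_decay ^ n * integral {-pi..pi} (\<lambda>\<theta>. exp (- (n / 5000) * \<theta>\<^sup>2)) + 2 * pi * (real n)\<^sup>2 / (3/2) ^ n)"
    proof -
      have ie: "(\<lambda>\<theta>. exp (- (n / 5000) * \<theta>\<^sup>2)) integrable_on {-pi..pi}"
        by (intro integrable_continuous_interval continuous_intros)
      have "((\<lambda>\<theta>. M * (1 / sqrt n / saddle_decay ^ n * exp (- (n / 5000) * \<theta>\<^sup>2) + (real n)\<^sup>2 / (3/2) ^ n)) has_integral
          M * (1 / sqrt n / saddle_decay ^ n * integral {-pi..pi} (\<lambda>\<theta>. exp (- (n / 5000) * \<theta>\<^sup>2)) +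
            (pi - (- pi)) *\<^sub>R ((real n)\<^sup>2 / (3/2) ^ n))) {-pi..pi}"
        using has_integral_const_real[of "(real n)\<^sup>2 / (3/2) ^ n" "-pi" pi]
        by (intro has_integral_mult_right has_integral_add integrable_integral ie) simp
      hence "(G has_integral
          M * (1 / sqrt n / saddle_decay ^ n * integral {-pi..pi} (\<lambda>\<theta>. exp (- (n / 5000) * \<theta>\<^sup>2)) +
            (pi - (- pi)) *\<^sub>R ((real n)\<^sup>2 / (3/2) ^ n))) {-pi..pi}"
        unfolding G_def by simp
      from integral_unique[OF this] show ?thesis by simp
    qed
    also have "\<dots> \<le> M * (1 / sqrt n / saddle_decay ^ n * (sqrt (5000 * pi) / sqrt n) + 2 * pi * (real n)\<^sup>2 / (3/2) ^ n)"
    proof (intro mult_left_mono add_right_mono M)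
      have "integral {-pi..pi} (\<lambda>\<theta>. exp (- (n / 5000) * \<theta>\<^sup>2)) \<le> sqrt (pi / (n / 5000))"
        using n by (intro integral_gaussian_le) auto
      also have "\<dots> = sqrt (5000 * pi) / sqrt n" by (simp add: mult.commute flip: real_sqrt_divide)
      finally show "integral {-pi..pi} (\<lambda>\<theta>. exp (- (n / 5000) * \<theta>\<^sup>2)) \<le> sqrt (5000 * pi) / sqrt n" .
    qed (use sd in auto)
    also have "1 / sqrt n / saddle_decay ^ n * (sqrt (5000 * pi) / sqrt n) = sqrt (5000 * pi) / (n * saddle_decay ^ n)"
      using n by (simp add: field_simps)
    finally show "norm (of_real (2 * pi * a n) - of_real (sqrt (2 * pi) * sqrt (n / saddle_decay) / 2 * fact n) *
       (integral {-pi..pi} (\<lambda>\<theta>. saddle_weight 0 (of_real \<theta>) / saddle_phase (of_real \<theta>) ^ n) +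
        of_real (saddle_decay * (real n + 1) / real n) * integral {-pi..pi} (\<lambda>\<theta>. saddle_weight 1 (of_real \<theta>) / saddle_phase (of_real \<theta>) ^ n)))
      \<le> C * (fact n / ln 2 ^ n) * (sqrt (5000 * pi) / (n * saddle_decay ^ n) + 2 * pi * (real n)\<^sup>2 / (3/2) ^ n)"
      unfolding h_def t_def w_def M_def by simp
  qed
qed


lemma power_decay_bound:
  "\<exists>C. \<forall>n\<ge>1. (real n)\<^sup>2 * (8/9) ^ n \<le> C / real n"
proof -
  have "(\<lambda>n. real n ^ 3 * (8/9) ^ n) \<longlonglongrightarrow> 0" by real_asymp
  hence "Bseq (\<lambda>n. real n ^ 3 * (8/9) ^ n)" by (intro convergent_imp_Bseq convergentI)
  then obtain C where C: "\<And>n. norm (real n ^ 3 * (8/9) ^ n) \<le> C" by (auto simp: Bseq_def)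
  have "(real n)\<^sup>2 * (8/9) ^ n \<le> C / real n" if "n \<ge> 1" for n
  proof -
    have "(real n)\<^sup>2 * (8/9) ^ n = real n ^ 3 * (8/9) ^ n / real n"
      using that by (simp add: power2_eq_square power3_eq_cube)
    also have "\<dots> \<le> C / real n" using C[of n] by (intro divide_right_mono) auto
    finally show ?thesis .
  qed
  thus ?thesis by blast
qed

text \<open>Two cancellations happen here: sqrt n from the tangent at K against 1/sqrt n from the
  Gaussian integral, and every power of ln 2, as the result cannot depend on the radius of the
  circle.\<close>

lemma saddle_constant:
  assumes "n \<ge> 1"
  shows "sqrt (2 * pi) * sqrt (n / saddle_decay) / 2 * (1 / sqrt (ln 2) * (12 * ln 2 / pi\<^sup>2)) * sqrt (pi / (n * (12 * (ln 2)\<^sup>2 / pi\<^sup>2)))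
    = 6 * sqrt 2 / pi"
proof -
  define l where "l = ln (2::real)"
  have l: "l > 0" by (simp add: l_def)
  have 1: "sqrt (n / saddle_decay) = sqrt n * sqrt 12 * sqrt l / pi"
    by (simp add: saddle_decay_def l_def real_sqrt_divide real_sqrt_mult)
  have 2: "sqrt (pi / (n * (12 * l\<^sup>2 / pi\<^sup>2))) = sqrt pi * pi / (sqrt n * sqrt 12 * l)"
    using l by (simp add: real_sqrt_divide real_sqrt_mult)
  have "sqrt (2 * pi) * (sqrt n * sqrt 12 * sqrt l / pi) / 2 * (1 / sqrt l * (12 * l / pi\<^sup>2)) * (sqrt pi * pi / (sqrt n * sqrt 12 * l)) =
      6 * sqrt 2 * (sqrt pi * sqrt pi) / pi\<^sup>2"
    using l assms by (simp add: real_sqrt_mult field_simps)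
  also have "\<dots> = 6 * sqrt 2 / pi" by (simp add: power2_eq_square)
  finally show ?thesis unfolding 1 l_def[symmetric] 2 .
qed

text \<open>Multiplying by (pi^2/12)^n = (ln 2)^n \<open>saddle_decay\<close>^n turns the Gaussian
  error into O(1/n) and the other one into n^2 (8/9)^n at most, up to constants. Both saddle
  integrals then come with relative error O(1/n).\<close>

lemma a_normalised_approx:
  "\<exists>C\<ge>0. \<forall>n\<ge>2. \<bar>a n * (pi\<^sup>2 / 12) ^ n / fact n - 6 * sqrt 2 / pi\<^sup>2\<bar> \<le> C / n"
proof -
  obtain C where C: "C \<ge> 0" "\<And>n. n \<ge> 2 \<Longrightarrow> norm (of_real (2 * pi * a n) - of_real (sqrt (2 * pi) * sqrt (n / saddle_decay) / 2 * fact n) *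
       (integral {-pi..pi} (\<lambda>\<theta>. saddle_weight 0 (of_real \<theta>) / saddle_phase (of_real \<theta>) ^ n) +
        of_real (saddle_decay * (real n + 1) / real n) * integral {-pi..pi} (\<lambda>\<theta>. saddle_weight 1 (of_real \<theta>) / saddle_phase (of_real \<theta>) ^ n)))
    \<le> C * (fact n / ln 2 ^ n) * (sqrt (5000 * pi) / (n * saddle_decay ^ n) + 2 * pi * (real n)\<^sup>2 / (3/2) ^ n)"
    using a_integral_approx by blast
  have "\<forall>j. \<exists>D. \<forall>n\<ge>1. norm ((pi\<^sup>2 / 12) ^ n * integral {-pi..pi} (\<lambda>\<theta>. saddle_weight j (of_real \<theta>) / saddle_phase (of_real \<theta>) ^ n) -
     saddle_weight j 0 * sqrt (pi / (n * (12 * (ln 2)\<^sup>2 / pi\<^sup>2)))) \<le> D / (n * sqrt n)"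
    using saddle_integral by blast
  from choice[OF this] obtain D where D: "\<forall>j. \<forall>n\<ge>1. norm ((pi\<^sup>2 / 12) ^ n * integral {-pi..pi} (\<lambda>\<theta>. saddle_weight j (of_real \<theta>) / saddle_phase (of_real \<theta>) ^ n) -
     saddle_weight j 0 * sqrt (pi / (n * (12 * (ln 2)\<^sup>2 / pi\<^sup>2)))) \<le> D j / (n * sqrt n)" ..
  obtain B where B: "\<And>n. n \<ge> 1 \<Longrightarrow> (real n)\<^sup>2 * (8/9) ^ n \<le> B / real n" using power_decay_bound by blast
  define q where "q = sqrt (2 * pi) / sqrt saddle_decay / 2"
  define E where "E = C * (sqrt (5000 * pi) + 2 * pi * B) + q * (D 0 + 2 * D 1) + 6 * sqrt 2 / pi"
  have sd: "saddle_decay > 0" "saddle_decay \<le> 4/3" using saddle_decay_bounds by auto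
  have q: "q \<ge> 0" using sd by (simp add: q_def)
  have main: "2 * pi * \<bar>a n * (pi\<^sup>2 / 12) ^ n / fact n - 6 * sqrt 2 / pi\<^sup>2\<bar> \<le> E / n" if n: "n \<ge> 2" for n
  proof -
    have nr: "real n \<ge> 2" using n by simp
    define al where "al = (pi\<^sup>2 / 12) ^ n"
    have al: "al > 0" "al = ln 2 ^ n * saddle_decay ^ n"
      by (simp_all add: al_def saddle_decay_def flip: power_mult_distrib)
    define v where "v = sqrt (pi / (n * (12 * (ln 2)\<^sup>2 / pi\<^sup>2)))"
    define t where "t = saddle_decay * (real n + 1) / real n"
    define h where "h = sqrt (2 * pi) * sqrt (n / saddle_decay) / 2"
    have h: "h = q * sqrt n" by (simp add: h_def q_def real_sqrt_divide)
    define I where "I = (\<lambda>j. integral {-pi..pi} (\<lambda>\<theta>. saddle_weight j (of_real \<theta>) / saddle_phase (of_real \<theta>) ^ n))"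
    define X where "X = a n * al / fact n"
    have t: "0 \<le> t" "t \<le> 2"
    proof -
      show "0 \<le> t" using sd by (simp add: t_def)
      have "t = saddle_decay * (1 + 1 / n)" using nr by (simp add: t_def field_simps)
      also have "\<dots> \<le> 4/3 * (3/2)" using sd nr by (intro mult_mono) auto
      finally show "t \<le> 2" by simp
    qed
    have 1: "norm (of_real (2 * pi * X) - of_real h * (of_real al * I 0 + of_real t * (of_real al * I 1))) \<le> C * (sqrt (5000 * pi) + 2 * pi * B) / n"
    proof -
      have "of_real (2 * pi * X) - of_real h * (of_real al * I 0 + of_real t * (of_real al * I 1)) = 
         of_real (al / fact n) * (of_real (2 * pi * a n) - of_real (h * fact n) * (I 0 + of_real t * I 1))"
        by (simp add: X_def field_simps)
      also have "norm \<dots> = (al / fact n) * norm (of_real (2 * pi * a n) - of_real (h * fact n) * (I 0 + of_real t * I 1))"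
        unfolding norm_mult norm_of_real using al(1) by simp
      also have "\<dots> \<le> (al / fact n) * (C * (fact n / ln 2 ^ n) * (sqrt (5000 * pi) / (n * saddle_decay ^ n) + 2 * pi * (real n)\<^sup>2 / (3/2) ^ n))"
        using C(2)[OF n] al(1) unfolding h_def I_def t_def by (intro mult_left_mono) auto
      also have "\<dots> = C * (sqrt (5000 * pi) / n + 2 * pi * ((real n)\<^sup>2 * (saddle_decay / (3/2)) ^ n))"
        unfolding al(2) using sd nr by (simp add: field_simps power_divide)
      also have "\<dots> \<le> C * (sqrt (5000 * pi) / n + 2 * pi * (B / n))"
      proof -
        have "(saddle_decay / (3/2)) ^ n \<le> (8/9) ^ n" using sd by (intro power_mono) auto
        hence "(real n)\<^sup>2 * (saddle_decay / (3/2)) ^ n \<le> (real n)\<^sup>2 * (8/9) ^ n" by (intro mult_left_mono) auto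
        also have "\<dots> \<le> B / n" using n by (intro B) auto
        finally show ?thesis using C(1) by (intro mult_left_mono add_left_mono) auto
      qed
      also have "\<dots> = C * (sqrt (5000 * pi) + 2 * pi * B) / n" by (simp add: algebra_simps add_divide_distrib)
      finally show ?thesis .
    qed
    \<comment> \<open>At the saddle the two terms of the tangent are equal up to 1/n, since k is
      near K there. Their sum, a factor 2 + 1/n, offsets the 1/2 in the tangent of the square
      root.\<close>
    have w: "saddle_weight 0 0 + of_real t * saddle_weight 1 0 = of_real (1 / sqrt (ln 2) * (12 * ln 2 / pi\<^sup>2) * (2 + 1 / n))"
    proof -
      have sd': "12 * ln 2 / pi\<^sup>2 = 1 / saddle_decay" by (simp add: saddle_decay_def)
      have t': "t / saddle_decay = 1 + 1 / n" using sd nr by (simp add: t_def field_simps)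
      have "saddle_weight 0 0 + of_real t * saddle_weight 1 0 = 
        of_real (1 / sqrt (ln 2) * (1 / saddle_decay) * (1 + t / saddle_decay))"
        unfolding saddle_weight_0 sd' by (simp add: algebra_simps add_divide_distrib)
      thus ?thesis unfolding t' sd' by simp
    qed
    have 2: "norm (of_real h * (of_real al * I 0 + of_real t * (of_real al * I 1)) - of_real (6 * sqrt 2 / pi * (2 + 1 / n))) \<le> q * (D 0 + 2 * D 1) / n"
    proof -
      have hv: "h * (1 / sqrt (ln 2) * (12 * ln 2 / pi\<^sup>2)) * v = 6 * sqrt 2 / pi"
        unfolding h_def v_def using n by (intro saddle_constant) simp
      have "of_real (6 * sqrt 2 / pi * (2 + 1 / n)) = complex_of_real (h * v * (1 / sqrt (ln 2) * (12 * ln 2 / pi\<^sup>2) * (2 + 1 / n)))"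
        unfolding hv[symmetric] by (simp only: mult_ac)
      also have "\<dots> = of_real h * of_real v * (saddle_weight 0 0 + of_real t * saddle_weight 1 0)"
        unfolding w by simp
      finally have "of_real h * (of_real al * I 0 + of_real t * (of_real al * I 1)) - of_real (6 * sqrt 2 / pi * (2 + 1 / n)) = 
         of_real h * ((of_real al * I 0 - saddle_weight 0 0 * of_real v) + of_real t * (of_real al * I 1 - saddle_weight 1 0 * of_real v))"
        by (simp add: algebra_simps)
      also have "norm \<dots> \<le> h * (D 0 / (n * sqrt n) + 2 * (D 1 / (n * sqrt n)))"
      proof -
        have d: "norm (of_real al * I j - saddle_weight j 0 * of_real v) \<le> D j / (n * sqrt n)" for j
          using D[rule_format, of n j] n unfolding al_def I_def v_def by simp
        have "norm (of_real t * (of_real al * I 1 - saddle_weight 1 0 * of_real v)) \<le> 2 * (D 1 / (n * sqrt n))"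
          unfolding norm_mult norm_of_real using t d[of 1] by (intro mult_mono) auto
        note tri = norm_triangle_le[OF add_mono[OF d[of 0] this]]
        have h0: "h \<ge> 0" using h q by simp
        have hn: "norm (complex_of_real h) = h" unfolding norm_of_real using h0 by (rule abs_of_nonneg)
        show ?thesis unfolding norm_mult[of "complex_of_real h"] hn by (rule mult_left_mono[OF tri h0])
      qed
      also have "\<dots> = q * (D 0 + 2 * D 1) / n" unfolding h using nr by (simp add: field_simps)
      finally show ?thesis .
    qed
    have 3: "norm (of_real (6 * sqrt 2 / pi * (2 + 1 / n)) - complex_of_real (6 * sqrt 2 / pi * 2)) \<le> 6 * sqrt 2 / pi / n"
      by (simp add: distrib_left norm_mult norm_divide)
    have "norm (complex_of_real (2 * pi * X) - complex_of_real (6 * sqrt 2 / pi * 2)) \<le>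
       C * (sqrt (5000 * pi) + 2 * pi * B) / n + q * (D 0 + 2 * D 1) / n + 6 * sqrt 2 / pi / n"
      using norm_triangle_le[OF add_mono[OF norm_triangle_le[OF add_mono[OF 1 2]] 3]] by simp
    also have "\<dots> = E / n" by (simp add: E_def add_divide_distrib)
    also have "norm (complex_of_real (2 * pi * X) - complex_of_real (6 * sqrt 2 / pi * 2)) = \<bar>2 * pi * X - 6 * sqrt 2 / pi * 2\<bar>"
      unfolding of_real_diff[symmetric] norm_of_real by simp
    also have "2 * pi * X - 6 * sqrt 2 / pi * 2 = 2 * pi * (X - 6 * sqrt 2 / pi\<^sup>2)"
      by (simp add: power2_eq_square right_diff_distrib)
    also have "\<bar>\<dots>\<bar> = 2 * pi * \<bar>X - 6 * sqrt 2 / pi\<^sup>2\<bar>" by (simp add: abs_mult)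
    finally show ?thesis by (simp add: X_def al_def)
  qed
  have "\<bar>a n * (pi\<^sup>2 / 12) ^ n / fact n - 6 * sqrt 2 / pi\<^sup>2\<bar> \<le> \<bar>E\<bar> / n" if "n \<ge> 2" for n
  proof -
    define y where "y = \<bar>a n * (pi\<^sup>2 / 12) ^ n / fact n - 6 * sqrt 2 / pi\<^sup>2\<bar>"
    have "1 * y \<le> 2 * pi * y" using pi_gt3 by (intro mult_right_mono) (auto simp: y_def)
    also have "\<dots> \<le> E / n" unfolding y_def by (rule main[OF that])
    also have "\<dots> \<le> \<bar>E\<bar> / n" by (intro divide_right_mono) auto
    finally show ?thesis by (simp add: y_def)
  qed
  thus ?thesis by (intro exI[of _ "\<bar>E\<bar>"]) auto
qed

theorem theorem3p1:
  shows "\<exists>\<epsilon> :: nat \<Rightarrow> real. \<epsilon> \<in> O(\<lambda>n. 1 / real n) \<and>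
    (\<forall>\<^sub>F n in sequentially.
      a n = c * \<rho> ^ n * real n powr (real n + 1 / 2) * (1 + \<epsilon> n))"
proof -
  obtain C where C: "C \<ge> 0" "\<And>n. n \<ge> 2 \<Longrightarrow> \<bar>a n * (pi\<^sup>2 / 12) ^ n / fact n - 6 * sqrt 2 / pi\<^sup>2\<bar> \<le> C / n"
    using a_normalised_approx by blast
  define L where "L = 6 * sqrt 2 / pi\<^sup>2"
  have L: "L > 0" by (simp add: L_def)
  define X where "X = (\<lambda>n. a n * (pi\<^sup>2 / 12) ^ n / fact n / L)"
  define S where "S = (\<lambda>n. stirling_ratio n / sqrt (2 * pi))"
  \<comment> \<open>The correction factor 1 + epsilon is exactly the product of the normalised
    Stirling ratio \<open>S\<close> and the normalised coefficient \<open>X\<close>, each of the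
    form 1 + O(1/n).\<close>
  define \<epsilon> where "\<epsilon> = (\<lambda>n. S n * X n - 1)"
  have cL: "c = sqrt (2 * pi) * L"
  proof -
    have "pi powr (3/2) = pi powr (1 + 1/2)" by simp
    also have "\<dots> = pi * sqrt pi" by (subst powr_add) (simp add: powr_half_sqrt)
    finally have "c = 12 / (pi * sqrt pi)" by (simp add: c_def)
    also have "\<dots> = 12 * sqrt pi / (pi * (sqrt pi * sqrt pi))" by (simp del: real_sqrt_mult_self)
    also have "\<dots> = 12 * sqrt pi / pi\<^sup>2" by (simp add: power2_eq_square)
    also have "\<dots> = 6 * (sqrt 2 * sqrt 2) * sqrt pi / pi\<^sup>2" by simp
    also have "\<dots> = sqrt (2 * pi) * L" by (simp only: L_def real_sqrt_mult times_divide_eq_right mult_ac)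
    finally show ?thesis .
  qed
  have eq: "a n = c * \<rho> ^ n * real n powr (real n + 1 / 2) * (1 + \<epsilon> n)" if n: "n \<ge> 1" for n
  proof -
    have e1: "real n powr (real n + 1 / 2) = real n ^ n * sqrt n"
      using n by (simp add: powr_add powr_realpow powr_half_sqrt)
    have e2: "\<rho> ^ n = 1 / (exp (real n) * (pi\<^sup>2 / 12) ^ n)"
      by (simp add: \<rho>_def power_divide power_mult_distrib exp_of_nat_mult[symmetric])
    have e3: "1 + \<epsilon> n = fact n * exp (real n) / (real n ^ n * sqrt n) / sqrt (2 * pi) * (a n * (pi\<^sup>2 / 12) ^ n / fact n / L)"
      by (simp add: \<epsilon>_def S_def X_def stirling_ratio_def)
    show ?thesis unfolding cL e1 e2 e3 using n L by simp
  qed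
  have bound: "\<bar>\<epsilon> n\<bar> \<le> (1 + 2 * C / L) * \<bar>1 / real n\<bar>" if n: "n \<ge> 2" for n
  proof -
    have s: "\<bar>S n - 1\<bar> \<le> 1 / n"
    proof -
      have "\<bar>S n - 1\<bar> = \<bar>stirling_ratio n - sqrt (2 * pi)\<bar> / sqrt (2 * pi)"
        by (simp add: S_def field_simps)
      also have "\<dots> \<le> (sqrt (2 * pi) / n) / sqrt (2 * pi)"
        using n by (intro divide_right_mono stirling_ratio_approx) auto
      finally show ?thesis by simp
    qed
    have x: "\<bar>X n - 1\<bar> \<le> C / L / n"
    proof -
      have "\<bar>X n - 1\<bar> = \<bar>a n * (pi\<^sup>2 / 12) ^ n / fact n - L\<bar> / L"
        using L by (simp add: X_def field_simps)
      also have "\<dots> \<le> (C / n) / L" using C(2)[OF n] L unfolding L_def by (intro divide_right_mono) auto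
      finally show ?thesis by (simp add: field_simps)
    qed
    have "1 / real n \<le> 1" using n by simp
    with s have S2: "\<bar>S n\<bar> \<le> 2" by linarith
    have "\<bar>\<epsilon> n\<bar> = \<bar>S n * (X n - 1) + (S n - 1)\<bar>" by (simp add: \<epsilon>_def algebra_simps)
    also have "\<dots> \<le> \<bar>S n\<bar> * \<bar>X n - 1\<bar> + \<bar>S n - 1\<bar>"
      using abs_triangle_ineq[of "S n * (X n - 1)" "S n - 1"] by (simp add: abs_mult)
    also have "\<dots> \<le> 2 * (C / L / n) + 1 / n" using S2 x s by (intro add_mono mult_mono) auto
    also have "\<dots> = (1 + 2 * C / L) * \<bar>1 / real n\<bar>" by (simp add: algebra_simps add_divide_distrib)
    finally show ?thesis .
  qed
  show ?thesis
  proof (intro exI[of _ \<epsilon>] conjI)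
    show "\<epsilon> \<in> O(\<lambda>n. 1 / real n)"
      by (rule bigoI[of _ "1 + 2 * C / L"], rule eventually_mono[OF eventually_ge_at_top[of 2]]) (use bound in auto)
    show "\<forall>\<^sub>F n in sequentially. a n = c * \<rho> ^ n * real n powr (real n + 1 / 2) * (1 + \<epsilon> n)"
      by (rule eventually_mono[OF eventually_ge_at_top[of 1]]) (use eq in auto)
  qed
qed

end
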